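(* Assume the Riemann Hypothesis. There exists an absolute constant $c>0$ such that $m(v/2\pi)\le m'(v^2)$ for all $v$ with $0<v<c$.
   Context: Write $s=\sigma+it$. Let $\rho'=\beta'+i\gamma'$ denote a generic zero of $\zeta'(s)$, and order the ordinates of the zeros of $\zeta(s)$ with positive ordinate (counted with multiplicity) as $0<\gamma_1\le\gamma_2\le\cdots$. Let $w(x)$ be the indicator function of the interval $[0,1]$. For $v>0$ define $$m'(v)=\liminf_{T\to\infty}\frac{2\pi}{T\log T}\sum_{T\le \gamma'\le 2T} w\Big(\frac{(\beta'-1/2)\log T}{v}\Big),$$ where the sum is over zeros $\rho'=\beta'+i\gamma'$ of $\zeta'(s)$ (with multiplicity), and $$m(v)=\liminf_{T\to\infty}\frac{2\pi}{T\log T}\sum_{T\le \gamma_n\le 2T} w\Big(\frac{(\gamma_{n+1}-\gamma_n)\log T}{2\pi v}\Big).$$ *)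

theory Defs
  imports "HOL-Complex_Analysis.Complex_Analysis"
begin

section \<open>The Riemann zeta function\<close>

text \<open>
  The Riemann zeta function is the analytic continuation to \<open>\<complex> - {1}\<close> of the Dirichlet
  series. The value at the pole is fixed to be 0 so that the description is unique.
\<close>

definition zeta :: "complex \<Rightarrow> complex" where
  "zeta = (THE f. f holomorphic_on - {1} \<and> f 1 = 0 \<and>
             (\<forall>s. 1 < Re s \<longrightarrow> (\<lambda>n. of_nat (Suc n) powr (- s)) sums f s))"

subsection \<open>Existence and uniqueness of the continuation\<close>

text \<open>
  With \<open>Z\<close> the Dirichlet series and \<open>W s = (s - 1) * Z s\<close>, summing the binomial expansion of
  \<open>(n + 1) powr (1 - s) - n powr (1 - s)\<close> over \<open>n\<close> expresses \<open>W s\<close> through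
  \<open>W (s + 1), W (s + 2), \<dots>\<close> and a remainder series that converges further to the left.
\<close>

lemma holomorphic_series_local:
  fixes f :: "nat \<Rightarrow> complex \<Rightarrow> complex"
  assumes S: "open S" and hol: "\<And>n. f n holomorphic_on S"
    and bnd: "\<And>x. x \<in> S \<Longrightarrow> \<exists>d h. 0 < d \<and> summable (h :: nat \<Rightarrow> real) \<and>
                (\<forall>n. \<forall>y\<in>ball x d \<inter> S. norm (f n y) \<le> h n)"
  shows "(\<lambda>x. \<Sum>n. f n x) holomorphic_on S" and "\<And>x. x \<in> S \<Longrightarrow> summable (\<lambda>n. f n x)"
proof -
  have "\<exists>g g'. \<forall>x\<in>S. ((\<lambda>n. f n x) sums g x) \<and> ((\<lambda>n. deriv (f n) x) sums g' x) \<and>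
          (g has_field_derivative g' x) (at x)"
  proof (rule series_and_derivative_comparison_local[OF S])
    show "(f n has_field_derivative deriv (f n) x) (at x)" if "x \<in> S" for n x
      by (rule holomorphic_derivI[OF hol S that])
    show "\<exists>d h. 0 < d \<and> summable (h :: nat \<Rightarrow> real) \<and>
            (\<forall>\<^sub>F n in sequentially. \<forall>y\<in>ball x d \<inter> S. norm (f n y) \<le> h n)" if "x \<in> S" for x
      using bnd[OF that] by (fast intro: always_eventually)
  qed
  then obtain g g' where g: "\<And>x. x \<in> S \<Longrightarrow> (\<lambda>n. f n x) sums g x"
      "\<And>x. x \<in> S \<Longrightarrow> (g has_field_derivative g' x) (at x)"
    by blast
  have "g holomorphic_on S"
    using g(2) S by (auto simp: holomorphic_on_open)
  then show "(\<lambda>x. \<Sum>n. f n x) holomorphic_on S"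
    by (rule holomorphic_transform) (use g(1) sums_unique in blast)
  show "\<And>x. x \<in> S \<Longrightarrow> summable (\<lambda>n. f n x)"
    using g(1) sums_summable by blast
qed

lemma open_Re_gt: "open {s. a < Re s}" and convex_Re_gt: "convex {s. a < Re s}"
  by (auto simp: open_halfspace_Re_gt convex_halfspace_Re_gt)

lemma norm_Suc_powr: "norm (of_nat (Suc n) powr s :: complex) = real (Suc n) powr Re s"
  using norm_powr_real_powr[of "of_nat (Suc n)" s] by (simp del: of_nat_Suc)

lemma summable_Suc_powr: "a < - 1 \<Longrightarrow> summable (\<lambda>n. real (Suc n) powr a)"
  using summable_real_powr_iff[of a] by (subst summable_Suc_iff) auto

definition dirichlet1 :: "complex \<Rightarrow> complex" where
  "dirichlet1 s = (\<Sum>n. of_nat (Suc n) powr (- s))"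

lemma summable_dirichlet1:
  assumes "1 < Re s" shows "summable (\<lambda>n. of_nat (Suc n) powr (- s) :: complex)"
  by (rule summable_norm_cancel) (use assms summable_Suc_powr[of "- Re s"] in \<open>simp add: norm_Suc_powr del: of_nat_Suc\<close>)

lemma holomorphic_dirichlet1: "dirichlet1 holomorphic_on {s. 1 < Re s}"
  unfolding dirichlet1_def
proof (rule holomorphic_series_local(1)[OF open_Re_gt])
  show "(\<lambda>s. of_nat (Suc n) powr (- s) :: complex) holomorphic_on {s. 1 < Re s}" for n
    by (intro holomorphic_intros) (auto simp del: of_nat_Suc)
next
  fix x :: complex assume "x \<in> {s. 1 < Re s}"
  then have x: "1 < Re x" by simp
  define d where "d = (Re x - 1) / 2"
  have d: "d > 0" using x by (simp add: d_def)
  have "norm (of_nat (Suc n) powr (- y) :: complex) \<le> real (Suc n) powr (- (1 + d))"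
    if "y \<in> ball x d" for n y
  proof -
    have "\<bar>Re (x - y)\<bar> < d" using that abs_Re_le_cmod[of "x - y"] by (simp add: dist_norm)
    then have "1 + d \<le> Re y" by (auto simp: d_def abs_if field_simps split: if_splits)
    then show ?thesis unfolding norm_Suc_powr by (intro powr_mono) auto
  qed
  then show "\<exists>d h. 0 < d \<and> summable (h :: nat \<Rightarrow> real) \<and>
      (\<forall>n. \<forall>y\<in>ball x d \<inter> {s. 1 < Re s}. norm (of_nat (Suc n) powr (- y) :: complex) \<le> h n)"
    using d summable_Suc_powr[of "- (1 + d)"] by (intro exI[of _ d] exI[of _ "\<lambda>n. real (Suc n) powr (- (1 + d))"]) auto
qed

definition powr_rem :: "nat \<Rightarrow> nat \<Rightarrow> complex \<Rightarrow> complex" where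
  "powr_rem K n s = of_nat (Suc (Suc n)) powr (1 - s) -
     (\<Sum>j\<le>K. ((1 - s) gchoose j) * of_nat (Suc n) powr (1 - s - of_nat j))"

lemma holomorphic_gchoose:
  "f holomorphic_on A \<Longrightarrow> (\<lambda>s. f s gchoose j) holomorphic_on A"
  unfolding gbinomial_prod_rev by (intro holomorphic_intros) auto

lemma powr_rem_bound:
  assumes "- real K \<le> Re s"
  shows "norm (powr_rem K n s) \<le>
    norm (\<Prod>l<Suc K. (1 - s) - of_nat l) * real (Suc n) powr (- Re s - real K)"
proof -
  let ?a = "1 - s"
  define f where "f = (\<lambda>i x. (\<Prod>l<i. ?a - of_nat l) * x powr (?a - of_nat i))"
  let ?S = "closed_segment (complex_of_real (real (Suc n))) (complex_of_real (real (Suc (Suc n))))"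
  define B where "B = norm (\<Prod>l<Suc K. ?a - of_nat l) * real (Suc n) powr (- Re s - real K)"
  have S: "\<exists>t. x = of_real t \<and> real (Suc n) \<le> t" if "x \<in> ?S" for x
    using that unfolding closed_segment_of_real by (auto simp: closed_segment_eq_real_ivl)
  have "norm (f 0 (of_real (real (Suc (Suc n)))) - (\<Sum>i\<le>K. f i (of_real (real (Suc n))) *
          (of_real (real (Suc (Suc n))) - of_real (real (Suc n))) ^ i / fact i))
        \<le> B * norm (of_real (real (Suc (Suc n))) - of_real (real (Suc n)) :: complex) ^ Suc K / fact K"
  proof (rule complex_Taylor)
    show "convex ?S" by simp
  next
    fix i x assume x: "x \<in> ?S"
    obtain t where t: "x = of_real t" "real (Suc n) \<le> t" using S[OF x] by blast
    then have nz: "x \<notin> \<real>\<^sub>\<le>\<^sub>0" by auto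
    show "(f i has_field_derivative f (Suc i) x) (at x within ?S)"
      unfolding f_def
      by (rule has_field_derivative_at_within)
         (use nz in \<open>auto intro!: derivative_eq_intros simp: algebra_simps\<close>)
  next
    fix x assume x: "x \<in> ?S"
    obtain t where t: "x = of_real t" "real (Suc n) \<le> t" using S[OF x] by blast
    have "norm (x powr (?a - of_nat (Suc K))) = t powr (Re (?a - of_nat (Suc K)))"
      using t by (simp add: norm_powr_real_powr)
    also have "\<dots> \<le> real (Suc n) powr (Re (?a - of_nat (Suc K)))"
      using t assms by (intro powr_mono2') auto
    also have "Re (?a - of_nat (Suc K)) = - Re s - real K" by simp
    finally show "norm (f (Suc K) x) \<le> B"
      unfolding f_def B_def norm_mult by (intro mult_left_mono) auto
  qed auto
  also have "f 0 (of_real (real (Suc (Suc n)))) - (\<Sum>i\<le>K. f i (of_real (real (Suc n))) *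
          (of_real (real (Suc (Suc n))) - of_real (real (Suc n))) ^ i / fact i) = powr_rem K n s"
    unfolding f_def powr_rem_def gbinomial_prod_rev atLeast0LessThan
    by (simp add: field_simps)
  also have "B * norm (of_real (real (Suc (Suc n))) - of_real (real (Suc n)) :: complex) ^ Suc K / fact K
      = B / fact K" by simp
  also have "\<dots> \<le> B"
    using divide_left_mono[of 1 "fact K" B] by (simp add: B_def)
  finally show ?thesis unfolding B_def .
qed

lemma powr_rem_series:
  shows "(\<lambda>s. \<Sum>n. powr_rem K n s) holomorphic_on {s. 1 - real K < Re s}"
    and "1 - real K < Re s \<Longrightarrow> summable (\<lambda>n. powr_rem K n s)"
proof -
  have hol: "powr_rem K n holomorphic_on {s. 1 - real K < Re s}" for n
    unfolding powr_rem_def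
    by (intro holomorphic_intros holomorphic_gchoose) (auto simp del: of_nat_Suc)
  have bnd: "\<exists>d h. 0 < d \<and> summable (h :: nat \<Rightarrow> real) \<and>
      (\<forall>n. \<forall>y\<in>ball x d \<inter> {s. 1 - real K < Re s}. norm (powr_rem K n y) \<le> h n)"
    if "x \<in> {s. 1 - real K < Re s}" for x
  proof -
    have x: "1 - real K < Re x" using that by simp
    define d where "d = (Re x - (1 - real K)) / 2"
    have d: "d > 0" using x by (simp add: d_def)
    have "compact ((\<lambda>s. \<Prod>l<Suc K. (1 - s) - of_nat l :: complex) ` cball x d)"
      by (intro compact_continuous_image continuous_intros) auto
    from compact_imp_bounded[OF this]
    obtain C where C: "\<And>y. y \<in> cball x d \<Longrightarrow> norm (\<Prod>l<Suc K. (1 - y) - of_nat l) \<le> C"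
      unfolding bounded_iff by blast
    have "norm (powr_rem K n y) \<le> C * real (Suc n) powr (- (1 + d))" if y: "y \<in> ball x d" for n y
    proof -
      have "\<bar>Re (x - y)\<bar> < d" using y abs_Re_le_cmod[of "x - y"] by (simp add: dist_norm)
      moreover have "2 * d = Re x - (1 - real K)" by (simp add: d_def)
      ultimately have Re: "1 - real K + d \<le> Re y" unfolding minus_complex.sel by linarith
      have "norm (powr_rem K n y) \<le>
          norm (\<Prod>l<Suc K. (1 - y) - of_nat l) * real (Suc n) powr (- Re y - real K)"
        by (rule powr_rem_bound) (use Re d in auto)
      also have "\<dots> \<le> C * real (Suc n) powr (- (1 + d))"
      proof (rule mult_mono)
        show "norm (\<Prod>l<Suc K. (1 - y) - of_nat l) \<le> C" using C y by auto
        show "real (Suc n) powr (- Re y - real K) \<le> real (Suc n) powr (- (1 + d))"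
          using Re by (intro powr_mono) auto
        show "0 \<le> C" using order_trans[OF norm_ge_zero C[of x]] d by simp
      qed auto
      finally show ?thesis .
    qed
    moreover have "summable (\<lambda>n. C * real (Suc n) powr (- (1 + d)))"
      using d by (intro summable_mult summable_Suc_powr) auto
    ultimately show ?thesis
      using d by (intro exI[of _ d] exI[of _ "\<lambda>n. C * real (Suc n) powr (- (1 + d))"]) auto
  qed
  show "(\<lambda>s. \<Sum>n. powr_rem K n s) holomorphic_on {s. 1 - real K < Re s}"
    by (rule holomorphic_series_local(1)[OF open_Re_gt hol bnd])
  show "summable (\<lambda>n. powr_rem K n s)" if "1 - real K < Re s"
    by (rule holomorphic_series_local(2)[OF open_Re_gt hol bnd]) (use that in auto)
qed

lemma dirichlet1_recurrence:
  assumes s: "1 < Re s" and K: "1 \<le> K"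
  shows "(s - 1) * dirichlet1 s = 1 + (\<Sum>n. powr_rem K n s) -
    (\<Sum>j\<in>{2..K}. ((1 - s) gchoose (j - 1)) / of_nat j *
       ((s + of_nat (j - 1) - 1) * dirichlet1 (s + of_nat (j - 1))))"
proof -
  let ?p = "\<lambda>n. of_nat (Suc n) powr (1 - s) :: complex"
  have "(\<lambda>n. norm (?p n)) \<longlonglongrightarrow> 0"
    unfolding norm_Suc_powr
    by (rule tendsto_neg_powr)
       (use s filterlim_compose[OF filterlim_real_sequentially filterlim_Suc] in \<open>auto simp: o_def\<close>)
  then have "?p \<longlonglongrightarrow> 0" by (simp add: tendsto_norm_zero_iff)
  then have "(\<lambda>n. ?p (Suc n) - ?p n) sums (0 - ?p 0)" by (rule telescope_sums)
  then have tel: "(\<lambda>n. ?p (Suc n) - ?p n) sums (- 1)" by simp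
  have trm: "(\<lambda>n. ((1 - s) gchoose j) * of_nat (Suc n) powr (1 - s - of_nat j))
      sums (((1 - s) gchoose j) * dirichlet1 (s + of_nat (j - 1)))" if "j \<ge> 1" for j
  proof (rule sums_mult)
    have "(\<lambda>n. of_nat (Suc n) powr (- (s + of_nat (j - 1))) :: complex) sums dirichlet1 (s + of_nat (j - 1))"
      unfolding dirichlet1_def by (rule summable_sums, rule summable_dirichlet1) (use s in simp)
    also have "- (s + of_nat (j - 1)) = 1 - s - of_nat j" using that by (simp add: of_nat_diff)
    finally show "(\<lambda>n. of_nat (Suc n) powr (1 - s - of_nat j)) sums dirichlet1 (s + of_nat (j - 1))" .
  qed
  have split: "(\<Sum>j\<le>K. g j) = g 0 + (\<Sum>j\<in>{1..K}. g j)" for g :: "nat \<Rightarrow> complex"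
    by (simp add: atMost_atLeast0 sum.atLeast_Suc_atMost)
  have "(\<lambda>n. (?p (Suc n) - ?p n) - (\<Sum>j\<in>{1..K}. ((1 - s) gchoose j) * of_nat (Suc n) powr (1 - s - of_nat j)))
      sums (- 1 - (\<Sum>j\<in>{1..K}. ((1 - s) gchoose j) * dirichlet1 (s + of_nat (j - 1))))"
    by (intro sums_diff tel sums_sum trm) auto
  also have "(\<lambda>n. (?p (Suc n) - ?p n) - (\<Sum>j\<in>{1..K}. ((1 - s) gchoose j) * of_nat (Suc n) powr (1 - s - of_nat j)))
      = (\<lambda>n. powr_rem K n s)"
    unfolding powr_rem_def split by (simp add: algebra_simps)
  finally have *: "(\<Sum>n. powr_rem K n s) =
      - 1 - (\<Sum>j\<in>{1..K}. ((1 - s) gchoose j) * dirichlet1 (s + of_nat (j - 1)))"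
    by (simp add: sums_iff)
  have "(\<Sum>j\<in>{1..K}. ((1 - s) gchoose j) * dirichlet1 (s + of_nat (j - 1))) =
      (1 - s) * dirichlet1 s + (\<Sum>j\<in>{2..K}. ((1 - s) gchoose j) * dirichlet1 (s + of_nat (j - 1)))"
    using K by (simp add: sum.atLeast_Suc_atMost numeral_2_eq_2)
  also have "(\<Sum>j\<in>{2..K}. ((1 - s) gchoose j) * dirichlet1 (s + of_nat (j - 1))) =
      - (\<Sum>j\<in>{2..K}. ((1 - s) gchoose (j - 1)) / of_nat j *
       ((s + of_nat (j - 1) - 1) * dirichlet1 (s + of_nat (j - 1))))"
    unfolding sum_negf[symmetric]
  proof (rule sum.cong)
    fix j assume "j \<in> {2..K}"
    then obtain i where i: "j = Suc i" by (cases j) auto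
    have "((1 - s) gchoose Suc i) * of_nat (Suc i) = ((1 - s) gchoose i) * (1 - s - of_nat i)"
      using gbinomial_absorb_comp[of "1 - s" i] gbinomial_mult_1[of "1 - s" i]
      by (simp add: algebra_simps)
    then have E: "(1 - s) gchoose Suc i = ((1 - s) gchoose i) * (1 - s - of_nat i) / of_nat (Suc i)"
      by (simp add: eq_divide_eq del: of_nat_Suc)
    show "((1 - s) gchoose j) * dirichlet1 (s + of_nat (j - 1)) =
       - (((1 - s) gchoose (j - 1)) / of_nat j *
       ((s + of_nat (j - 1) - 1) * dirichlet1 (s + of_nat (j - 1))))"
      unfolding i diff_Suc_1 E by (simp only: divide_inverse) (simp add: algebra_simps del: of_nat_Suc)
  qed simp
  finally have A: "(\<Sum>j\<in>{1..K}. ((1 - s) gchoose j) * dirichlet1 (s + of_nat (j - 1))) =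
      (1 - s) * dirichlet1 s + - (\<Sum>j\<in>{2..K}. ((1 - s) gchoose (j - 1)) / of_nat j *
       ((s + of_nat (j - 1) - 1) * dirichlet1 (s + of_nat (j - 1))))" .
  show ?thesis unfolding * A by (simp only: left_diff_distrib) simp
qed

lemma zeta_halfplane_continuation:
  "\<exists>W. W holomorphic_on {s. 1 - real m < Re s} \<and> (\<forall>s. 1 < Re s \<longrightarrow> W s = (s - 1) * dirichlet1 s)"
proof (induction m)
  case 0
  show ?case
    by (rule exI[of _ "\<lambda>s. (s - 1) * dirichlet1 s"]) (auto intro!: holomorphic_intros holomorphic_dirichlet1)
next
  case (Suc m)
  then obtain W where W: "W holomorphic_on {s. 1 - real m < Re s}"
    "\<And>s. 1 < Re s \<Longrightarrow> W s = (s - 1) * dirichlet1 s" by blast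
  let ?K = "Suc m"
  define V where "V = (\<lambda>s. 1 + (\<Sum>n. powr_rem ?K n s) -
    (\<Sum>j\<in>{2..?K}. ((1 - s) gchoose (j - 1)) / of_nat j * W (s + of_nat (j - 1))))"
  have Wj: "(\<lambda>s. W (s + of_nat (j - 1))) holomorphic_on {s. 1 - real (Suc m) < Re s}"
    if "j \<in> {2..?K}" for j
  proof -
    have "W \<circ> (\<lambda>s. s + of_nat (j - 1)) holomorphic_on {s. 1 - real (Suc m) < Re s}"
      by (rule holomorphic_on_compose_gen[OF _ W(1)]) (use that in \<open>auto intro!: holomorphic_intros\<close>)
    then show ?thesis by (simp add: o_def)
  qed
  have "V holomorphic_on {s. 1 - real (Suc m) < Re s}"
    unfolding V_def by (intro holomorphic_intros holomorphic_gchoose powr_rem_series Wj) auto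
  moreover have "V s = (s - 1) * dirichlet1 s" if s: "1 < Re s" for s
    unfolding V_def using s by (subst dirichlet1_recurrence[OF s, of ?K]) (auto simp: W(2) intro!: sum.cong)
  ultimately show ?case by blast
qed

lemma zeta_continuation:
  "\<exists>f. f holomorphic_on - {1} \<and> f 1 = 0 \<and>
     (\<forall>s. 1 < Re s \<longrightarrow> (\<lambda>n. of_nat (Suc n) powr (- s)) sums f s)"
proof -
  obtain W where W: "\<And>m. W m holomorphic_on {s. 1 - real m < Re s}"
    "\<And>m s. 1 < Re s \<Longrightarrow> W m s = (s - 1) * dirichlet1 s"
    using zeta_halfplane_continuation by metis
  have agree: "W m s = W n s" if "m \<le> n" "1 - real m < Re s" for m n s
  proof (rule analytic_continuation_open
      [where s = "{s. 1 < Re s}" and s' = "{s. 1 - real m < Re s}" and f = "W m" and g = "W n"])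
    show "{s. 1 < Re s} \<noteq> {}" by (auto intro: exI[of _ 2])
    show "W n holomorphic_on {s. 1 - real m < Re s}"
      using W(1)[of n] by (rule holomorphic_on_subset) (use that in auto)
  qed (use that W convex_connected[OF convex_Re_gt] in \<open>auto simp: open_Re_gt\<close>)
  define M where "M = (\<lambda>s. nat \<lceil>2 - Re s\<rceil>)"
  define f where "f = (\<lambda>s. if s = 1 then 0 else W (M s) s / (s - 1))"
  have M: "1 - real (M s) < Re s" for s unfolding M_def by linarith
  have f_eq: "f s = W n s / (s - 1)" if "s \<noteq> 1" "1 - real n < Re s" for s n
  proof -
    have "W (M s) s = W n s"
      using agree[of n "M s" s] agree[of "M s" n s] that M[of s] by (metis nle_le)
    then show ?thesis using that by (simp add: f_def)
  qed
  have "f holomorphic_on - {1}"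
  proof -
    have "f holomorphic_on (\<Union>n. {s. 1 - real n < Re s} - {1})"
    proof (rule holomorphic_on_UN_open)
      fix n
      have "(\<lambda>s. W n s / (s - 1)) holomorphic_on {s. 1 - real n < Re s} - {1}"
        using W(1)[of n] by (intro holomorphic_intros) (auto intro: holomorphic_on_subset)
      then show "f holomorphic_on {s. 1 - real n < Re s} - {1}"
        by (rule holomorphic_transform) (auto simp: f_eq[of _ n])
    qed (auto intro!: open_Diff open_Re_gt)
    moreover have "- {1} \<subseteq> (\<Union>n. {s. 1 - real n < Re s} - {1})" using M by auto
    ultimately show ?thesis by (rule holomorphic_on_subset)
  qed
  moreover have "(\<lambda>n. of_nat (Suc n) powr (- s)) sums f s" if s: "1 < Re s" for s
  proof -
    have "s \<noteq> 1" using s by auto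
    then have "f s = dirichlet1 s" using s W(2)[OF s, of 0] f_eq[of s 0] by simp
    then show ?thesis
      using summable_sums[OF summable_dirichlet1[OF s]] by (simp add: dirichlet1_def)
  qed
  ultimately show ?thesis by (intro exI[of _ f]) (auto simp: f_def)
qed

lemma zeta_continuation_unique:
  "\<exists>!f. f holomorphic_on - {1} \<and> f 1 = 0 \<and>
     (\<forall>s. 1 < Re s \<longrightarrow> (\<lambda>n. of_nat (Suc n) powr (- s)) sums f s)"
proof (rule ex_ex1I[OF zeta_continuation])
  fix f g :: "complex \<Rightarrow> complex"
  assume f: "f holomorphic_on - {1} \<and> f 1 = 0 \<and>
     (\<forall>s. 1 < Re s \<longrightarrow> (\<lambda>n. of_nat (Suc n) powr (- s)) sums f s)"
  assume g: "g holomorphic_on - {1} \<and> g 1 = 0 \<and>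
     (\<forall>s. 1 < Re s \<longrightarrow> (\<lambda>n. of_nat (Suc n) powr (- s)) sums g s)"
  have "f s = g s" if "s \<in> - {1}" for s
  proof (rule analytic_continuation_open
      [where s = "{s. 1 < Re s}" and s' = "- {1}" and f = f and g = g])
    show "{s. 1 < Re s} \<noteq> {}" by (auto intro: exI[of _ 2])
    show "connected (- {1 :: complex})" by (rule connected_punctured_universe) simp
    show "f z = g z" if "z \<in> {s. 1 < Re s}" for z
      using f g that sums_unique2 by blast
  qed (use f g that in \<open>auto simp: open_Re_gt\<close>)
  then show "f = g" using f g by (intro ext) (metis ComplI singletonD)
qed

lemma zeta_holomorphic: "zeta holomorphic_on - {1}"
  and zeta_sums: "1 < Re s \<Longrightarrow> (\<lambda>n. of_nat (Suc n) powr (- s)) sums zeta s"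
  using theI'[OF zeta_continuation_unique] unfolding zeta_def[symmetric] by auto


section \<open>The Riemann Hypothesis and the zeros\<close>

definition riemann_hypothesis :: bool where
  "riemann_hypothesis \<longleftrightarrow> (\<forall>s. zeta s = 0 \<and> 0 < Re s \<and> Re s < 1 \<longrightarrow> Re s = 1 / 2)"

definition zero_mult :: "(complex \<Rightarrow> complex) \<Rightarrow> complex \<Rightarrow> nat" where
  "zero_mult f z = nat (zorder f z)"

definition zero_count :: "real \<Rightarrow> nat" where
  "zero_count t = (\<Sum>\<rho> | zeta \<rho> = 0 \<and> 0 < Im \<rho> \<and> Im \<rho> \<le> t. zero_mult zeta \<rho>)"

text \<open>
  \<open>zero_ordinate n\<close>, for \<open>n \<ge> 1\<close>, is the \<open>n\<close>-th term of the nondecreasing enumeration with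
  multiplicity of the positive ordinates of zeros of zeta: the least height up to which there are
  at least \<open>n\<close> zeros. (The index 0 carries no meaning.)
\<close>

definition zero_ordinate :: "nat \<Rightarrow> real" where
  "zero_ordinate n = Inf {t. 0 < t \<and> n \<le> zero_count t}"

abbreviation unit_window :: "real \<Rightarrow> real" where
  "unit_window \<equiv> indicator {0..1}"

text \<open>
  The sum over zeros of the derivative is an \<open>infsum\<close> because the window cuts a possibly unbounded
  horizontal strip down to a compact rectangle, hence to finitely many nonzero terms. (Where
  \<open>deriv zeta\<close> has no meaning, namely at 1, the ordinate is 0, which is irrelevant for large \<open>T\<close>.)
\<close>

definition m_deriv :: "real \<Rightarrow> ereal" where
  "m_deriv v = Liminf at_top (\<lambda>T::real. ereal (2 * pi / (T * ln T) *
     (\<Sum>\<^sub>\<infinity>\<rho>\<in>{\<rho>. deriv zeta \<rho> = 0 \<and> T \<le> Im \<rho> \<and> Im \<rho> \<le> 2 * T}.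
        real (zero_mult (deriv zeta) \<rho>) * unit_window ((Re \<rho> - 1 / 2) * ln T / v))))"

definition m_gap :: "real \<Rightarrow> ereal" where
  "m_gap v = Liminf at_top (\<lambda>T::real. ereal (2 * pi / (T * ln T) *
     (\<Sum>n | 1 \<le> n \<and> T \<le> zero_ordinate n \<and> zero_ordinate n \<le> 2 * T.
        unit_window ((zero_ordinate (Suc n) - zero_ordinate n) * ln T / (2 * pi * v)))))"

end

theory Submission
  imports Defs "HOL-Real_Asymp.Real_Asymp"
begin

text \<open>
  Every gap between consecutive ordinates \<open>a < b\<close> of length at most \<open>v / ln T\<close> contains, for small \<open>v\<close>,
  the ordinate of a zero of the derivative at distance at most \<open>v\<^sup>2 / ln T\<close> from the critical line,
  and a zero of multiplicity \<open>m\<close> accounts for \<open>m - 1\<close> gaps of length 0 and is a zero of multiplicity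
  \<open>m - 1\<close> of the derivative. So the two counts differ by at most 1, from the gap straddling \<open>2 * T\<close>.

  For the zero in the gap write the logarithmic derivative of zeta near \<open>1/2 + \<i> * a\<close> as
  \<open>\<Sum> m / (s - \<rho>) + E s\<close> with \<open>E\<close> Lipschitz with constant \<open>O(ln T)\<close> (Jensen and Borel-Caratheodory).
  By the functional equation its real part on the critical line lies in \<open>[- ln t, 0)\<close>, while its
  imaginary part runs through all real values on the gap. At a point \<open>t\<close> where the imaginary part vanishes the
  logarithmic derivative is \<open>- l\<close> with \<open>0 < l \<le> ln t\<close>, and its derivative is nearly
  \<open>A = \<Sum> m / (t - \<gamma>)\<^sup>2 \<ge> 8 / (b - a)\<^sup>2\<close>, so there is a zero close to \<open>1/2 + \<i> * t + l / A\<close>.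
\<close>

section \<open>Size and non-vanishing of zeta\<close>

text \<open>All estimates are local at one height: a disc about \<open>2 + \<i> * a\<close>, where
  zeta is bounded away from 0, reaches past the critical line, and both the number of zeros in it
  and the regular part are governed by \<open>ln a\<close>. What such a disc yields for
  \<open>E\<close> is a bound on its derivative only, not on its size. The missing value comes from
  the critical line: the poles lie on that line, so their sum is purely imaginary there, and
  \<open>Re E\<close> equals the real part of the logarithmic derivative, which the functional
  equation determines. The sign of this real part places the zero of the derivative to the right of
  the line, as the window in \<open>m_deriv\<close> demands.

  \<open>riemann_hypothesis\<close> speaks of the open strip only. Zeros with nonzero ordinate
  outside it are excluded separately, by the Euler product for \<open>1 \<le> Re s\<close> and by
  the functional equation for \<open>Re s \<le> 0\<close>; afterwards all zeros that matter lie on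
  one line, and an ordinate determines its zero.\<close>

lemma zeta_eq_dirichlet1: "1 < Re s \<Longrightarrow> zeta s = dirichlet1 s"
  using zeta_sums[of s] by (simp add: dirichlet1_def sums_iff)

text \<open>The recurrence at \<open>K = 1\<close>, where the sum over \<open>{2..K}\<close> is
  empty. The remainder series still converges for \<open>0 < Re s\<close>, so this is an explicit
  formula for zeta across the critical strip.\<close>

lemma zeta_Re_pos:
  assumes "0 < Re s" "s \<noteq> 1"
  shows "(s - 1) * zeta s = 1 + (\<Sum>n. powr_rem 1 n s)"
proof (rule analytic_continuation_open
    [where s = "{s. 1 < Re s}" and s' = "{s. 0 < Re s} - {1}" and f = "\<lambda>s. (s - 1) * zeta s"
      and g = "\<lambda>s. 1 + (\<Sum>n. powr_rem 1 n s)"])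
  show "{s. 1 < Re s} \<noteq> {}" by (auto intro: exI[of _ 2])
  show "connected ({s. 0 < Re s} - {1 :: complex})"
    by (rule connected_open_delete) (auto simp: open_Re_gt convex_connected[OF convex_Re_gt])
  show "(\<lambda>s. (s - 1) * zeta s) holomorphic_on {s. 0 < Re s} - {1}"
    by (intro holomorphic_intros holomorphic_on_subset[OF zeta_holomorphic]) auto
  show "(\<lambda>s. 1 + (\<Sum>n. powr_rem 1 n s)) holomorphic_on {s. 0 < Re s} - {1}"
    using powr_rem_series(1)[of 1] by (intro holomorphic_intros) (auto intro: holomorphic_on_subset)
  show "(z - 1) * zeta z = 1 + (\<Sum>n. powr_rem 1 n z)" if "z \<in> {s. 1 < Re s}" for z
    using dirichlet1_recurrence[of z 1] that by (simp add: zeta_eq_dirichlet1)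
qed (use assms open_Re_gt in auto)

text \<open>The remainder bound carries the factor \<open>norm (1 - s) * norm s\<close>; division by
  \<open>s - 1\<close> leaves linear growth. The left edge is 2 - 19/10: it is reached by the discs
  of radius 19/10 about points with real part 2.\<close>

lemma zeta_strip_bound:
  "\<exists>C>0. \<forall>s. 1 / 10 \<le> Re s \<and> Re s \<le> 4 \<and> 1 \<le> \<bar>Im s\<bar> \<longrightarrow> norm (zeta s) \<le> C * \<bar>Im s\<bar>"
proof -
  define S where "S = (\<Sum>n. real (Suc n) powr (- 11 / 10))"
  have sm: "summable (\<lambda>n. real (Suc n) powr (- 11 / 10))" by (rule summable_Suc_powr) simp
  have S0: "0 \<le> S" unfolding S_def by (intro suminf_nonneg sm) auto
  have "norm (zeta s) \<le> (1 + 5 * S) * \<bar>Im s\<bar>"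
    if s: "1 / 10 \<le> Re s" "Re s \<le> 4" "1 \<le> \<bar>Im s\<bar>" for s
  proof -
    have n1: "s \<noteq> 1" using s by auto
    have ge1: "1 \<le> norm (s - 1)" using abs_Im_le_cmod[of "s - 1"] s by simp
    have le: "norm (powr_rem 1 n s) \<le> norm (1 - s) * norm s * real (Suc n) powr (- 11 / 10)" for n
    proof -
      have "norm (powr_rem 1 n s) \<le> norm (\<Prod>l<Suc 1. (1 - s) - of_nat l) * real (Suc n) powr (- Re s - real 1)"
        by (rule powr_rem_bound) (use s in auto)
      also have "norm (\<Prod>l<Suc 1. (1 - s) - of_nat l) = norm (1 - s) * norm s"
        by (simp add: norm_mult)
      also have "real (Suc n) powr (- Re s - real 1) \<le> real (Suc n) powr (- 11 / 10)"
        by (rule powr_mono) (use s in auto)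
      finally show ?thesis by (simp add: mult_left_mono)
    qed
    have smn: "summable (\<lambda>n. norm (powr_rem 1 n s))"
      by (rule summable_comparison_test'[OF summable_mult[OF sm]]) (use le in auto)
    have "norm (\<Sum>n. powr_rem 1 n s) \<le> (\<Sum>n. norm (powr_rem 1 n s))"
      by (rule summable_norm[OF smn])
    also have "\<dots> \<le> (\<Sum>n. norm (1 - s) * norm s * real (Suc n) powr (- 11 / 10))"
      by (intro suminf_le le smn summable_mult sm)
    also have "\<dots> = norm (1 - s) * norm s * S" unfolding S_def by (rule suminf_mult[OF sm])
    finally have A: "norm (\<Sum>n. powr_rem 1 n s) \<le> norm (s - 1) * norm s * S"
      by (simp add: norm_minus_commute)
    have "norm (s - 1) * norm (zeta s) = norm (1 + (\<Sum>n. powr_rem 1 n s))"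
      using zeta_Re_pos[of s] s n1 by (simp flip: norm_mult)
    also have "\<dots> \<le> 1 + norm (s - 1) * norm s * S"
      using norm_triangle_ineq[of 1 "\<Sum>n. powr_rem 1 n s"] A by simp
    also have "\<dots> \<le> norm (s - 1) * (1 + norm s * S)" using ge1 by (simp add: algebra_simps)
    finally have "norm (zeta s) \<le> 1 + norm s * S"
      by (rule mult_left_le_imp_le) (use ge1 in linarith)
    also have "norm s \<le> 5 * \<bar>Im s\<bar>" using cmod_le[of s] s by linarith
    then have "1 + norm s * S \<le> \<bar>Im s\<bar> + (5 * \<bar>Im s\<bar>) * S"
      using s S0 by (intro add_mono mult_right_mono) auto
    finally show ?thesis by (simp add: algebra_simps)
  qed
  then show ?thesis using S0 by (intro exI[of _ "1 + 5 * S"]) auto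
qed

text \<open>At \<open>s = 1\<close> every remainder term is \<open>1 - 1\<close>, so the series
  vanishes there and the residue is 1. The residue enters the non-vanishing on
  \<open>Re s = 1\<close> and shows that zeta is not affine.\<close>

lemma zeta_pole: "((\<lambda>s. (s - 1) * zeta s) \<longlongrightarrow> 1) (at 1)"
proof -
  have "(\<lambda>s. 1 + (\<Sum>n. powr_rem 1 n s)) holomorphic_on {s. 0 < Re s}"
    using powr_rem_series(1)[of 1] by (intro holomorphic_intros) auto
  then have "isCont (\<lambda>s. 1 + (\<Sum>n. powr_rem 1 n s)) 1"
    using open_Re_gt by (auto dest: holomorphic_on_imp_continuous_on simp: continuous_on_eq_continuous_at)
  moreover have "(\<Sum>n. powr_rem 1 n 1) = 0" proof -
    have "powr_rem 1 n 1 = 0" for n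
      using of_nat_neq_0[of n, where ?'a = complex] of_nat_neq_0[of "Suc n", where ?'a = complex]
      unfolding powr_rem_def by (simp del: of_nat_Suc)
    then show ?thesis by simp
  qed
  ultimately have "((\<lambda>s. 1 + (\<Sum>n. powr_rem 1 n s)) \<longlongrightarrow> 1) (at 1)"
    by (simp add: isCont_def)
  moreover have "\<forall>\<^sub>F s in at 1. 1 + (\<Sum>n. powr_rem 1 n s) = (s - 1) * zeta s"
  proof -
    have "\<forall>\<^sub>F s::complex in at 1. s \<in> {s. 0 < Re s} - {1}"
      by (rule eventually_at_in_open) (auto simp: open_Re_gt)
    then show ?thesis by eventually_elim (use zeta_Re_pos in auto)
  qed
  ultimately show ?thesis by (rule Lim_transform_eventually)
qed

lemma zeta_cnj: "s \<noteq> 1 \<Longrightarrow> zeta (cnj s) = cnj (zeta s)"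
proof -
  assume s: "s \<noteq> 1"
  have "zeta s = (cnj \<circ> zeta \<circ> cnj) s"
  proof (rule analytic_continuation_open
    [where s = "{s. 1 < Re s}" and s' = "- {1}" and f = zeta and g = "cnj \<circ> zeta \<circ> cnj"])
    show "{s. 1 < Re s} \<noteq> {}" by (auto intro: exI[of _ 2])
    show "connected (- {1 :: complex})" by (rule connected_punctured_universe) simp
    have "cnj ` (- {1}) = - {1}"
    proof -
      have "bij cnj" by (rule o_bij[of cnj]) (auto simp: o_def)
      then show ?thesis by (simp add: bij_image_Compl_eq)
    qed
    then show "(cnj \<circ> zeta \<circ> cnj) holomorphic_on - {1}"
      using zeta_holomorphic by (subst holomorphic_on_compose_cnj_cnj) (auto intro: open_Compl)
    fix z :: complex assume "z \<in> {s. 1 < Re s}"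
    then have z: "1 < Re z" by simp
    have "(\<lambda>n. cnj (of_nat (Suc n) powr (- cnj z))) sums cnj (zeta (cnj z))"
      using zeta_sums[of "cnj z"] z by (subst sums_cnj) auto
    also have "(\<lambda>n. cnj (of_nat (Suc n) powr (- cnj z))) = (\<lambda>n. of_nat (Suc n) powr (- z))"
      by (auto simp: fun_eq_iff cnj_powr complex_is_Real_iff simp del: of_nat_Suc)
    finally show "zeta z = (cnj \<circ> zeta \<circ> cnj) z"
      using zeta_sums[OF z] sums_unique2 by (auto simp: o_def)
  qed (use s zeta_holomorphic in \<open>auto simp: open_Re_gt\<close>)
  then show ?thesis by simp
qed

section \<open>Euler product and non-vanishing for Re s at least 1\<close>

lemma zeta_has_sum: "1 < Re s \<Longrightarrow> ((\<lambda>n. of_nat n powr (- s)) has_sum zeta s) UNIV"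
proof -
  assume s: "1 < Re s"
  have e: "norm (of_nat n powr (- s) :: complex) = real n powr - Re s" for n
    using norm_Suc_powr[of "n - 1" "- s"] by (cases n) auto
  have "summable (\<lambda>n. norm (of_nat n powr (- s) :: complex))"
    unfolding e using s by (simp add: summable_real_powr_iff)
  moreover have "(\<lambda>n. of_nat n powr (- s)) sums zeta s"
    using zeta_sums[OF s] by (subst (asm) sums_Suc_iff) simp
  ultimately show ?thesis by (rule norm_summable_imp_has_sum)
qed

text \<open>The sieve of Eratosthenes: multiplying by \<open>1 - of_nat q powr (- s)\<close>
  subtracts the terms at the multiples of \<open>q\<close> from those still present. Unordered sums
  permit the reindexing by \<open>\<lambda>n. q * n\<close>; the index 0 is harmless because its
  term is 0.\<close>

lemma zeta_sieve:
  assumes s: "1 < Re s" and A: "finite A" "\<And>p. p \<in> A \<Longrightarrow> prime (p :: nat)"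
  shows "((\<lambda>n. of_nat n powr (- s)) has_sum ((\<Prod>p\<in>A. 1 - of_nat p powr (- s)) * zeta s))
           {n. \<forall>p\<in>A. \<not> p dvd n}"
  using A
proof (induction A rule: finite_induct)
  case empty
  then show ?case using zeta_has_sum[OF s] by simp
next
  case (insert q A)
  let ?f = "\<lambda>n. of_nat n powr (- s) :: complex"
  let ?S = "{n. \<forall>p\<in>A. \<not> p dvd n}" and ?Z = "(\<Prod>p\<in>A. 1 - of_nat p powr (- s)) * zeta s"
  have q: "prime q" and IH: "(?f has_sum ?Z) ?S" using insert by auto
  have dvd: "p dvd q * n \<longleftrightarrow> p dvd n" if "p \<in> A" for p n
    using that insert q by (metis insertCI prime_dvd_mult_iff primes_dvd_imp_eq)
  have "((\<lambda>n. ?f q * ?f n) has_sum (?f q * ?Z)) ?S"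
    by (intro has_sum_cmult_right IH)
  also have "(\<lambda>n. ?f q * ?f n) = ?f \<circ> (\<lambda>n. q * n)"
    by (auto simp: fun_eq_iff powr_times_real)
  finally have "(?f \<circ> (\<lambda>n. q * n) has_sum (?f q * ?Z)) ?S" .
  moreover have "inj_on (\<lambda>n. q * n) ?S"
    using prime_gt_0_nat[OF q] by (auto simp: inj_on_def)
  ultimately have "(?f has_sum (?f q * ?Z)) ((\<lambda>n. q * n) ` ?S)"
    by (simp only: has_sum_reindex)
  moreover have "(\<lambda>n. q * n) ` ?S \<subseteq> ?S" using dvd by auto
  ultimately have "(?f has_sum (?Z - ?f q * ?Z)) (?S - (\<lambda>n. q * n) ` ?S)"
    using IH has_sum_Diff by blast
  moreover have "?S - (\<lambda>n. q * n) ` ?S = {n. \<forall>p\<in>insert q A. \<not> p dvd n}"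
  proof (intro equalityI subsetI)
    fix n assume n: "n \<in> ?S - (\<lambda>n. q * n) ` ?S"
    have "\<not> q dvd n"
    proof
      assume "q dvd n"
      then obtain k where k: "n = q * k" by (rule dvdE)
      then have "k \<in> ?S" using n dvd by auto
      then show False using n k by blast
    qed
    then show "n \<in> {n. \<forall>p\<in>insert q A. \<not> p dvd n}" using n by simp
  qed auto
  ultimately show ?case using insert by (simp add: algebra_simps)
qed

text \<open>The indices that survive the sieve by the primes up to \<open>N\<close> are 1 and some
  from \<open>N\<close> on, so the error is at most a tail of the absolutely convergent series. With
  zeta as a factor of a sequence that tends to 1, non-vanishing is immediate.\<close>

lemma euler_product:
  assumes s: "1 < Re s"
  shows "(\<lambda>N. (\<Prod>p\<in>{p. prime p \<and> p \<le> N}. 1 - of_nat p powr (- s)) * zeta s) \<longlonglongrightarrow> 1"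
proof -
  let ?f = "\<lambda>n. of_nat n powr (- s) :: complex"
  let ?P = "\<lambda>N. (\<Prod>p\<in>{p. prime p \<and> p \<le> N}. 1 - of_nat p powr (- s)) * zeta s"
  have e: "norm (?f n) = real n powr - Re s" for n
    using norm_Suc_powr[of "n - 1" "- s"] by (cases n) auto
  have sm: "summable (\<lambda>n. norm (?f n))"
    unfolding e using s by (simp add: summable_real_powr_iff)
  \<comment> \<open>From 2 on the prime 2 is among the sieving primes, which removes the index
    0.\<close>
  have bnd: "norm (?P N - 1) \<le> (\<Sum>n. norm (?f (n + N)))" if N: "N \<ge> 2" for N
  proof -
    let ?S = "{n. \<forall>p\<in>{p. prime p \<and> p \<le> N}. \<not> p dvd n}"
    have S1: "1 \<in> ?S" by (auto)
    have "(?f has_sum (?P N)) ?S"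
      by (rule zeta_sieve[OF s]) auto
    then have hs: "(?f has_sum (?P N - ?f 1)) (?S - {1})"
      by (rule has_sum_Diff) (use S1 has_sum_finite[of "{1}" ?f] in simp_all)
    have sub: "?S - {1} \<subseteq> {N..}"
    proof
      fix n assume n: "n \<in> ?S - {1}"
      show "n \<in> {N..}"
      proof (rule ccontr)
        assume "n \<notin> {N..}"
        then have "n < N" by simp
        obtain p where p: "prime p" "p dvd n" using n prime_factor_nat[of n] by auto
        show False
        proof (cases "n = 0")
          case True then show False using n N two_is_prime_nat by auto
        next
          case False
          then have "p \<le> n" using p by (simp add: dvd_imp_le)
          then show False using n p \<open>n < N\<close> by auto
        qed
      qed
    qed
    have sN: "((\<lambda>n. norm (?f n)) has_sum (\<Sum>n. norm (?f (n + N)))) {N..}"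
    proof -
      have "((\<lambda>n. norm (?f (n + N))) has_sum (\<Sum>n. norm (?f (n + N)))) UNIV"
        using sm summable_iff_shift[of "\<lambda>n. norm (?f n)" N]
        by (intro norm_summable_imp_has_sum summable_sums) (simp_all del: of_nat_add)
      moreover have "(\<lambda>n. n + N) ` UNIV = {N..}"
        by (simp add: add.commute[of _ N] atLeast0LessThan image_add_atLeast flip: atLeast_0)
      ultimately show ?thesis
        using has_sum_reindex[of "\<lambda>n. n + N" UNIV "\<lambda>n. norm (?f n)"]
        by (simp add: o_def del: of_nat_add)
    qed
    then have so: "(\<lambda>n. norm (?f n)) summable_on {N..}" by (auto simp: summable_on_def)
    have so': "(\<lambda>n. norm (?f n)) summable_on (?S - {1})"
      by (rule summable_on_subset_banach[OF so sub])
    have "norm (?P N - ?f 1) \<le> infsum (\<lambda>n. norm (?f n)) (?S - {1})"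
      using norm_infsum_bound[OF so'] infsumI[OF hs] by simp
    also have "\<dots> \<le> infsum (\<lambda>n. norm (?f n)) {N..}"
      by (rule infsum_mono2[OF so' so sub]) auto
    also have "\<dots> = (\<Sum>n. norm (?f (n + N)))" by (rule infsumI[OF sN])
    finally show ?thesis by simp
  qed
  have "(\<lambda>N. \<Sum>n. norm (?f (n + N))) \<longlonglongrightarrow> 0"
    by (rule suminf_exist_split2[OF sm])
  then have "(\<lambda>N. ?P N - 1) \<longlonglongrightarrow> 0"
    by (rule Lim_null_comparison[rotated]) (intro eventually_sequentiallyI[of 2] bnd)
  then show ?thesis by (simp add: LIM_zero_iff)
qed

text \<open>Real part of the logarithm series; the term at 0 is a division by zero and contributes
  0.\<close>

lemma ln_norm_one_minus_sums:
  assumes "norm (w :: complex) < 1"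
  shows "(\<lambda>n. - Re (w ^ n) / real n) sums ln (norm (1 - w))"
proof -
  have nz: "1 - w \<noteq> 0" using assms by auto
  have "(\<lambda>n. - ((- (- w)) ^ n) / of_nat n) sums ln (1 + (- w))"
    by (rule Ln_series') (use assms in simp)
  then have "(\<lambda>n. Re (- (w ^ n) / of_nat n)) sums Re (ln (1 + (- w)))"
    unfolding minus_minus by (rule sums_Re)
  also have "Re (ln (1 + (- w))) = ln (norm (1 - w))" using nz by simp
  also have "(\<lambda>n. Re (- (w ^ n) / of_nat n)) = (\<lambda>n. - Re (w ^ n) / real n)"
    by simp
  finally show ?thesis .
qed

text \<open>After taking logarithms, the coefficient of \<open>r ^ n / n\<close> is
  \<open>- (3 + 4 * c + (2 * c\<^sup>2 - 1))\<close>, that is \<open>- 2 * (1 + c)\<^sup>2\<close>,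
  where \<open>c\<close> is the real part of \<open>z ^ n\<close>.\<close>

lemma norm_one_minus_3_4_1:
  fixes z :: complex
  assumes r: "0 < r" "r < 1" and z: "norm z = 1"
  shows "norm (1 - complex_of_real r) ^ 3 * norm (1 - of_real r * z) ^ 4 * norm (1 - of_real r * z ^ 2) \<le> 1"
proof -
  let ?A = "norm (1 - complex_of_real r)" and ?B = "norm (1 - of_real r * z)"
    and ?D = "norm (1 - of_real r * z ^ 2)"
  have n1: "norm (complex_of_real r) < 1" "norm (of_real r * z) < 1" "norm (of_real r * z ^ 2) < 1"
    using r z by (auto simp: norm_mult norm_power)
  then have pos: "?A > 0" "?B > 0" "?D > 0" by auto
  have "(\<lambda>n. 3 * (- Re (of_real r ^ n) / real n) + 4 * (- Re ((of_real r * z) ^ n) / real n)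
      + - Re ((of_real r * z ^ 2) ^ n) / real n) sums (3 * ln ?A + 4 * ln ?B + ln ?D)"
    by (intro sums_add sums_mult ln_norm_one_minus_sums n1)
  moreover have "3 * (- Re (of_real r ^ n) / real n) + 4 * (- Re ((of_real r * z) ^ n) / real n)
      + - Re ((of_real r * z ^ 2) ^ n) / real n \<le> 0" for n
  proof -
    define c where "c = Re (z ^ n)"
    have "(Im (z ^ n))\<^sup>2 = 1 - c\<^sup>2"
      using cmod_power2[of "z ^ n"] z by (simp add: c_def norm_power)
    moreover have "Re ((z ^ n)\<^sup>2) = (Re (z ^ n))\<^sup>2 - (Im (z ^ n))\<^sup>2"
      by (simp add: power2_eq_square)
    moreover have "(z\<^sup>2) ^ n = (z ^ n)\<^sup>2" by (simp add: power_mult[symmetric] mult.commute)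
    ultimately have "Re ((z\<^sup>2) ^ n) = 2 * c\<^sup>2 - 1" by (simp add: c_def)
    then have E: "Re ((of_real r * z\<^sup>2) ^ n) = r ^ n * (2 * c\<^sup>2 - 1)"
      "Re ((of_real r * z) ^ n) = r ^ n * c" "Re (of_real r ^ n) = r ^ n"
      by (simp_all add: power_mult_distrib c_def flip: of_real_power)
    have "3 * (- Re (of_real r ^ n) / real n) + 4 * (- Re ((of_real r * z) ^ n) / real n)
      + - Re ((of_real r * z ^ 2) ^ n) / real n = - (2 * r ^ n * (1 + c)\<^sup>2) / real n"
      unfolding E by (cases "n = 0") (simp_all add: field_simps power2_eq_square)
    also have "\<dots> \<le> 0" using r by (intro divide_nonpos_nonneg) auto
    finally show ?thesis .
  qed
  ultimately have "3 * ln ?A + 4 * ln ?B + ln ?D \<le> 0"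
    by (rule sums_le[OF _ _ sums_zero, rotated])
  then have "ln (?A ^ 3 * ?B ^ 4 * ?D) \<le> 0" using pos by (simp add: ln_mult ln_realpow)
  then show ?thesis using pos by (subst (asm) ln_le_zero_iff) auto
qed

text \<open>Multiplying the local inequality over the primes up to \<open>N\<close> bounds the
  weighted product of the \<open>?E\<close> by the same product of zeta values, and by the Euler
  product the former tends to 1.\<close>

lemma zeta_3_4_1:
  assumes "1 < x"
  shows "norm (zeta (of_real x)) ^ 3 * norm (zeta (Complex x t)) ^ 4 * norm (zeta (Complex x (2 * t))) \<ge> 1"
proof -
  define c where "c = (\<lambda>s N. (\<Prod>p\<in>{p. prime p \<and> p \<le> N}. 1 - of_nat p powr (- s :: complex)))"
  let ?E = "\<lambda>s N. norm (c s N * zeta s)"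
  have loc: "norm (1 - of_nat p powr (- complex_of_real x)) ^ 3 * norm (1 - of_nat p powr (- Complex x t)) ^ 4
      * norm (1 - of_nat p powr (- Complex x (2 * t))) \<le> 1" if "prime p" for p
  proof -
    have p: "p > 1" using that prime_gt_1_nat by blast
    define r where "r = real p powr (- x)"
    define z where "z = cis (- t * ln (real p))"
    have r: "0 < r" "r < 1" using p assms by (auto simp: r_def powr_less_one)
    have e: "of_nat p powr (- Complex x y) = of_real r * cis (- y * ln (real p))" for y
    proof -
      have "- Complex x y * of_real (ln (real p)) =
          of_real (- x * ln (real p)) + \<i> * of_real (- y * ln (real p))"
        by (simp add: complex_eq_iff)
      moreover have "Ln (of_nat p) = of_real (ln (real p))"
        using Ln_of_real[of "real p"] p by simp
      ultimately show ?thesis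
        using p by (simp add: powr_def r_def exp_add cis_conv_exp exp_of_real del: of_real_mult of_real_minus)
    qed
    have e0: "of_nat p powr (- complex_of_real x) = of_real r"
      using e[of 0] by (simp add: complex_of_real_def)
    have e2: "of_nat p powr (- Complex x (2 * t)) = of_real r * z ^ 2"
      unfolding e z_def Complex.DeMoivre by (simp add: algebra_simps)
    have z: "norm z = 1" by (simp add: z_def)
    show ?thesis unfolding e0 e2 unfolding e z_def[symmetric] using norm_one_minus_3_4_1[OF r z] .
  qed
  have le: "?E (of_real x) N ^ 3 * ?E (Complex x t) N ^ 4 * ?E (Complex x (2 * t)) N \<le>
      norm (zeta (of_real x)) ^ 3 * norm (zeta (Complex x t)) ^ 4 * norm (zeta (Complex x (2 * t)))" for N
  proof -
    have "norm (c (of_real x) N) ^ 3 * norm (c (Complex x t) N) ^ 4 * norm (c (Complex x (2 * t)) N) \<le> 1"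
      unfolding c_def prod_norm[symmetric] prod_power_distrib prod.distrib[symmetric]
      by (rule prod_le_1) (use loc in auto)
    from mult_right_mono[OF this, of "norm (zeta (of_real x)) ^ 3 * norm (zeta (Complex x t)) ^ 4 * norm (zeta (Complex x (2 * t)))"]
    show ?thesis by (simp add: norm_mult power_mult_distrib mult_ac)
  qed
  have lim: "?E s \<longlonglongrightarrow> norm (1::complex)" if "1 < Re s" for s
    unfolding c_def using euler_product[OF that] by (rule tendsto_norm)
  have "(\<lambda>N. ?E (of_real x) N ^ 3 * ?E (Complex x t) N ^ 4 * ?E (Complex x (2 * t)) N) \<longlonglongrightarrow>
      norm (1::complex) ^ 3 * norm (1::complex) ^ 4 * norm (1::complex)"
    by (intro tendsto_intros lim) (use assms in auto)
  then show ?thesis by (intro LIMSEQ_le_const2[of _ 1]) (use le in auto)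
qed

lemma zeta_nonzero_Re_gt_1: "1 < Re s \<Longrightarrow> zeta s \<noteq> 0"
  using euler_product[of s] by (auto simp: LIMSEQ_const_iff)


text \<open>A zero at \<open>1 + \<i> * t\<close> would enter with the fourth power, the pole at 1
  only with the third: as \<open>x\<close> tends to 1 from the right, the product in the 3-4-1
  inequality would be \<open>x - 1\<close> times a convergent expression, against its lower bound
  1.\<close>

lemma zeta_nonzero_Re_eq_1:
  assumes t: "t \<noteq> 0"
  shows "zeta (Complex 1 t) \<noteq> 0"
proof
  assume z: "zeta (Complex 1 t) = 0"
  have at: "((\<lambda>x. Complex x y) \<longlongrightarrow> Complex 1 y) (at_right 1)" for y
    by (intro tendsto_intros)
  have cont: "isCont zeta (Complex 1 y)" if "y \<noteq> 0" for y
    using holomorphic_on_imp_continuous_on[OF zeta_holomorphic] that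
    by (simp add: continuous_on_eq_continuous_at open_Compl complex_eq_iff)
  have nb: "\<forall>\<^sub>F x in at_right 1. (1::real) < x" by (simp add: eventually_at_right_less)
  have L2: "((\<lambda>x. zeta (Complex x (2 * t))) \<longlongrightarrow> zeta (Complex 1 (2 * t))) (at_right 1)"
    by (rule isCont_tendsto_compose[OF cont at]) (use t in auto)
  have L0: "((\<lambda>x. (of_real x - 1) * zeta (of_real x)) \<longlongrightarrow> 1) (at_right 1)"
  proof (rule filterlim_compose[OF zeta_pole])
    have "((\<lambda>x. of_real x :: complex) \<longlongrightarrow> of_real 1) (at_right 1)" by (intro tendsto_intros)
    then show "filterlim complex_of_real (at 1) (at_right 1)"
      by (auto simp: filterlim_at intro: eventually_mono[OF nb])
  qed
  have "zeta field_differentiable at (Complex 1 t)"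
    by (rule holomorphic_on_imp_differentiable_at[OF zeta_holomorphic])
       (use t in \<open>auto simp: complex_eq_iff\<close>)
  then obtain D where "(zeta has_field_derivative D) (at (Complex 1 t))"
    by (auto simp: field_differentiable_def)
  then have D: "((\<lambda>s. (zeta s - zeta (Complex 1 t)) / (s - Complex 1 t)) \<longlongrightarrow> D) (at (Complex 1 t))"
    by (simp add: has_field_derivative_iff)
  have L1: "((\<lambda>x. (zeta (Complex x t) - zeta (Complex 1 t)) / (Complex x t - Complex 1 t)) \<longlongrightarrow> D) (at_right 1)"
    by (rule filterlim_compose[OF D])
       (use at[of t] in \<open>auto simp: filterlim_at intro: eventually_mono[OF nb]\<close>)
  have e: "Complex x t - Complex 1 t = of_real x - 1" for x by (simp add: complex_eq_iff)
  have "((\<lambda>x. (x - 1) * (norm ((of_real x - 1) * zeta (of_real x)) ^ 3 *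
      norm ((zeta (Complex x t) - zeta (Complex 1 t)) / (Complex x t - Complex 1 t)) ^ 4 *
      norm (zeta (Complex x (2 * t))))) \<longlongrightarrow> (1 - 1) * (norm (1::complex) ^ 3 * norm D ^ 4 * norm (zeta (Complex 1 (2 * t)))))
     (at_right 1)"
    by (intro tendsto_intros L0 L1 L2)
  then have "((\<lambda>x. (x - 1) * (norm ((of_real x - 1) * zeta (of_real x)) ^ 3 *
      norm ((zeta (Complex x t) - zeta (Complex 1 t)) / (Complex x t - Complex 1 t)) ^ 4 *
      norm (zeta (Complex x (2 * t))))) \<longlongrightarrow> 0) (at_right 1)" by simp
  moreover have "\<forall>\<^sub>F x in at_right 1. 1 \<le> (x - 1) * (norm ((of_real x - 1) * zeta (of_real x)) ^ 3 *
      norm ((zeta (Complex x t) - zeta (Complex 1 t)) / (Complex x t - Complex 1 t)) ^ 4 *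
      norm (zeta (Complex x (2 * t))))"
    using nb
  proof eventually_elim
    case (elim x)
    have n: "norm (complex_of_real x - 1) = x - 1"
      using norm_of_real[of "x - 1", where 'a = complex] elim by simp
    have alg: "d * ((d * a) ^ 3 * (b / d) ^ 4 * c) = a ^ 3 * b ^ 4 * c" if "d \<noteq> 0" for a b c d :: real
      using that by (simp add: field_simps eval_nat_numeral)
    have "(x - 1) * (norm ((of_real x - 1) * zeta (of_real x)) ^ 3 *
      norm ((zeta (Complex x t) - zeta (Complex 1 t)) / (Complex x t - Complex 1 t)) ^ 4 *
      norm (zeta (Complex x (2 * t)))) =
      norm (zeta (of_real x)) ^ 3 * norm (zeta (Complex x t)) ^ 4 * norm (zeta (Complex x (2 * t)))"
      using elim unfolding e z norm_mult norm_divide n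
      by (subst alg) auto
    then show ?case using zeta_3_4_1[OF elim, of t] by (simp only:)
  qed
  ultimately have "(1::real) \<le> 0"
    by (intro tendsto_lowerbound) auto
  then show False by simp
qed

lemma zeta_nonzero_Re_ge_1: "1 \<le> Re s \<Longrightarrow> Im s \<noteq> 0 \<Longrightarrow> zeta s \<noteq> 0"
  using zeta_nonzero_Re_gt_1[of s] zeta_nonzero_Re_eq_1[of "Im s"] complex_surj[of s]
  by (cases "Re s = 1") auto

section \<open>Local partial fractions of a logarithmic derivative\<close>

lemma factor_out_zero:
  fixes g :: "complex \<Rightarrow> complex"
  assumes S: "open S" "connected S" and g: "g holomorphic_on S" and p: "p \<in> S" "g p = 0"
    and nc: "\<exists>z\<in>S. g z \<noteq> 0"
  shows "\<exists>k\<ge>1. \<exists>h. h holomorphic_on S \<and> h p \<noteq> 0 \<and> (\<forall>z\<in>S. g z = (z - p) ^ k * h z)"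
proof -
  have "\<not> g constant_on S" using p nc by (metis constant_on_def)
  then obtain h0 r k where k: "0 < k" and r: "0 < r" "ball p r \<subseteq> S" and h0: "h0 holomorphic_on ball p r"
    "\<And>w. w \<in> ball p r \<Longrightarrow> g w = (w - p) ^ k * h0 w" "\<And>w. w \<in> ball p r \<Longrightarrow> h0 w \<noteq> 0"
    by (rule holomorphic_factor_zero_nonconstant[OF g S p]) auto
  define h where "h = (\<lambda>z. if z \<in> ball p r then h0 z else g z / (z - p) ^ k)"
  have eq: "h z = g z / (z - p) ^ k" if "z \<noteq> p" for z
    using that h0(2) by (auto simp: h_def)
  have "h holomorphic_on (S - {p}) \<union> ball p r"
  proof (rule holomorphic_on_Un)
    have "(\<lambda>z. g z / (z - p) ^ k) holomorphic_on S - {p}"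
      by (intro holomorphic_intros holomorphic_on_subset[OF g]) auto
    then show "h holomorphic_on S - {p}"
      by (rule holomorphic_transform) (use eq in auto)
    show "h holomorphic_on ball p r"
      by (rule holomorphic_transform[OF h0(1)]) (auto simp: h_def)
  qed (use S in auto)
  moreover have "(S - {p}) \<union> ball p r = S" using r p by auto
  moreover have "h p \<noteq> 0" using r h0(3)[of p] by (simp add: h_def)
  moreover have "\<forall>z\<in>S. g z = (z - p) ^ k * h z"
    by (metis eq k p(2) mult_zero_left nonzero_mult_div_cancel_left power_eq_0_iff right_minus_eq times_divide_eq_right)
  ultimately show ?thesis using k by (intro exI[of _ k]) auto
qed

text \<open>Only positivity of the exponents is recorded: they later act as weights of poles, where
  \<open>1 \<le> n p\<close> gives the required lower bound.\<close>

lemma factor_out_zeros: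
  fixes f :: "complex \<Rightarrow> complex"
  assumes S: "open S" "connected S" and f: "f holomorphic_on S" and nc: "\<exists>z\<in>S. f z \<noteq> 0"
    and Z: "finite Z" "Z \<subseteq> S" "\<And>p. p \<in> Z \<Longrightarrow> f p = 0"
  shows "\<exists>n g. (\<forall>p\<in>Z. 1 \<le> (n p :: nat)) \<and> g holomorphic_on S \<and> (\<forall>p\<in>Z. g p \<noteq> 0) \<and>
           (\<forall>z\<in>S. f z = (\<Prod>p\<in>Z. (z - p) ^ n p) * g z)"
  using Z
proof (induction Z rule: finite_induct)
  case empty
  then show ?case using f by auto
next
  case (insert q Z)
  have "\<exists>n g. (\<forall>p\<in>Z. 1 \<le> (n p :: nat)) \<and> g holomorphic_on S \<and> (\<forall>p\<in>Z. g p \<noteq> 0) \<and>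
           (\<forall>z\<in>S. f z = (\<Prod>p\<in>Z. (z - p) ^ n p) * g z)"
    by (rule insert.IH) (use insert.prems in auto)
  then obtain n g where g: "\<And>p. p \<in> Z \<Longrightarrow> 1 \<le> n p" "g holomorphic_on S" "\<And>p. p \<in> Z \<Longrightarrow> g p \<noteq> 0"
    "\<And>z. z \<in> S \<Longrightarrow> f z = (\<Prod>p\<in>Z. (z - p) ^ n p) * g z" by metis
  have "f q = 0" "q \<in> S" using insert by auto
  then have "g q = 0" using g(4)[of q] insert by auto
  moreover have "\<exists>z\<in>S. g z \<noteq> 0" using nc g(4) by auto
  ultimately obtain k h where h: "k \<ge> 1" "h holomorphic_on S" "h q \<noteq> 0" "\<And>z. z \<in> S \<Longrightarrow> g z = (z - q) ^ k * h z"
    using factor_out_zero[OF S g(2) \<open>q \<in> S\<close>] by blast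
  show ?case
  proof (intro exI[of _ "n(q := k)"] exI[of _ h] conjI ballI)
    fix z assume "z \<in> S"
    have "(\<Prod>p\<in>Z. (z - p) ^ (n(q := k)) p) = (\<Prod>p\<in>Z. (z - p) ^ n p)"
      by (rule prod.cong) (use insert in auto)
    then show "f z = (\<Prod>p\<in>insert q Z. (z - p) ^ (n(q := k)) p) * h z"
      using g(4)[OF \<open>z \<in> S\<close>] h(4)[OF \<open>z \<in> S\<close>] insert by (simp add: algebra_simps)
  next
    fix p assume "p \<in> insert q Z"
    then show "h p \<noteq> 0" using g(3)[of p] h(3) h(4)[of p] insert by (cases "p = q") auto
  qed (use g h insert in auto)
qed

text \<open>The map from \<open>h\<close> to \<open>h / (2 * A - h)\<close> sends the half-plane
  \<open>Re \<le> A\<close> into the closed unit disc and fixes 0, so Schwarz's lemma bounds the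
  image by \<open>norm z / R\<close>; solving for \<open>h\<close> gives the claim.\<close>

lemma Borel_Caratheodory_0:
  assumes R: "0 < R" and h: "h holomorphic_on ball 0 R" and h0: "h 0 = 0"
    and A: "0 < A" "\<And>z. z \<in> ball 0 R \<Longrightarrow> Re (h z) \<le> A" and z: "norm z < R"
  shows "norm (h z) \<le> 2 * A * norm z / (R - norm z)"
proof -
  define w where "w = (\<lambda>u. h (of_real R * u) / (2 * of_real A - h (of_real R * u)))"
  have inR: "of_real R * u \<in> ball 0 R" if "norm u < 1" for u :: complex
    using that R by (simp add: norm_mult)
  have nz: "2 * of_real A - h (of_real R * u) \<noteq> 0" if "norm u < 1" for u
    using A(2)[OF inR[OF that]] A(1) by (auto simp: complex_eq_iff)
  have hR: "(\<lambda>u. h (of_real R * u)) holomorphic_on ball 0 1"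
  proof -
    have "(h \<circ> (\<lambda>u. of_real R * u)) holomorphic_on ball 0 1"
      by (rule holomorphic_on_compose_gen[OF _ h]) (use inR in \<open>auto intro!: holomorphic_intros\<close>)
    then show ?thesis by (simp add: o_def)
  qed
  have hol: "w holomorphic_on ball 0 1"
    unfolding w_def by (intro holomorphic_intros hR) (use nz in auto)
  have less1: "norm (w u) < 1" if "norm u < 1" for u
  proof -
    let ?v = "h (of_real R * u)"
    have "norm ?v ^ 2 < norm (2 * of_real A - ?v) ^ 2 \<or> Re ?v = A"
      using A(1) A(2)[OF inR[OF that]] unfolding cmod_power2
      by (auto simp: power2_eq_square algebra_simps)
    \<comment> \<open>Equality at an interior point would make \<open>exp h\<close> attain its
      maximum modulus there and hence be constant, although its modulus is 1 at the origin and
      \<open>exp A > 1\<close> at that point.\<close>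
    have "Re ?v < A"
    proof (rule ccontr)
      assume "\<not> Re ?v < A"
      then have e: "Re ?v = A" using A(2)[OF inR[OF that]] by simp
      define e where "e = (\<lambda>u. exp (h (of_real R * u)))"
      have "e constant_on ball 0 1"
      proof (rule maximum_modulus_principle[where U = "ball 0 1" and \<xi> = u])
        show "e holomorphic_on ball 0 1" unfolding e_def by (intro holomorphic_intros hR)
        show "norm (e z) \<le> norm (e u)" if "z \<in> ball 0 1" for z
          using A(2)[OF inR] that e by (simp add: e_def)
      qed (use that in auto)
      then have "e u = e 0" using that by (metis constant_on_def dist_self mem_ball mem_ball_0 zero_less_one)
      then have "norm (e u) = norm (e 0)" by simp
      then show False using e h0 A(1) by (simp add: e_def)
    qed
    then have "norm ?v ^ 2 < norm (2 * of_real A - ?v) ^ 2"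
      using A(1) unfolding cmod_power2 by (simp add: power2_eq_square algebra_simps)
    then have "norm ?v < norm (2 * of_real A - ?v)" by (rule power_less_imp_less_base) simp
    then show ?thesis using nz[OF that] by (simp add: w_def norm_divide divide_less_eq)
  qed
  define u where "u = z / of_real R"
  have nu: "norm u = norm z / R" using R by (simp add: u_def norm_divide)
  then have u1: "norm u < 1" using z R by simp
  have "norm (w u) \<le> norm u"
    by (rule Schwarz_Lemma(1)[OF hol _ less1]) (use u1 h0 in \<open>auto simp: w_def\<close>)
  moreover have "of_real R * u = z" using R by (simp add: u_def)
  ultimately have "norm (h z) \<le> norm u * norm (2 * of_real A - h z)"
    using nz[OF u1] by (simp add: w_def norm_divide divide_le_eq)
  also have "\<dots> \<le> norm u * (2 * A + norm (h z))"
    using norm_triangle_ineq4[of "2 * of_real A" "h z"] A(1) by (intro mult_left_mono) (simp_all add: norm_mult)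
  finally have "norm (h z) * (R - norm z) \<le> 2 * A * norm z"
    using R unfolding nu by (simp add: field_simps)
  then show ?thesis using z by (simp add: field_simps)
qed

lemma has_field_derivative_prod_power:
  fixes u :: "'a \<Rightarrow> complex \<Rightarrow> complex"
  assumes "finite Z" and "\<And>p. p \<in> Z \<Longrightarrow> (u p has_field_derivative u' p) (at z)"
    and "\<And>p. p \<in> Z \<Longrightarrow> u p z \<noteq> 0"
  shows "((\<lambda>z. \<Prod>p\<in>Z. u p z ^ n p) has_field_derivative
           (\<Prod>p\<in>Z. u p z ^ n p) * (\<Sum>p\<in>Z. of_nat (n p) * u' p / u p z)) (at z)"
  using assms
proof (induction Z rule: finite_induct)
  case (insert q Z)
  have nz: "u q z \<noteq> 0" using insert by auto
  have "((\<lambda>z. u q z ^ n q) has_field_derivative (of_nat (n q) * (u' q * u q z ^ (n q - 1)))) (at z)"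
    using DERIV_power[OF insert.prems(1)[of q], of "n q"] by simp
  also have "of_nat (n q) * (u' q * u q z ^ (n q - 1)) = u q z ^ n q * (of_nat (n q) * u' q / u q z)"
    using nz by (cases "n q") auto
  finally have 1: "((\<lambda>z. u q z ^ n q) has_field_derivative u q z ^ n q * (of_nat (n q) * u' q / u q z)) (at z)" .
  have 2: "((\<lambda>z. \<Prod>p\<in>Z. u p z ^ n p) has_field_derivative
           (\<Prod>p\<in>Z. u p z ^ n p) * (\<Sum>p\<in>Z. of_nat (n p) * u' p / u p z)) (at z)"
    using insert by auto
  show ?case using DERIV_mult[OF 1 2] insert(1,2) by (simp add: algebra_simps)
qed simp

text \<open>Only \<open>deriv E\<close> is bounded, and on a smaller disc: differences of
  \<open>E\<close> are all that is estimated in this way. The disc is centred at 0, so zeta enters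
  translated.\<close>

definition local_log_deriv :: "(complex \<Rightarrow> complex) \<Rightarrow> real \<Rightarrow> real \<Rightarrow> real \<Rightarrow> bool" where
  "local_log_deriv f R r B \<longleftrightarrow> (\<exists>n :: complex \<Rightarrow> nat. \<exists>E.
     (\<forall>p\<in>{p \<in> cball 0 R. f p = 0}. 1 \<le> n p) \<and> E holomorphic_on ball 0 R \<and>
     (\<forall>z\<in>ball 0 R. f z \<noteq> 0 \<longrightarrow>
        deriv f z / f z = (\<Sum>p\<in>{p \<in> cball 0 R. f p = 0}. of_nat (n p) / (z - p)) + E z) \<and>
     (\<forall>z\<in>ball 0 r. norm (deriv E z) \<le> B))"

text \<open>The first summand of the bound comes from Borel-Caratheodory and Cauchy applied to the
  logarithm \<open>h\<close> of \<open>F / F 0\<close>. The second comes from Jensen: there are at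
  most \<open>ln (M / norm (f 0)) / ln (R / R1)\<close> zeros, and each adds a reflected pole term
  whose derivative is at most \<open>1 / (R - R1)\<^sup>2\<close>.\<close>

lemma local_log_deriv:
  fixes f :: "complex \<Rightarrow> complex"
  assumes r: "0 < r" "r < R1" "R1 < R" "R < R'"
    and f: "f holomorphic_on ball 0 R'" and f0: "f 0 \<noteq> 0" "norm (f 0) < M"
    and M: "\<And>z. norm z = R \<Longrightarrow> norm (f z) \<le> M"
  shows "finite {p \<in> cball 0 R1. f p = 0}"
    and "local_log_deriv f R1 r
      ((32 * R1 / (R1 - r) ^ 3 + 1 / (ln (R / R1) * (R - R1)\<^sup>2)) * ln (M / norm (f 0)))"
proof -
  define Z where "Z = {p \<in> cball 0 R1. f p = 0}"
  define A where "A = ln (M / norm (f 0))"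
  have A: "A > 0" unfolding A_def using f0 by (intro ln_gt_zero) simp
  have nc: "\<not> f constant_on ball 0 R' \<or> Z = {}"
    using f0 r by (auto simp: constant_on_def Z_def)
  show finZ: "finite {p \<in> cball 0 R1. f p = 0}"
  proof (cases "Z = {}")
    case True
    then show ?thesis unfolding Z_def by (metis finite.emptyI)
  next
    case False
    then show ?thesis using nc r
      by (intro holomorphic_compact_finite_zeros[OF f]) auto
  qed
  then have fZ: "finite Z" by (simp only: Z_def)
  have Zr: "norm p \<le> R1" "f p = 0" "p \<noteq> 0" if "p \<in> Z" for p
    using that f0 by (auto simp: Z_def)
  have "\<exists>n g. (\<forall>p\<in>Z. 1 \<le> (n p :: nat)) \<and> g holomorphic_on ball 0 R' \<and> (\<forall>p\<in>Z. g p \<noteq> 0) \<and>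
           (\<forall>z\<in>ball 0 R'. f z = (\<Prod>p\<in>Z. (z - p) ^ n p) * g z)"
    by (rule factor_out_zeros) (use f finZ f0 r in \<open>auto simp: Z_def intro!: bexI[of _ 0]\<close>)
  then obtain n g where n: "\<And>p. p \<in> Z \<Longrightarrow> 1 \<le> (n p :: nat)" and g: "g holomorphic_on ball 0 R'"
    and gZ: "\<And>p. p \<in> Z \<Longrightarrow> g p \<noteq> 0"
    and fg: "\<And>z. norm z < R' \<Longrightarrow> f z = (\<Prod>p\<in>Z. (z - p) ^ n p) * g z" by (auto simp: Ball_def)
  \<comment> \<open>Blaschke factors up to the zeros \<open>z - p\<close>: on the circle of radius \<open>R\<close> they have modulus \<open>\<bar>z - p\<bar>\<close>, so \<open>F\<close> has
    no zeros in the smaller disc and keeps the bound \<open>M\<close>.\<close>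
  define q where "q = (\<lambda>p z. (of_real (R\<^sup>2) - cnj p * z) / of_real R)"
  define F where "F = (\<lambda>z. (\<Prod>p\<in>Z. q p z ^ n p) * g z)"
  have qnz: "q p z \<noteq> 0" if "p \<in> Z" "norm z \<le> R" for p z
  proof -
    have "norm (cnj p * z) \<le> R1 * R"
      using that Zr[of p] r unfolding norm_mult by (intro mult_mono) auto
    also have "\<dots> < norm (of_real (R\<^sup>2) :: complex)" using r by (simp add: power2_eq_square norm_mult)
    finally have "of_real (R\<^sup>2) \<noteq> cnj p * z" by auto
    then show ?thesis using r by (auto simp: q_def)
  qed
  have qn: "norm (q p z) = norm (z - p)" if "norm z = R" for p z
  proof -
    have "of_real (R\<^sup>2) = z * cnj z" using complex_norm_square[of z] that by simp
    then have "q p z = z * cnj (z - p) / of_real R" by (simp add: q_def algebra_simps)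
    then have "norm (q p z) = norm z * norm (cnj (z - p)) / R"
      using r by (simp add: norm_mult norm_divide del: complex_cnj_diff)
    then show ?thesis using that r by (simp del: complex_cnj_diff)
  qed
  have Fhol: "F holomorphic_on ball 0 R'"
    unfolding F_def q_def using r by (intro holomorphic_intros g) auto
  have FM: "norm (F z) \<le> M" if "norm z \<le> R" for z
  proof (rule maximum_modulus_frontier[where S = "cball 0 R" and f = F])
    show "F holomorphic_on interior (cball 0 R)" "continuous_on (closure (cball 0 R)) F"
      using r by (auto intro!: holomorphic_on_subset[OF Fhol] holomorphic_on_imp_continuous_on)
    fix z :: complex assume "z \<in> frontier (cball 0 R)"
    then have z: "norm z = R" using r by simp
    then have "norm (F z) = norm (f z)"
      using fg[of z] r by (simp add: F_def norm_mult norm_power qn[OF z] flip: prod_norm)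
    then show "norm (F z) \<le> M" using M z by simp
  qed (use that in auto)
  have Fnz: "F z \<noteq> 0" if "norm z < R1" for z
  proof -
    have "g z \<noteq> 0"
    proof (cases "z \<in> Z")
      case False
      then have "f z \<noteq> 0" using that by (auto simp: Z_def)
      then show ?thesis using fg[of z] that r by auto
    qed (use gZ in auto)
    then show ?thesis using qnz that r fZ by (auto simp: F_def)
  qed
  \<comment> \<open>Jensen's inequality: at the origin every zero replaces the factor
    \<open>norm p\<close> by \<open>R\<close>, a gain of at least \<open>R / R1\<close>. As
    \<open>norm (F 0)\<close> is still at most \<open>M\<close>, this bounds the number
    \<open>N\<close> of zeros; it also shows that \<open>F 0\<close> is no smaller than
    \<open>f 0\<close>.\<close>
  have F0: "norm (F 0) = norm (f 0) * (\<Prod>p\<in>Z. (R / norm p) ^ n p)"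
  proof -
    have "norm (F 0) = (\<Prod>p\<in>Z. R ^ n p) * norm (g 0)"
      using r by (simp add: F_def q_def norm_mult norm_power power2_eq_square flip: prod_norm)
    also have "(\<Prod>p\<in>Z. R ^ n p) = (\<Prod>p\<in>Z. norm p ^ n p) * (\<Prod>p\<in>Z. (R / norm p) ^ n p)"
      unfolding prod.distrib[symmetric] by (rule prod.cong) (use Zr in \<open>auto simp: power_divide\<close>)
    finally show ?thesis
      using fg[of 0] r by (simp add: norm_mult norm_power flip: prod_norm)
  qed
  have ge: "R / R1 \<le> R / norm p" if "p \<in> Z" for p
    using Zr[OF that] r by (intro divide_left_mono) auto
  have RR: "1 < R / R1" using r by simp
  define N where "N = (\<Sum>p\<in>Z. real (n p))"
  have "(\<Prod>p\<in>Z. (R / R1) ^ n p) \<le> (\<Prod>p\<in>Z. (R / norm p) ^ n p)"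
    by (intro prod_mono conjI power_mono ge) (use r in auto)
  then have Pge: "(R / R1) powr N \<le> (\<Prod>p\<in>Z. (R / norm p) ^ n p)"
    using r fZ by (simp add: N_def powr_sum powr_realpow)
  have "norm (f 0) * (R / R1) powr N \<le> norm (F 0)"
    unfolding F0 by (intro mult_left_mono Pge) auto
  also have "\<dots> \<le> M" using FM[of 0] r by simp
  finally have "(R / R1) powr N \<le> M / norm (f 0)" using f0 by (simp add: field_simps)
  then have "ln ((R / R1) powr N) \<le> A"
    unfolding A_def by (intro ln_mono) (use RR f0 in auto)
  then have NA: "N \<le> A / ln (R / R1)" using RR by (simp add: ln_powr field_simps)
  have "1 \<le> (R / R1) powr N" using RR by (intro ge_one_powr_ge_zero) (auto simp: N_def sum_nonneg)
  then have F0ge: "norm (f 0) \<le> norm (F 0)"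
    using mult_left_mono[OF order_trans[OF _ Pge], of 1 "norm (f 0)"] unfolding F0 by simp
  obtain h0 where h0: "h0 holomorphic_on ball 0 R1" "\<And>z. z \<in> ball 0 R1 \<Longrightarrow> exp (h0 z) = F z"
    by (rule holomorphic_logarithm_exists[of "ball 0 R1" F 0])
       (use r Fnz in \<open>auto intro: holomorphic_on_subset[OF Fhol]\<close>)
  define h where "h = (\<lambda>z. h0 z - h0 0)"
  have h: "h holomorphic_on ball 0 R1" "h 0 = 0"
    unfolding h_def by (auto intro!: holomorphic_intros h0)
  have Fh: "F z = F 0 * exp (h z)" if "norm z < R1" for z
    using h0(2)[of z] h0(2)[of 0] Fnz[of 0] that r by (simp add: h_def exp_diff)
  have Reh: "Re (h z) \<le> A" if "norm z < R1" for z
  proof -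
    have "norm (F 0) * exp (Re (h z)) \<le> M" using Fh[OF that] FM[of z] that r by (simp add: norm_mult)
    then have "norm (f 0) * exp (Re (h z)) \<le> M"
      using mult_right_mono[OF F0ge, of "exp (Re (h z))"] by (meson exp_ge_zero order_trans)
    then have "exp (Re (h z)) \<le> M / norm (f 0)" using f0 by (simp add: field_simps)
    moreover have "0 < M / norm (f 0)" using f0 le_less_trans[OF norm_ge_zero f0(2)] by simp
    ultimately show ?thesis unfolding A_def by (subst ln_ge_iff) auto
  qed
  \<comment> \<open>Half of the available margin, so that Cauchy discs of radius
    \<open>\<eta>\<close> about points of the inner disc stay where \<open>hb\<close> applies. The
    factor \<open>fact 2 * 2 / \<eta> ^ 3\<close> is then the \<open>32 / (R1 - r) ^ 3\<close> of
    the statement.\<close>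
  define \<eta> where "\<eta> = (R1 - r) / 2"
  have \<eta>: "\<eta> > 0" "r + \<eta> = R1 - \<eta>" using r by (auto simp: \<eta>_def field_simps)
  have hb: "norm (h z) \<le> 2 * A * R1 / \<eta>" if "norm z \<le> R1 - \<eta>" for z
  proof -
    have "norm (h z) \<le> 2 * A * norm z / (R1 - norm z)"
      by (rule Borel_Caratheodory_0[OF _ h(1,2) A]) (use r \<eta> that Reh in auto)
    also have "\<dots> \<le> 2 * A * R1 / \<eta>"
      by (rule frac_le) (use that \<eta> A r in auto)
    finally show ?thesis .
  qed
  have hdd: "norm (deriv (deriv h) z) \<le> 32 * R1 / (R1 - r) ^ 3 * A" if z: "norm z < r" for z
  proof -
    have sub: "cball z \<eta> \<subseteq> ball 0 R1"
    proof
      fix w assume "w \<in> cball z \<eta>"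
      then show "w \<in> ball 0 R1" using norm_triangle_ineq2[of w z] z \<eta> by (simp add: dist_norm norm_minus_commute)
    qed
    have "norm ((deriv ^^ 2) h z) \<le> fact 2 * (2 * A * R1 / \<eta>) / \<eta> ^ 2"
    proof (rule Cauchy_inequality)
      show "h holomorphic_on ball z \<eta>" "continuous_on (cball z \<eta>) h"
        using sub ball_subset_cball[of z \<eta>] by (auto intro!: holomorphic_on_subset[OF h(1)] holomorphic_on_imp_continuous_on)
      fix x assume "norm (z - x) = \<eta>"
      then show "norm (h x) \<le> 2 * A * R1 / \<eta>"
        using norm_triangle_ineq2[of x z] z \<eta> by (intro hb) (simp add: norm_minus_commute)
    qed (use \<eta> in auto)
    also have "\<dots> = 32 * R1 / (R1 - r) ^ 3 * A"
      using r by (simp add: \<eta>_def field_simps eval_nat_numeral)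
    finally show ?thesis by (simp add: eval_nat_numeral)
  qed
  \<comment> \<open>\<open>f\<close> and \<open>F\<close> share the cofactor \<open>g\<close>, so
    the regular part \<open>deriv g z / g z\<close> is the logarithmic derivative
    \<open>deriv h z\<close> of \<open>F\<close> minus that of the factors \<open>q p\<close>, whose
    zeros lie outside the disc of radius \<open>R\<close>.\<close>
  define E where "E = (\<lambda>z. deriv h z + (\<Sum>p\<in>Z. of_nat (n p) * (cnj p / (of_real (R\<^sup>2) - cnj p * z))))"
  have den: "of_real (R\<^sup>2) - cnj p * z \<noteq> 0" if "p \<in> Z" "norm z \<le> R" for p z
    using qnz[OF that] by (auto simp: q_def)
  have Ehol: "E holomorphic_on ball 0 R1"
    unfolding E_def using den r by (intro holomorphic_intros holomorphic_deriv h) (auto intro!: den)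
  \<comment> \<open>From \<open>R\<^sup>2 - R1\<^sup>2 \<ge> R1 * (R - R1)\<close>; the factor
    \<open>R1\<close> then cancels against \<open>norm p \<le> R1\<close>.\<close>
  have denb: "R1 * (R - R1) \<le> norm (of_real (R\<^sup>2) - cnj p * z)" if "p \<in> Z" "norm z \<le> R1" for p z
  proof -
    have "norm (cnj p * z) \<le> R1 * R1"
      using that Zr[of p] r unfolding norm_mult by (intro mult_mono) auto
    moreover have "norm (of_real (R\<^sup>2) :: complex) = R * R" using r by (simp add: power2_eq_square norm_mult)
    moreover have "R1 * R \<le> R * R" using r by simp
    ultimately show ?thesis using norm_triangle_ineq2[of "of_real (R\<^sup>2)" "cnj p * z"]
      by (simp add: algebra_simps)
  qed
  have Ed: "norm (deriv E z) \<le> (32 * R1 / (R1 - r) ^ 3 + 1 / (ln (R / R1) * (R - R1)\<^sup>2)) * A"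
    if z: "z \<in> ball 0 r" for z
  proof -
    have z': "norm z < r" "norm z \<le> R1" "norm z \<le> R" "norm z < R1" using z r by auto
    have "deriv h holomorphic_on ball 0 R1" by (intro holomorphic_deriv h) auto
    then have d1: "(deriv h has_field_derivative deriv (deriv h) z) (at z)"
      by (rule holomorphic_derivI) (use z' in auto)
    have "(E has_field_derivative (deriv (deriv h) z +
        (\<Sum>p\<in>Z. of_nat (n p) * (cnj p / (of_real (R\<^sup>2) - cnj p * z))\<^sup>2))) (at z)"
      unfolding E_def
    proof (intro DERIV_add[OF d1] DERIV_sum)
      fix p assume p: "p \<in> Z"
      show "((\<lambda>z. of_nat (n p) * (cnj p / (of_real (R\<^sup>2) - cnj p * z))) has_field_derivative
         of_nat (n p) * (cnj p / (of_real (R\<^sup>2) - cnj p * z))\<^sup>2) (at z)"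
        using den[OF p z'(3)] by (auto intro!: derivative_eq_intros simp: power2_eq_square divide_simps)
    qed
    then have "deriv E z = deriv (deriv h) z +
        (\<Sum>p\<in>Z. of_nat (n p) * (cnj p / (of_real (R\<^sup>2) - cnj p * z))\<^sup>2)" by (rule DERIV_imp_deriv)
    also have "norm \<dots> \<le> 32 * R1 / (R1 - r) ^ 3 * A + (\<Sum>p\<in>Z. real (n p) * (1 / (R - R1)\<^sup>2))"
    proof (intro norm_triangle_le add_mono hdd z' sum_norm_le)
      fix p assume p: "p \<in> Z"
      have "norm (cnj p / (of_real (R\<^sup>2) - cnj p * z)) \<le> R1 / (R1 * (R - R1))"
        unfolding norm_divide by (rule frac_le) (use denb[OF p z'(2)] Zr[OF p] r in auto)
      also have "\<dots> = 1 / (R - R1)" using r by simp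
      finally have "norm (cnj p / (of_real (R\<^sup>2) - cnj p * z)) ^ 2 \<le> (1 / (R - R1))\<^sup>2"
        by (intro power_mono) auto
      then show "norm (of_nat (n p) * (cnj p / (of_real (R\<^sup>2) - cnj p * z))\<^sup>2) \<le> real (n p) * (1 / (R - R1)\<^sup>2)"
        unfolding norm_mult norm_power norm_of_nat by (intro mult_left_mono) (auto simp: power_one_over)
    qed
    also have "(\<Sum>p\<in>Z. real (n p) * (1 / (R - R1)\<^sup>2)) = N * (1 / (R - R1)\<^sup>2)"
      unfolding N_def by (rule sum_distrib_right[symmetric])
    also have "\<dots> \<le> A / ln (R / R1) * (1 / (R - R1)\<^sup>2)" by (intro mult_right_mono NA) auto
    finally show ?thesis by (simp add: algebra_simps)
  qed
  have fE: "deriv f z / f z = (\<Sum>p\<in>Z. of_nat (n p) / (z - p)) + E z" if z: "z \<in> ball 0 R1" "f z \<noteq> 0" for z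
  proof -
    have z': "norm z < R1" "norm z < R'" "norm z \<le> R" using z r by auto
    have zp: "z - p \<noteq> 0" if "p \<in> Z" for p using z Zr[OF that] by auto
    have gz: "g z \<noteq> 0" using fg[OF z'(2)] z by auto
    have dg: "(g has_field_derivative deriv g z) (at z)"
      by (rule holomorphic_derivI[OF g]) (use z' in auto)
    have "((\<lambda>z. \<Prod>p\<in>Z. (z - p) ^ n p) has_field_derivative
           (\<Prod>p\<in>Z. (z - p) ^ n p) * (\<Sum>p\<in>Z. of_nat (n p) * 1 / (z - p))) (at z)"
      by (rule has_field_derivative_prod_power) (use fZ zp in \<open>auto intro!: derivative_eq_intros\<close>)
    note DP = DERIV_mult[OF this dg]
    have "((\<lambda>z. (\<Prod>p\<in>Z. (z - p) ^ n p) * g z) has_field_derivative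
         f z * ((\<Sum>p\<in>Z. of_nat (n p) / (z - p)) + deriv g z / g z)) (at z)"
      by (rule DERIV_cong[OF DP]) (use gz fg[OF z'(2)] in \<open>simp add: field_simps\<close>)
    then have "(f has_field_derivative f z * ((\<Sum>p\<in>Z. of_nat (n p) / (z - p)) + deriv g z / g z)) (at z)"
      by (rule has_field_derivative_transform_within_open[of _ _ _ "ball 0 R'"]) (use z' fg in auto)
    then have 1: "deriv f z / f z = (\<Sum>p\<in>Z. of_nat (n p) / (z - p)) + deriv g z / g z"
      using z by (simp add: DERIV_imp_deriv)
    have "((\<lambda>z. \<Prod>p\<in>Z. q p z ^ n p) has_field_derivative
           (\<Prod>p\<in>Z. q p z ^ n p) * (\<Sum>p\<in>Z. of_nat (n p) * (- cnj p / of_real R) / q p z)) (at z)"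
      by (rule has_field_derivative_prod_power)
         (use fZ qnz[OF _ z'(3)] r in \<open>auto simp: q_def intro!: derivative_eq_intros\<close>)
    also have "(\<Sum>p\<in>Z. of_nat (n p) * (- cnj p / of_real R) / q p z) =
       - (\<Sum>p\<in>Z. of_nat (n p) * (cnj p / (of_real (R\<^sup>2) - cnj p * z)))"
      unfolding sum_negf[symmetric] using r by (intro sum.cong) (auto simp: q_def)
    finally have 2: "((\<lambda>z. \<Prod>p\<in>Z. q p z ^ n p) has_field_derivative (\<Prod>p\<in>Z. q p z ^ n p) *
       - (\<Sum>p\<in>Z. of_nat (n p) * (cnj p / (of_real (R\<^sup>2) - cnj p * z)))) (at z)" .
    have "(F has_field_derivative F z * (deriv g z / g z -
        (\<Sum>p\<in>Z. of_nat (n p) * (cnj p / (of_real (R\<^sup>2) - cnj p * z))))) (at z)"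
      unfolding F_def by (rule DERIV_cong[OF DERIV_mult[OF 2 dg]]) (use gz in \<open>simp add: field_simps\<close>)
    moreover have "(F has_field_derivative F z * deriv h z) (at z)"
    proof -
      have "(h has_field_derivative deriv h z) (at z)"
        by (rule holomorphic_derivI[OF h(1)]) (use z in auto)
      then have "((\<lambda>z. F 0 * exp (h z)) has_field_derivative F z * deriv h z) (at z)"
        using Fh[OF z'(1)] by (auto intro!: derivative_eq_intros)
      then show ?thesis
        by (rule has_field_derivative_transform_within_open[of _ _ _ "ball 0 R1"]) (use z Fh in auto)
    qed
    ultimately have "deriv h z = deriv g z / g z -
        (\<Sum>p\<in>Z. of_nat (n p) * (cnj p / (of_real (R\<^sup>2) - cnj p * z)))"
      using Fnz[OF z'(1)] DERIV_unique by fastforce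
    then show ?thesis unfolding 1 E_def by simp
  qed
  show "local_log_deriv f R1 r
      ((32 * R1 / (R1 - r) ^ 3 + 1 / (ln (R / R1) * (R - R1)\<^sup>2)) * ln (M / norm (f 0)))"
    unfolding local_log_deriv_def Z_def[symmetric] A_def[symmetric]
    using n Ehol fE Ed by (intro exI[of _ n] exI[of _ E]) auto
qed

section \<open>The functional equation\<close>

text \<open>Writing \<open>x powr (s - s0)\<close> as \<open>exp ((s - s0) * ln x)\<close> and
  integrating termwise gives a power series about \<open>s0\<close>. Domination comes from
  \<open>exp (\<rho> * \<bar>ln x\<bar>) \<le> x powr \<rho> + x powr (- \<rho>)\<close>, that is,
  from absolute convergence at \<open>Re s0 + \<rho>\<close> and
  \<open>Re s0 - \<rho>\<close>.\<close>

lemma mellin_holomorphic: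
  fixes k :: "real \<Rightarrow> real"
  assumes k[measurable]: "k \<in> borel_measurable borel" and k0: "\<And>x. x \<le> 0 \<Longrightarrow> k x = 0"
    and int: "\<And>\<sigma>. \<alpha> < \<sigma> \<Longrightarrow> integrable lborel (\<lambda>x. \<bar>k x\<bar> * x powr (\<sigma> - 1))"
  shows "(\<lambda>s. \<integral>x. complex_of_real (k x) * of_real x powr (s - 1) \<partial>lborel) holomorphic_on {s. \<alpha> < Re s}"
proof -
  define M where "M = (\<lambda>s. \<integral>x. complex_of_real (k x) * of_real x powr (s - 1) \<partial>lborel)"
  have "\<exists>r>0. M holomorphic_on ball s0 r" if "\<alpha> < Re s0" for s0
  proof -
    define r where "r = Re s0 - \<alpha>"
    define c where "c = (\<lambda>n x. complex_of_real (k x * ln x ^ n / fact n) * of_real x powr (s0 - 1))"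
    have [measurable]: "c n \<in> borel_measurable borel" for n unfolding c_def by measurable
    have "(\<lambda>n. (\<integral>x. c n x \<partial>lborel) * (w - s0) ^ n) sums M w" if w: "w \<in> ball s0 r" for w
    proof -
      define \<rho> where "\<rho> = norm (w - s0)"
      have \<rho>: "0 \<le> \<rho>" "\<alpha> < Re s0 - \<rho>" using w by (auto simp: \<rho>_def r_def dist_norm norm_minus_commute)
      define f where "f = (\<lambda>n x. c n x * (w - s0) ^ n)"
      define g where "g = (\<lambda>x. \<bar>k x\<bar> * x powr (Re s0 + \<rho> - 1) + \<bar>k x\<bar> * x powr (Re s0 - \<rho> - 1))"
      have g: "integrable lborel g" unfolding g_def
        using int[of "Re s0 + \<rho>"] int[of "Re s0 - \<rho>"] \<rho> by (intro Bochner_Integration.integrable_add) auto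
      have [measurable]: "f n \<in> borel_measurable borel" for n unfolding f_def by measurable
      have nf: "norm (f n x) = \<bar>k x\<bar> * x powr (Re s0 - 1) * ((\<bar>ln x\<bar> * \<rho>) ^ n / fact n)" if "x > 0" for n x
        using that unfolding f_def c_def \<rho>_def
        by (simp add: norm_mult norm_divide norm_power norm_powr_real_powr abs_mult power_abs power_mult_distrib)
      have sn: "(\<lambda>n. norm (f n x)) sums (\<bar>k x\<bar> * x powr (Re s0 - 1) * exp (\<bar>ln x\<bar> * \<rho>))" if "x > 0" for x
        unfolding nf[OF that] using exp_converges[of "\<bar>ln x\<bar> * \<rho>"]
        by (intro sums_mult) (simp add: scaleR_conv_of_real divide_inverse mult.commute)
      have f0: "f n x = 0" if "x \<le> 0" for n x using that k0 by (simp add: f_def c_def)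
      have le_g: "\<bar>k x\<bar> * x powr (Re s0 - 1) * exp (\<bar>ln x\<bar> * \<rho>) \<le> g x" if "x > 0" for x
      proof -
        have "exp (\<bar>ln x\<bar> * \<rho>) \<le> x powr \<rho> + x powr (- \<rho>)"
          using that by (cases "ln x \<ge> 0") (auto simp: powr_def mult.commute)
        then have "\<bar>k x\<bar> * x powr (Re s0 - 1) * exp (\<bar>ln x\<bar> * \<rho>) \<le>
            \<bar>k x\<bar> * x powr (Re s0 - 1) * (x powr \<rho> + x powr (- \<rho>))"
          by (intro mult_left_mono) auto
        also have "\<dots> = g x"
          by (simp add: g_def algebra_simps flip: powr_add)
        finally show ?thesis .
      qed
      have part: "(\<Sum>n<N. norm (f n x)) \<le> g x" for N x
      proof (cases "x > 0")
        case True
        have "(\<Sum>n<N. norm (f n x)) \<le> (\<Sum>n. norm (f n x))"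
          using sn[OF True] by (intro sum_le_suminf) (auto simp: sums_iff)
        then show ?thesis using sn[OF True] le_g[OF True] by (simp add: sums_iff)
      qed (auto simp: f0 g_def)
      have intf: "integrable lborel (f n)" for n
      proof (rule Bochner_Integration.integrable_bound[OF g])
        show "AE x in lborel. norm (f n x) \<le> norm (g x)"
        proof (rule AE_I2)
          fix x
          have "norm (f n x) \<le> (\<Sum>n<Suc n. norm (f n x))" by (simp add: sum_nonneg)
          also have "\<dots> \<le> g x" by (rule part)
          finally show "norm (f n x) \<le> norm (g x)" by simp
        qed
      qed simp
      have summ: "summable (\<lambda>n. \<integral>x. norm (f n x) \<partial>lborel)"
      proof (rule bounded_imp_summable)
        show "(\<Sum>n\<le>N. \<integral>x. norm (f n x) \<partial>lborel) \<le> (\<integral>x. g x \<partial>lborel)" for N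
        proof -
          have "(\<Sum>n\<le>N. \<integral>x. norm (f n x) \<partial>lborel) = (\<integral>x. (\<Sum>n\<le>N. norm (f n x)) \<partial>lborel)"
            by (rule Bochner_Integration.integral_sum[symmetric]) (intro integrable_norm intf)
          also have "\<dots> \<le> (\<integral>x. g x \<partial>lborel)"
            using part[where N = "Suc N"]
            by (intro integral_mono g Bochner_Integration.integrable_sum integrable_norm intf) (simp add: lessThan_Suc_atMost)
          finally show ?thesis .
        qed
      qed auto
      have aes: "summable (\<lambda>n. norm (f n x))" for x
        using sn[of x] by (cases "x > 0") (auto simp: f0 sums_iff)
      have "(\<lambda>n. integral\<^sup>L lborel (f n)) sums (\<integral>x. (\<Sum>n. f n x) \<partial>lborel)"
        by (rule sums_integral[OF intf _ summ]) (simp add: aes)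
      also have "(\<lambda>x. \<Sum>n. f n x) = (\<lambda>x. complex_of_real (k x) * of_real x powr (w - 1))"
      proof
        fix x
        show "(\<Sum>n. f n x) = complex_of_real (k x) * of_real x powr (w - 1)"
        proof (cases "x > 0")
          case True
          have "(\<lambda>n. (of_real (k x) * of_real x powr (s0 - 1)) * ((of_real (ln x) * (w - s0)) ^ n /\<^sub>R fact n)) sums
              ((of_real (k x) * of_real x powr (s0 - 1)) * exp (of_real (ln x) * (w - s0)))"
            by (intro sums_mult exp_converges)
          also have "(\<lambda>n. (of_real (k x) * of_real x powr (s0 - 1)) * ((of_real (ln x) * (w - s0)) ^ n /\<^sub>R fact n)) = (\<lambda>n. f n x)"
            by (simp add: f_def c_def scaleR_conv_of_real power_mult_distrib divide_inverse mult_ac)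
          also have "(of_real (k x) * of_real x powr (s0 - 1)) * exp (of_real (ln x) * (w - s0)) =
              of_real (k x) * of_real x powr (w - 1)"
            using True by (simp add: powr_def Ln_of_real algebra_simps flip: exp_add)
          finally show ?thesis by (simp add: sums_iff)
        qed (simp add: f0 k0)
      qed
      also have "(\<lambda>n. integral\<^sup>L lborel (f n)) = (\<lambda>n. (\<integral>x. c n x \<partial>lborel) * (w - s0) ^ n)"
        by (simp add: f_def)
      finally show ?thesis by (simp add: M_def)
    qed
    then have "M holomorphic_on ball s0 r" by (rule power_series_holomorphic)
    moreover have "r > 0" using that by (simp add: r_def)
    ultimately show ?thesis by blast
  qed
  then show ?thesis unfolding M_def[symmetric]
    by (intro analytic_imp_holomorphic) (auto simp: analytic_on_def)
qed

section \<open>Gamma integrals of nonnegative functions\<close>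

lemma nn_integral_Gamma_scaled:
  fixes p c :: real
  assumes "0 < p" "0 < c"
  shows "(\<integral>\<^sup>+x. ennreal (indicator {0<..} x * x powr (p - 1) * exp (- c * x)) \<partial>lborel) = ennreal (Gamma p * c powr (- p))"
proof -
  let ?I = "\<integral>\<^sup>+x. ennreal (indicator {0<..} x * x powr (p - 1) * exp (- c * x)) \<partial>lborel"
  have "ennreal (Gamma p) = (\<integral>\<^sup>+t. ennreal (indicator {0..} t * t powr (p - 1) / exp t) \<partial>lborel)"
    by (rule Gamma_conv_nn_integral_real[OF assms(1)])
  also have "\<dots> = ennreal \<bar>c\<bar> * (\<integral>\<^sup>+x. ennreal (indicator {0..} (0 + c * x) * (0 + c * x) powr (p - 1) / exp (0 + c * x)) \<partial>lborel)"
    by (rule nn_integral_real_affine) (use assms in auto)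
  also have "(\<lambda>x. ennreal (indicator {0..} (0 + c * x) * (0 + c * x) powr (p - 1) / exp (0 + c * x))) =
      (\<lambda>x. ennreal (c powr (p - 1)) * ennreal (indicator {0<..} x * x powr (p - 1) * exp (- c * x)))"
    using assms by (auto simp: fun_eq_iff indicator_def powr_mult exp_minus field_simps zero_le_mult_iff simp flip: ennreal_mult)
  also have "(\<integral>\<^sup>+x. ennreal (c powr (p - 1)) * ennreal (indicator {0<..} x * x powr (p - 1) * exp (- c * x)) \<partial>lborel) =
      ennreal (c powr (p - 1)) * ?I"
    by (rule nn_integral_cmult) measurable
  also have "ennreal \<bar>c\<bar> * (ennreal (c powr (p - 1)) * ?I) = ennreal (c powr p) * ?I"
    using assms by (simp add: powr_diff flip: ennreal_mult mult.assoc)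
  finally have "ennreal (c powr (- p)) * ennreal (Gamma p) = ennreal (c powr (- p)) * ennreal (c powr p) * ?I"
    by (simp add: mult.assoc)
  also have "ennreal (c powr (- p)) * ennreal (c powr p) = 1"
    using assms by (simp flip: ennreal_mult powr_add)
  finally show ?thesis using assms Gamma_real_pos[of p] by (simp add: mult.commute flip: ennreal_mult)
qed

text \<open>Insert \<open>1 / (1 + u)\<close> as the integral of \<open>exp (- (1 + u) * y)\<close>
  over \<open>y > 0\<close> and exchange the integrals: the integral over \<open>u\<close> produces
  \<open>Gamma q * y powr (- q)\<close>, and the remaining one is \<open>Gamma (1 - q)\<close>. For
  nonnegative integrals the exchange is unconditional.\<close>

lemma nn_integral_Gamma_reflection:
  fixes q :: real
  assumes "0 < q" "q < 1"
  shows "(\<integral>\<^sup>+u. ennreal (indicator {0<..} u * (u powr (q - 1) / (1 + u))) \<partial>lborel) = ennreal (Gamma q * Gamma (1 - q))"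
proof -
  have 1: "ennreal (indicator {0<..} u * (u powr (q - 1) / (1 + u))) =
      (\<integral>\<^sup>+y. ennreal (indicator {0<..} u * u powr (q - 1)) * ennreal (indicator {0<..} y * exp (- (1 + u) * y)) \<partial>lborel)" for u
  proof (cases "u > 0")
    case True
    have "(\<integral>\<^sup>+y. ennreal (indicator {0<..} y * exp (- (1 + u) * y)) \<partial>lborel) =
       (\<integral>\<^sup>+y. ennreal (indicator {0<..} y * y powr (1 - 1) * exp (- (1 + u) * y)) \<partial>lborel)"
      by (intro nn_integral_cong) (auto simp: indicator_def)
    also have "\<dots> = ennreal (1 / (1 + u))"
      using nn_integral_Gamma_scaled[of 1 "1 + u"] True by (simp add: powr_minus_divide)
    finally show ?thesis using True
      by (subst nn_integral_cmult) (auto simp flip: ennreal_mult)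
  qed auto
  have "(\<integral>\<^sup>+u. ennreal (indicator {0<..} u * (u powr (q - 1) / (1 + u))) \<partial>lborel) =
     (\<integral>\<^sup>+u. \<integral>\<^sup>+y. ennreal (indicator {0<..} u * u powr (q - 1)) * ennreal (indicator {0<..} y * exp (- (1 + u) * y)) \<partial>lborel \<partial>lborel)"
    by (subst 1) simp
  also have "\<dots> = (\<integral>\<^sup>+y. \<integral>\<^sup>+u. ennreal (indicator {0<..} u * u powr (q - 1)) * ennreal (indicator {0<..} y * exp (- (1 + u) * y)) \<partial>lborel \<partial>lborel)"
    by (rule lborel_pair.Fubini') measurable
  also have "(\<lambda>y. \<integral>\<^sup>+u. ennreal (indicator {0<..} u * u powr (q - 1)) * ennreal (indicator {0<..} y * exp (- (1 + u) * y)) \<partial>lborel) =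
     (\<lambda>y. ennreal (Gamma q) * ennreal (indicator {0<..} y * y powr ((1 - q) - 1) * exp (- 1 * y)))"
  proof
    fix y
    show "(\<integral>\<^sup>+u. ennreal (indicator {0<..} u * u powr (q - 1)) * ennreal (indicator {0<..} y * exp (- (1 + u) * y)) \<partial>lborel) =
      ennreal (Gamma q) * ennreal (indicator {0<..} y * y powr ((1 - q) - 1) * exp (- 1 * y))"
    proof (cases "y > 0")
      case True
      have "(\<integral>\<^sup>+u. ennreal (indicator {0<..} u * u powr (q - 1)) * ennreal (indicator {0<..} y * exp (- (1 + u) * y)) \<partial>lborel) =
         (\<integral>\<^sup>+u. ennreal (exp (- y)) * ennreal (indicator {0<..} u * u powr (q - 1) * exp (- y * u)) \<partial>lborel)"
        using True by (intro nn_integral_cong) (auto simp: indicator_def exp_add exp_diff exp_minus field_simps simp flip: ennreal_mult)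
      also have "\<dots> = ennreal (exp (- y)) * ennreal (Gamma q * y powr (- q))"
        using nn_integral_Gamma_scaled[OF assms(1) True] by (subst nn_integral_cmult) auto
      finally show ?thesis using True assms Gamma_real_pos[of q] by (simp add: mult_ac flip: ennreal_mult)
    qed auto
  qed
  also have "(\<integral>\<^sup>+y. ennreal (Gamma q) * ennreal (indicator {0<..} y * y powr ((1 - q) - 1) * exp (- 1 * y)) \<partial>lborel) =
      ennreal (Gamma q) * ennreal (Gamma (1 - q) * 1 powr (- (1 - q)))"
    using nn_integral_Gamma_scaled[of "1 - q" 1] assms by (subst nn_integral_cmult) auto
  finally show ?thesis using assms Gamma_real_pos[of q] by (simp flip: ennreal_mult)
qed

text \<open>The substitution \<open>u = (x / a)\<^sup>2\<close> with \<open>q = (1 + s) / 2\<close>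
  reduces this to the previous integral. It is the integral of one partial fraction of
  \<open>bern\<close> against \<open>x powr (s - 1)\<close>.\<close>

lemma nn_integral_powr_div_squares:
  fixes s a :: real
  assumes s: "- 1 < s" "s < 1" and a: "0 < a"
  shows "(\<integral>\<^sup>+x. ennreal (indicator {0<..} x * (2 * x powr s / (x\<^sup>2 + a\<^sup>2))) \<partial>lborel) =
    ennreal (a powr (s - 1) * (Gamma ((1 + s) / 2) * Gamma ((1 - s) / 2)))"
proof -
  define q where "q = (1 + s) / 2"
  have q: "0 < q" "q < 1" "1 - q = (1 - s) / 2" using s by (auto simp: q_def field_simps)
  define f where "f = (\<lambda>u::real. u powr (q - 1) / (1 + u))"
  define J where "J = Gamma q * Gamma (1 - q)"
  have J: "J > 0" unfolding J_def using q Gamma_real_pos by auto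
  have "((\<lambda>u. indicator {0<..} u * f u) has_integral J) UNIV"
    unfolding f_def by (rule nn_integral_has_integral)
       (use J q nn_integral_Gamma_reflection[of q] in \<open>auto simp: J_def indicator_def\<close>)
  then have hi: "(f has_integral J) {0<..}"

  proof -
    have "(\<lambda>u. indicator {0<..} u * f u) = (\<lambda>u. if u \<in> {0<..} then f u else 0)"
      by (auto simp: fun_eq_iff)
    then show ?thesis
      using \<open>((\<lambda>u. indicator {0<..} u * f u) has_integral J) UNIV\<close>
      by (simp only: has_integral_restrict_UNIV)
  qed
  then have ai: "f absolutely_integrable_on {0<..}"
    by (intro nonnegative_absolutely_integrable_1) (auto simp: f_def has_integral_integrable)
  define g where "g = (\<lambda>x::real. (x / a)\<^sup>2)"
  define g' where "g' = (\<lambda>x::real. 2 * x / a\<^sup>2)"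
  have img: "g ` {0<..} = {0<..}"
  proof -
    have "y \<in> g ` {0<..}" if "y > 0" for y
      using that a by (intro image_eqI[of _ _ "a * sqrt y"]) (auto simp: g_def)
    then show ?thesis using a by (auto simp: g_def)
  qed
  have "inj_on g {0<..}"
    using a by (auto simp: inj_on_def g_def power2_eq_iff_nonneg)
  then have "(\<lambda>x. \<bar>g' x\<bar> * f (g x)) absolutely_integrable_on {0<..} \<and>
           integral {0<..} (\<lambda>x. \<bar>g' x\<bar> * f (g x)) = J"
    using ai hi img a
    by (subst has_absolute_integral_change_of_variables_1'[where g = g])
       (auto simp: g_def g'_def power2_eq_square integral_unique intro!: derivative_eq_intros)
  then have "((\<lambda>x. \<bar>g' x\<bar> * f (g x)) has_integral J) {0<..}"
    by (metis has_integral_integrable_integral set_lebesgue_integral_eq_integral(1))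
  then have "(\<integral>\<^sup>+x. ennreal (indicator {0<..} x * (\<bar>g' x\<bar> * f (g x))) \<partial>lborel) = ennreal J"
    by (intro nn_integral_has_integral_lebesgue) (auto simp: f_def g_def)
  also have "(\<lambda>x. ennreal (indicator {0<..} x * (\<bar>g' x\<bar> * f (g x)))) =
     (\<lambda>x. ennreal (a powr (1 - s)) * ennreal (indicator {0<..} x * (2 * x powr s / (x\<^sup>2 + a\<^sup>2))))"
  proof
    fix x
    show "ennreal (indicator {0<..} x * (\<bar>g' x\<bar> * f (g x))) =
      ennreal (a powr (1 - s)) * ennreal (indicator {0<..} x * (2 * x powr s / (x\<^sup>2 + a\<^sup>2)))"
    proof (cases "x > 0")
      case True
      have "g x = (x / a) powr 2" using True a by (simp add: g_def powr_numeral)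
      moreover have "2 * (q - 1) = s - 1" by (simp add: q_def field_simps)
      ultimately have "g x powr (q - 1) = (x / a) powr (s - 1)" by (simp only: powr_powr)
      also have "\<dots> = x powr s * a powr (1 - s) * a / (x * a)"
        using True a by (simp add: powr_divide powr_diff field_simps)
      finally have e: "g x powr (q - 1) = x powr s * a powr (1 - s) / x" using a by simp
      have "\<bar>g' x\<bar> * f (g x) = a powr (1 - s) * (2 * x powr s / (x\<^sup>2 + a\<^sup>2))"

      proof -
        have "1 + g x = (x\<^sup>2 + a\<^sup>2) / a\<^sup>2" using a by (simp add: g_def field_simps)
        moreover have "x\<^sup>2 + a\<^sup>2 > 0" using a by (simp add: add_nonneg_pos)
        moreover have "(2 * x / b) * ((X * A / x) / (Q / b)) = A * (2 * X / Q)" if "Q > 0" "b > 0" for Q b X A :: real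
          using True that by (simp add: field_simps)
        ultimately show ?thesis
          unfolding f_def e using True a by (simp add: g'_def)
      qed
      then show ?thesis using True by (simp flip: ennreal_mult)
    qed auto
  qed
  also have "(\<integral>\<^sup>+x. ennreal (a powr (1 - s)) * ennreal (indicator {0<..} x * (2 * x powr s / (x\<^sup>2 + a\<^sup>2))) \<partial>lborel) =
     ennreal (a powr (1 - s)) * (\<integral>\<^sup>+x. ennreal (indicator {0<..} x * (2 * x powr s / (x\<^sup>2 + a\<^sup>2))) \<partial>lborel)"
    by (rule nn_integral_cmult) measurable
  finally have "ennreal (a powr (s - 1)) * ennreal (a powr (1 - s)) * (\<integral>\<^sup>+x. ennreal (indicator {0<..} x * (2 * x powr s / (x\<^sup>2 + a\<^sup>2))) \<partial>lborel)
     = ennreal (a powr (s - 1)) * ennreal J" by (simp add: mult.assoc)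
  also have "ennreal (a powr (s - 1)) * ennreal (a powr (1 - s)) = 1"
    using a by (simp flip: ennreal_mult powr_add)
  finally have "(\<integral>\<^sup>+x. ennreal (indicator {0<..} x * (2 * x powr s / (x\<^sup>2 + a\<^sup>2))) \<partial>lborel) =
      ennreal (a powr (s - 1) * J)" using J by (simp flip: ennreal_mult)
  then show ?thesis unfolding J_def q(3) by (simp only: q_def)
qed

text \<open>Equal to half of coth(x/2) minus 1/x: the kernel \<open>1 / (exp x - 1)\<close> freed of
  the terms \<open>1 / x - 1 / 2\<close> of its expansion at 0, so that it tends to 0 there like a
  multiple of \<open>x\<close>.\<close>

definition bern :: "real \<Rightarrow> real" where
  "bern x = 1 / (exp x - 1) - 1 / x + 1 / 2"

text \<open>The logarithmic derivative of the reflection formula expresses the cotangent by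
  \<open>Digamma z - Digamma (1 - z)\<close>. Passing from \<open>Digamma z\<close> to
  \<open>Digamma (1 + z)\<close> produces the \<open>1 / z\<close>, and the two Digamma series
  combine termwise.\<close>

lemma cot_partial_fractions:
  fixes z :: complex
  assumes z: "z \<notin> \<int>"
  shows "(\<lambda>n. 2 * z / ((of_nat (Suc n))\<^sup>2 - z\<^sup>2)) sums (1 / z - of_real pi * cot (of_real pi * z))"
proof -
  have i: "1 - z \<notin> \<int>" "1 + z \<notin> \<int>"
    using z Ints_diff[of 1 "1 - z"] Ints_diff[of "1 + z" 1] by auto
  then have nz: "z \<noteq> 0" "1 - z \<noteq> 0" "1 + z \<noteq> 0" using z Ints_0 by metis+
  have sinnz: "sin (of_real pi * z) \<noteq> 0"
    using z by (auto simp: sin_eq_0 field_simps)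
  have np: "z \<notin> \<int>\<^sub>\<le>\<^sub>0" "1 - z \<notin> \<int>\<^sub>\<le>\<^sub>0" using z i nonpos_Ints_Int by blast+
  have d1: "((\<lambda>w. Gamma w * Gamma (1 - w)) has_field_derivative
      Gamma z * Digamma z * Gamma (1 - z) - Gamma z * (Gamma (1 - z) * Digamma (1 - z))) (at z)"
    using np by (auto intro!: derivative_eq_intros simp: algebra_simps)
  have d2: "((\<lambda>w. of_real pi / sin (of_real pi * w)) has_field_derivative
      - (of_real pi / sin (of_real pi * z)) * (of_real pi * cot (of_real pi * z))) (at z)"
    using sinnz by (auto intro!: derivative_eq_intros simp: cot_def field_simps power2_eq_square)
  have "(\<lambda>w::complex. Gamma w * Gamma (1 - w)) = (\<lambda>w. of_real pi / sin (of_real pi * w))"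
    by (simp add: Gamma_reflection_complex fun_eq_iff)
  then have "Gamma z * Digamma z * Gamma (1 - z) - Gamma z * (Gamma (1 - z) * Digamma (1 - z)) =
      - (of_real pi / sin (of_real pi * z)) * (of_real pi * cot (of_real pi * z))"
    using d1 d2 by (simp only: DERIV_unique)
  then have "(of_real pi / sin (of_real pi * z)) * (Digamma z - Digamma (1 - z) + of_real pi * cot (of_real pi * z)) = 0"
    unfolding Gamma_reflection_complex[symmetric] by (simp add: algebra_simps)
  then have "Digamma z - Digamma (1 - z) = - of_real pi * cot (of_real pi * z)"
    using sinnz by (simp add: add_eq_0_iff2)
  then have dg: "Digamma (1 + z) - Digamma (1 - z) = 1 / z - of_real pi * cot (of_real pi * z)"
    using Digamma_plus1[OF nz(1)] by (simp add: add.commute)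
  have "(\<lambda>k. (inverse (of_nat (Suc k)) - inverse (1 + z + of_nat k)) - (inverse (of_nat (Suc k)) - inverse (1 - z + of_nat k)))
      sums ((\<Sum>k. inverse (of_nat (Suc k)) - inverse (1 + z + of_nat k)) - (\<Sum>k. inverse (of_nat (Suc k)) - inverse (1 - z + of_nat k)))"
    using summable_Digamma[of "1 + z"] summable_Digamma[of "1 - z"] nz
    by (intro sums_diff summable_sums) auto
  moreover
    have "(inverse (of_nat (Suc k)) - inverse (1 + z + of_nat k)) - (inverse (of_nat (Suc k)) - inverse (1 - z + of_nat k))
        = 2 * z / ((of_nat (Suc k))\<^sup>2 - z\<^sup>2)" for k
    proof -
      have "of_nat (Suc k) \<in> (\<int> :: complex set)" by simp
      then have n1: "of_nat (Suc k) - z \<noteq> 0" "of_nat (Suc k) + z \<noteq> 0"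
        using z by (auto simp: add_eq_0_iff minus_in_Ints_iff)
      have "(inverse (of_nat (Suc k)) - inverse (1 + z + of_nat k)) - (inverse (of_nat (Suc k)) - inverse (1 - z + of_nat k))
          = 1 / (of_nat (Suc k) - z) - 1 / (of_nat (Suc k) + z)"
        by (simp add: divide_inverse algebra_simps)
      also have "\<dots> = 2 * z / ((of_nat (Suc k) - z) * (of_nat (Suc k) + z))"
        using n1 by (simp add: divide_simps del: of_nat_Suc)
      also have "(of_nat (Suc k) - z) * (of_nat (Suc k) + z) = (of_nat (Suc k))\<^sup>2 - z\<^sup>2"
        by (simp add: power2_eq_square algebra_simps del: of_nat_Suc)
      finally show ?thesis .
    qed
  ultimately have "(\<lambda>n. 2 * z / ((of_nat (Suc n))\<^sup>2 - z\<^sup>2)) sums (Digamma (1 + z) - Digamma (1 - z))"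
    by (simp only: Digamma_def) (simp add: Digamma_def)
  then show ?thesis unfolding dg .
qed

text \<open>The cotangent expansion on the imaginary axis, at \<open>\<i> * x / (2 * pi)\<close>,
  where the cotangent becomes a hyperbolic one.\<close>

lemma bern_sums:
  assumes x: "0 < x"
  shows "(\<lambda>n. 2 * x / (x\<^sup>2 + (2 * pi * real (Suc n))\<^sup>2)) sums bern x"
proof -
  define z where "z = \<i> * of_real (x / (2 * pi))"
  have z: "z \<notin> \<int>" using x by (auto simp: z_def complex_eq_iff elim!: Ints_cases)
  have pz: "of_real pi * z = \<i> * of_real (x / 2)" by (simp add: z_def)
  have e: "2 * z / ((of_nat (Suc n))\<^sup>2 - z\<^sup>2) = 2 * pi * \<i> * of_real (2 * x / (x\<^sup>2 + (2 * pi * real (Suc n))\<^sup>2))" for n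
  proof -
    have "z\<^sup>2 = - of_real ((x / (2 * pi))\<^sup>2)" unfolding z_def power_mult_distrib by simp
    then have "(of_nat (Suc n))\<^sup>2 - z\<^sup>2 = of_real ((real (Suc n))\<^sup>2 + (x / (2 * pi))\<^sup>2)"
      by simp
    then have "2 * z / ((of_nat (Suc n))\<^sup>2 - z\<^sup>2) =
        \<i> * of_real (2 * (x / (2 * pi)) / ((real (Suc n))\<^sup>2 + (x / (2 * pi))\<^sup>2))"
      by (simp add: z_def)
    also have "2 * (x / (2 * pi)) / ((real (Suc n))\<^sup>2 + (x / (2 * pi))\<^sup>2) = 2 * pi * (2 * x / (x\<^sup>2 + (2 * pi * real (Suc n))\<^sup>2))"
    proof -
      have "(real (Suc n))\<^sup>2 + (x / (2 * pi))\<^sup>2 > 0" "x\<^sup>2 + (2 * pi * real (Suc n))\<^sup>2 > 0"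
        using x by (auto intro!: add_pos_nonneg add_nonneg_pos)
      then show ?thesis by (simp add: field_simps power2_eq_square del: of_nat_Suc)
    qed
    finally show ?thesis by simp
  qed
  have ct: "1 / z - of_real pi * cot (of_real pi * z) = 2 * pi * \<i> * of_real (bern x)"
  proof -
    have ex: "exp x - 1 > 0" using x by simp
    have s: "sin (\<i> * of_real (x / 2)) = \<i> * of_real ((exp (x / 2) - exp (- x / 2)) / 2)"
      by (simp add: sin_exp_eq exp_of_real[symmetric] field_simps flip: exp_minus)
    have c: "cos (\<i> * of_real (x / 2)) = of_real ((exp (x / 2) + exp (- x / 2)) / 2)"
      by (simp add: cos_exp_eq exp_of_real[symmetric] field_simps flip: exp_minus)
    have p: "exp (x / 2) - exp (- x / 2) > 0" using x by simp
    have "cot (of_real pi * z) = - \<i> * of_real ((exp (x / 2) + exp (- x / 2)) / (exp (x / 2) - exp (- x / 2)))"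
      unfolding pz cot_def s c using p by (simp add: divide_simps)
    also have "(exp (x / 2) + exp (- x / 2)) / (exp (x / 2) - exp (- x / 2)) = 2 / (exp x - 1) + 1"
    proof -
      have "exp x = exp (x / 2) * exp (x / 2)" by (simp flip: exp_add)
      then show ?thesis using p ex by (simp add: exp_minus field_simps)
    qed
    finally have ce: "cot (of_real pi * z) = - \<i> * of_real (2 / (exp x - 1) + 1)" .
    have "1 / z = - \<i> * of_real (2 * pi / x)" using x by (simp add: z_def divide_simps)
    then have "1 / z - of_real pi * cot (of_real pi * z) = \<i> * of_real (pi * (2 / (exp x - 1) + 1) - 2 * pi / x)"
      unfolding ce by (simp add: algebra_simps)
    also have "pi * (2 / (exp x - 1) + 1) - 2 * pi / x = 2 * pi * bern x"
      by (simp add: bern_def algebra_simps)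
    finally show ?thesis by simp
  qed
  have "(\<lambda>n. 2 * pi * \<i> * of_real (2 * x / (x\<^sup>2 + (2 * pi * real (Suc n))\<^sup>2))) sums (2 * pi * \<i> * of_real (bern x))"
    using cot_partial_fractions[OF z] unfolding e ct .
  then have "(\<lambda>n. complex_of_real (2 * x / (x\<^sup>2 + (2 * pi * real (Suc n))\<^sup>2))) sums of_real (bern x)"
    by (subst (asm) sums_mult_iff) auto
  then show ?thesis by (simp only: sums_of_real_iff)
qed

text \<open>Read off the partial fractions termwise. The linear bound lets the Mellin integral
  converge at 0 for all \<open>Re s > - 1\<close>; nonnegativity keeps the later computations within
  nonnegative integrals.\<close>

lemma bern_bounds:
  assumes "0 < x"
  shows "0 \<le> bern x" "bern x \<le> (\<Sum>n. 1 / (real (Suc n))\<^sup>2) * x"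
proof -
  note b = bern_sums[OF assms]
  have sm: "summable (\<lambda>n. 1 / (real (Suc n))\<^sup>2)"
    using inverse_squares_sums by (simp add: sums_iff add.commute)
  show "0 \<le> bern x"
    by (rule sums_le[OF _ sums_zero b]) (use assms in auto)
  show "bern x \<le> (\<Sum>n. 1 / (real (Suc n))\<^sup>2) * x"
  proof (rule sums_le[OF _ b])
    show "(\<lambda>n. 1 / (real (Suc n))\<^sup>2 * x) sums ((\<Sum>n. 1 / (real (Suc n))\<^sup>2) * x)"
      by (intro sums_mult2 summable_sums sm)
    fix n
    have "2 * (real (Suc n))\<^sup>2 \<le> x\<^sup>2 + (2 * pi * real (Suc n))\<^sup>2"
    proof -
      have "2 * 2 \<le> (2 * pi) * (2 * pi)" by (rule mult_mono) (use pi_gt3 in auto)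
      then have "2 \<le> (2 * pi)\<^sup>2" unfolding power2_eq_square by linarith
      then have "2 * (real (Suc n))\<^sup>2 \<le> (2 * pi)\<^sup>2 * (real (Suc n))\<^sup>2" by (intro mult_right_mono) auto
      then show ?thesis by (simp only: power_mult_distrib) (use zero_le_power2[of x] in linarith)
    qed
    then have "2 * x / (x\<^sup>2 + (2 * pi * real (Suc n))\<^sup>2) \<le> 2 * x / (2 * (real (Suc n))\<^sup>2)"
      using assms by (intro divide_left_mono) (auto intro!: mult_pos_pos add_pos_nonneg)
    then show "2 * x / (x\<^sup>2 + (2 * pi * real (Suc n))\<^sup>2) \<le> 1 / (real (Suc n))\<^sup>2 * x" by simp
  qed
qed

text \<open>
  Splitting at 1 makes the integral converge for \<open>-1 < Re s\<close>; it represents \<open>Gamma s * zeta s\<close> up to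
  elementary terms, and for \<open>-1 < Re s < 0\<close> these turn the kernel into \<open>bern\<close> on the whole half-line, whose partial
  fractions can be integrated termwise.
\<close>

definition mellin_kernel :: "real \<Rightarrow> real" where
  "mellin_kernel x = (if x \<le> 0 then 0 else if x \<le> 1 then bern x else 1 / (exp x - 1))"

lemma mellin_kernel_measurable [measurable]: "mellin_kernel \<in> borel_measurable borel"
  unfolding mellin_kernel_def bern_def by measurable

lemma mellin_kernel_nonneg: "0 \<le> mellin_kernel x"
  using bern_bounds[of x] by (auto simp: mellin_kernel_def)

lemma mellin_kernel_integrable:
  assumes "- 1 < \<sigma>"
  shows "integrable lborel (\<lambda>x. mellin_kernel x * x powr (\<sigma> - 1))"
proof -
  define C where "C = (\<Sum>n. 1 / (real (Suc n))\<^sup>2)"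
  have C: "C \<ge> 0"
    using bern_bounds[of 1] by (simp add: C_def)
  \<comment> \<open>\<open>C * exp 1\<close> serves \<open>x \<le> 1\<close>, where
    \<open>exp (1 - x) \<ge> 1\<close>; the summand 2 serves \<open>x > 1\<close>, where
    \<open>exp x \<ge> 2\<close> gives \<open>1 / (exp x - 1) \<le> 2 * exp (- x)\<close>.\<close>
  define D where "D = C * exp 1 + 2"
  have le: "mellin_kernel x * x powr (\<sigma> - 1) \<le> D * (indicator {0<..} x * x powr ((\<sigma> + 1) - 1) * exp (- 1 * x))" for x
  proof (cases "x \<le> 0")
    case False
    then have x: "x > 0" by simp
    have px: "x * x powr (\<sigma> - 1) = x powr \<sigma>" using x by (simp add: powr_diff)
    have "mellin_kernel x * x powr (\<sigma> - 1) \<le> D * (x powr \<sigma> * exp (- x))"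
    proof (cases "x \<le> 1")
      case True
      have "bern x * x powr (\<sigma> - 1) \<le> C * x * x powr (\<sigma> - 1)"
        using bern_bounds(2)[OF x] unfolding C_def by (intro mult_right_mono) auto
      also have "\<dots> = C * x powr \<sigma> * 1" by (simp add: mult.assoc px)
      also have "\<dots> \<le> C * x powr \<sigma> * exp (1 - x)"
        using True C by (intro mult_left_mono) auto
      also have "\<dots> = C * exp 1 * (x powr \<sigma> * exp (- x))" by (simp add: exp_diff exp_minus divide_inverse)
      also have "\<dots> \<le> D * (x powr \<sigma> * exp (- x))" unfolding D_def by (intro mult_right_mono) auto
      finally show ?thesis using True x by (simp add: mellin_kernel_def)
    next
      case False
      have e: "exp x \<ge> 2" using exp_ge_add_one_self[of x] False by linarith
      have "1 / (exp x - 1) \<le> 1 / (exp x / 2)" using e by (intro frac_le) auto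
      also have "1 / (exp x / 2) = 2 * exp (- x)" by (simp add: exp_minus field_simps)
      finally have "1 / (exp x - 1) \<le> 2 * exp (- x)" .
      moreover have "x powr (\<sigma> - 1) \<le> x powr \<sigma>" using False by (intro powr_mono) auto
      ultimately have "1 / (exp x - 1) * x powr (\<sigma> - 1) \<le> 2 * exp (- x) * x powr \<sigma>"
        using e by (intro mult_mono) auto
      also have "\<dots> \<le> D * (x powr \<sigma> * exp (- x))"
        unfolding D_def using C by (simp add: algebra_simps)
      finally show ?thesis using False by (simp add: mellin_kernel_def)
    qed
    then show ?thesis using x by simp
  qed (simp add: mellin_kernel_def)
  have "integrable lborel (\<lambda>x. indicator {0<..} x * x powr ((\<sigma> + 1) - 1) * exp (- 1 * x))"
    using nn_integral_Gamma_scaled[of "\<sigma> + 1" 1] assms by (intro integrableI_nonneg) auto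
  then have "integrable lborel (\<lambda>x. D * (indicator {0<..} x * x powr ((\<sigma> + 1) - 1) * exp (- 1 * x)))"
    by simp
  then show ?thesis
    by (rule Bochner_Integration.integrable_bound)
       (use le order_trans[OF le abs_ge_self] mellin_kernel_nonneg in \<open>auto simp: abs_mult\<close>)
qed

definition mellin :: "complex \<Rightarrow> complex" where
  "mellin s = (\<integral>x. complex_of_real (mellin_kernel x) * of_real x powr (s - 1) \<partial>lborel)"

lemma mellin_holo: "mellin holomorphic_on {s. - 1 < Re s}"
  unfolding mellin_def[abs_def]
proof (rule mellin_holomorphic[OF mellin_kernel_measurable])
  show "mellin_kernel x = 0" if "x \<le> 0" for x using that by (simp add: mellin_kernel_def)
  show "integrable lborel (\<lambda>x. \<bar>mellin_kernel x\<bar> * x powr (\<sigma> - 1))" if "- 1 < \<sigma>" for \<sigma>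
    using mellin_kernel_integrable[OF that] by (simp add: mellin_kernel_nonneg)
qed

lemma mellin_of_real:
  assumes "- 1 < s"
  shows "\<exists>m\<ge>0. mellin (of_real s) = of_real m \<and>
    (\<integral>\<^sup>+x. ennreal (mellin_kernel x * x powr (s - 1)) \<partial>lborel) = ennreal m"
proof -
  define m where "m = (\<integral>x. mellin_kernel x * x powr (s - 1) \<partial>lborel)"
  have nn: "0 \<le> mellin_kernel x * x powr (s - 1)" for x
    using mellin_kernel_nonneg[of x] by simp
  have "complex_of_real (mellin_kernel x) * of_real x powr (of_real s - 1) =
      of_real (mellin_kernel x * x powr (s - 1))" for x
  proof (cases "x \<le> 0")
    case False
    then show ?thesis using powr_of_real[of x "s - 1"] by simp
  qed (simp add: mellin_kernel_def)
  then have "mellin (of_real s) = of_real m"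
    unfolding mellin_def m_def by (simp only: integral_complex_of_real)
  moreover have "(\<integral>\<^sup>+x. ennreal (mellin_kernel x * x powr (s - 1)) \<partial>lborel) = ennreal m"
    unfolding m_def by (rule nn_integral_eq_integral[OF mellin_kernel_integrable[OF assms]]) (use nn in auto)
  moreover have "m \<ge> 0" unfolding m_def by (rule integral_nonneg_AE) (use nn in auto)
  ultimately show ?thesis by blast
qed

lemma zeta_real_sums:
  assumes "1 < s"
  shows "(\<lambda>n. real (Suc n) powr (- s)) sums Re (zeta (of_real s))" "zeta (of_real s) = of_real (Re (zeta (of_real s)))"
proof -
  have "(\<lambda>n. of_nat (Suc n) powr (- complex_of_real s)) = (\<lambda>n. of_real (real (Suc n) powr (- s)))"
  proof
    fix n show "of_nat (Suc n) powr (- complex_of_real s) = of_real (real (Suc n) powr (- s))"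
      using powr_of_real[of "real (Suc n)" "- s"] by (simp del: of_nat_Suc)
  qed
  then have *: "(\<lambda>n. complex_of_real (real (Suc n) powr (- s))) sums zeta (of_real s)"
    using zeta_sums[of "of_real s"] assms by simp
  from sums_Re[OF this] show 1: "(\<lambda>n. real (Suc n) powr (- s)) sums Re (zeta (of_real s))" by simp
  then have "(\<lambda>n. complex_of_real (real (Suc n) powr (- s))) sums of_real (Re (zeta (of_real s)))"
    by (simp only: sums_of_real_iff)
  then show "zeta (of_real s) = of_real (Re (zeta (of_real s)))" using * sums_unique2 by blast
qed

lemma has_integral_powr_unit_interval:
  fixes a :: real assumes "- 1 < a"
  shows "((\<lambda>x. x powr a) has_integral 1 / (a + 1)) {0..1}"
  using has_integral_powr_from_0[OF assms, of 1] by simp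

text \<open>Summing the scaled Gamma integrals as a geometric series gives the kernel
  \<open>1 / (exp x - 1)\<close>. On the unit interval it exceeds \<open>mellin_kernel\<close> by
  \<open>1 / x - 1 / 2\<close>, whose Mellin integral is the elementary part.\<close>

lemma mellin_identity_gt_1:
  assumes s: "1 < s"
  shows "Gamma (of_real s) * zeta (of_real s) = mellin (of_real s) + 1 / (of_real s - 1) - 1 / (2 * of_real s)"
proof -
  obtain m where m: "m \<ge> 0" "mellin (of_real s) = of_real m"
    "(\<integral>\<^sup>+x. ennreal (mellin_kernel x * x powr (s - 1)) \<partial>lborel) = ennreal m"
    using mellin_of_real[of s] s by auto
  define Z where "Z = Re (zeta (of_real s))"
  have Z: "(\<lambda>n. real (Suc n) powr (- s)) sums Z" "zeta (of_real s) = of_real Z"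
    using zeta_real_sums[OF s] by (auto simp: Z_def)
  let ?P = "\<lambda>x. x powr (s - 2) - x powr (s - 1) / 2"
  have P: "(?P has_integral (1 / (s - 1) - 1 / s / 2)) {0..1}"
    using has_integral_powr_unit_interval[of "s - 2"] has_integral_powr_unit_interval[of "s - 1"] s
    by (intro has_integral_diff has_integral_divide) auto
  have Pe: "?P x = x powr (s - 1) * (1 / x - 1 / 2)" if "x > 0" for x
    using that by (simp add: powr_diff field_simps power2_eq_square)
  have Pnn: "0 \<le> ?P x" if "0 \<le> x" "x \<le> 1" for x
    using that Pe[of x] by (cases "x = 0") auto
  have c: "0 \<le> 1 / (s - 1) - 1 / s / 2" using s by (simp add: field_simps)
  have nP: "(\<integral>\<^sup>+x. ennreal (indicator {0..1} x * ?P x) \<partial>lborel) = ennreal (1 / (s - 1) - 1 / s / 2)"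
    by (rule nn_integral_has_integral_lebesgue[OF _ P]) (use Pnn in auto)
  have "ennreal (Gamma s * Z) = (\<Sum>n. ennreal (Gamma s * real (Suc n) powr (- s)))"
    using sums_mult[OF Z(1), of "Gamma s"] Gamma_real_pos[of s] s
    by (subst suminf_ennreal2) (auto simp: sums_iff simp del: of_nat_Suc)
  also have "\<dots> = (\<Sum>n. \<integral>\<^sup>+x. ennreal (indicator {0<..} x * x powr (s - 1) * exp (- real (Suc n) * x)) \<partial>lborel)"
    using s by (subst nn_integral_Gamma_scaled) auto
  also have "\<dots> = (\<integral>\<^sup>+x. (\<Sum>n. ennreal (indicator {0<..} x * x powr (s - 1) * exp (- real (Suc n) * x))) \<partial>lborel)"
    by (rule nn_integral_suminf[symmetric]) measurable
  also have "\<dots> = (\<integral>\<^sup>+x. ennreal (mellin_kernel x * x powr (s - 1)) + ennreal (indicator {0..1} x * ?P x) \<partial>lborel)"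
  proof (rule nn_integral_cong)
    fix x :: real
    show "(\<Sum>n. ennreal (indicator {0<..} x * x powr (s - 1) * exp (- real (Suc n) * x))) =
      ennreal (mellin_kernel x * x powr (s - 1)) + ennreal (indicator {0..1} x * ?P x)"
    proof (cases "x > 0")
      case True
      have "(\<lambda>n. exp (- x) ^ Suc n) sums (exp (- x) / (1 - exp (- x)))"
        using sums_mult[OF geometric_sums[of "exp (- x)"], of "exp (- x)"] True by simp
      also have "exp (- x) / (1 - exp (- x)) = 1 / (exp x - 1)"
        using True by (simp add: exp_minus field_simps)
      also have "(\<lambda>n. exp (- x) ^ Suc n) = (\<lambda>n. exp (- real (Suc n) * x))"
        by (simp add: exp_of_nat_mult[symmetric] del: of_nat_Suc power_Suc)
      finally have g: "(\<lambda>n. x powr (s - 1) * exp (- real (Suc n) * x)) sums (x powr (s - 1) * (1 / (exp x - 1)))"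
        by (rule sums_mult)
      have "(\<Sum>n. ennreal (indicator {0<..} x * x powr (s - 1) * exp (- real (Suc n) * x))) =
          (\<Sum>n. ennreal (x powr (s - 1) * exp (- real (Suc n) * x)))" using True by simp
      also have "\<dots> = ennreal (x powr (s - 1) * (1 / (exp x - 1)))"
        using g by (subst suminf_ennreal2) (auto simp: sums_iff)
      also have "\<dots> = ennreal (mellin_kernel x * x powr (s - 1)) + ennreal (indicator {0..1} x * ?P x)"
      proof (cases "x \<le> 1")
        case x1: True
        have "x powr (s - 1) * (1 / (exp x - 1)) = bern x * x powr (s - 1) + ?P x"
          unfolding Pe[OF True] by (simp add: bern_def algebra_simps)
        then show ?thesis
          using True x1 Pnn[of x] bern_bounds(1)[OF True] by (simp add: mellin_kernel_def flip: ennreal_plus)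
      qed (use True in \<open>simp add: mellin_kernel_def mult.commute\<close>)
      finally show ?thesis .
    qed (cases "x = 0"; simp add: mellin_kernel_def)
  qed
  also have "\<dots> = ennreal m + ennreal (1 / (s - 1) - 1 / s / 2)"
    by (subst nn_integral_add) (simp_all add: m nP)
  also have "\<dots> = ennreal (m + (1 / (s - 1) - 1 / s / 2))"
    using m c by (simp flip: ennreal_plus)
  finally have "Gamma s * Z = m + (1 / (s - 1) - 1 / s / 2)"
    using m c Gamma_real_pos[of s] s sums_le[OF _ sums_zero Z(1)]
    by (subst (asm) ennreal_inj) auto
  then have "complex_of_real (Gamma s * Z) = of_real (m + (1 / (s - 1) - 1 / s / 2))" by simp
  then show ?thesis by (simp add: m Z Gamma_complex_of_real)
qed

text \<open>For these \<open>s\<close> the elementary terms are integrals over \<open>{1..}\<close>: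
  \<open>1 / (1 - s)\<close> that of \<open>x powr (s - 2)\<close>, and \<open>- 1 / (2 * s)\<close>
  that of \<open>x powr (s - 1) / 2\<close>. They turn the kernel into \<open>bern\<close> beyond 1;
  the first stays on the other side of the equation so that all integrands are nonnegative.\<close>

lemma mellin_identity_lt_0:
  assumes s: "- 1 < s" "s < 0"
  shows "mellin (of_real s) + 1 / (of_real s - 1) - 1 / (2 * of_real s) =
    of_real ((2 * pi) powr (s - 1) * (Gamma ((1 + s) / 2) * Gamma ((1 - s) / 2))) * zeta (of_real (1 - s))"
proof -
  obtain m where m: "m \<ge> 0" "mellin (of_real s) = of_real m"
    "(\<integral>\<^sup>+x. ennreal (mellin_kernel x * x powr (s - 1)) \<partial>lborel) = ennreal m"
    using mellin_of_real[of s] s by auto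
  define Z where "Z = Re (zeta (of_real (1 - s)))"
  have Z: "(\<lambda>n. real (Suc n) powr (s - 1)) sums Z" "zeta (of_real (1 - s)) = of_real Z"
    using zeta_real_sums[of "1 - s"] s by (auto simp: Z_def)
  have Z0: "Z \<ge> 0" by (rule sums_le[OF _ sums_zero Z(1)]) auto
  define G where "G = Gamma ((1 + s) / 2) * Gamma ((1 - s) / 2)"
  have G: "G > 0" unfolding G_def using s by (intro mult_pos_pos Gamma_real_pos) auto
  have i1: "(\<integral>\<^sup>+x. ennreal (indicator {1..} x * x powr e) \<partial>lborel) = ennreal (- 1 / (e + 1))" if "e < - 1" for e :: real
    using nn_integral_has_integral_lebesgue[OF _ has_integral_powr_to_inf[OF that, of 1]] by simp
  have i2: "(\<integral>\<^sup>+x. ennreal (indicator {1..} x * (x powr (s - 1) / 2)) \<partial>lborel) = ennreal (1 / (- s) / 2)"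
    using nn_integral_has_integral_lebesgue[OF _ has_integral_divide[OF has_integral_powr_to_inf[of "s - 1" 1], of 2]] s by simp
  have "ennreal (m + 1 / (- s) / 2) = ennreal m + ennreal (1 / (- s) / 2)"
    using m s by (intro ennreal_plus) auto
  also have "\<dots> = (\<integral>\<^sup>+x. ennreal (mellin_kernel x * x powr (s - 1)) + ennreal (indicator {1..} x * (x powr (s - 1) / 2)) \<partial>lborel)"
    by (subst nn_integral_add) (simp_all only: m i2, measurable)
  also have "\<dots> = (\<integral>\<^sup>+x. (\<Sum>n. ennreal (indicator {0<..} x * (2 * x powr s / (x\<^sup>2 + (2 * pi * real (Suc n))\<^sup>2))))
      + ennreal (indicator {1..} x * x powr (s - 2)) \<partial>lborel)"
  proof (rule nn_integral_cong_AE)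
    \<comment> \<open>At \<open>x = 1\<close> the kernel is still \<open>bern\<close> while the
      indicators of \<open>{1..}\<close> already apply, so the two integrands differ at this one
      point.\<close>
    have "AE x in lborel. x \<noteq> (1 :: real)" by (rule AE_lborel_singleton)
    then show "AE x in lborel. ennreal (mellin_kernel x * x powr (s - 1)) + ennreal (indicator {1..} x * (x powr (s - 1) / 2))
      = (\<Sum>n. ennreal (indicator {0<..} x * (2 * x powr s / (x\<^sup>2 + (2 * pi * real (Suc n))\<^sup>2)))) + ennreal (indicator {1..} x * x powr (s - 2))"
    proof eventually_elim
      case (elim x)
      show ?case
      proof (cases "x > 0")
        case True
        have "x powr (s - 1) * (2 * x / (x\<^sup>2 + (2 * pi * real (Suc n))\<^sup>2)) = 2 * x powr s / (x\<^sup>2 + (2 * pi * real (Suc n))\<^sup>2)" for n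
          using True by (simp add: powr_diff)
        then have "(\<lambda>n. 2 * x powr s / (x\<^sup>2 + (2 * pi * real (Suc n))\<^sup>2)) sums (x powr (s - 1) * bern x)"
          using sums_mult[OF bern_sums[OF True], of "x powr (s - 1)"] by (simp only:)
        moreover have "0 \<le> 2 * x powr s / (x\<^sup>2 + (2 * pi * real (Suc n))\<^sup>2)" for n by simp
        ultimately have "(\<Sum>n. ennreal (2 * x powr s / (x\<^sup>2 + (2 * pi * real (Suc n))\<^sup>2))) = ennreal (x powr (s - 1) * bern x)"
          by (subst suminf_ennreal2) (auto simp: sums_iff simp del: of_nat_Suc)
        then have S: "(\<Sum>n. ennreal (indicator {0<..} x * (2 * x powr s / (x\<^sup>2 + (2 * pi * real (Suc n))\<^sup>2)))) = ennreal (x powr (s - 1) * bern x)"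
          using True by simp
        show ?thesis
        proof (cases "x < 1")
          case x1: True
          then show ?thesis unfolding S using True by (simp add: mellin_kernel_def mult.commute)
        next
          case False
          then have x1: "x > 1" using elim by simp
          have "1 / (exp x - 1) * x powr (s - 1) + 1 / 2 * x powr (s - 1) = x powr (s - 1) * bern x + x powr (s - 2)"
            using x1 by (simp add: bern_def algebra_simps powr_diff power2_eq_square)
          then show ?thesis unfolding S using x1 bern_bounds(1)[of x]
            by (simp add: mellin_kernel_def flip: ennreal_plus)
        qed
      qed (simp add: mellin_kernel_def)
    qed
  qed
  also have "\<dots> = (\<Sum>n. ennreal ((2 * pi * real (Suc n)) powr (s - 1) * G)) + ennreal (- 1 / ((s - 2) + 1))"
    using i1[of "s - 2"] nn_integral_powr_div_squares[of s "2 * pi * real (Suc n)" for n] s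
    by (subst nn_integral_add) (simp_all add: nn_integral_suminf G_def del: of_nat_Suc)
  also have "(\<Sum>n. ennreal ((2 * pi * real (Suc n)) powr (s - 1) * G)) = ennreal ((2 * pi) powr (s - 1) * G * Z)"
  proof -
    have "(\<lambda>n. (2 * pi) powr (s - 1) * G * real (Suc n) powr (s - 1)) sums ((2 * pi) powr (s - 1) * G * Z)"
      by (intro sums_mult Z)
    moreover have "(2 * pi) powr (s - 1) * G * real (Suc n) powr (s - 1) = (2 * pi * real (Suc n)) powr (s - 1) * G" for n
      by (simp add: powr_mult del: of_nat_Suc)
    ultimately show ?thesis using G
      by (subst suminf_ennreal2) (auto simp: sums_iff simp del: of_nat_Suc)
  qed
  also have "ennreal ((2 * pi) powr (s - 1) * G * Z) + ennreal (- 1 / ((s - 2) + 1)) =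
      ennreal ((2 * pi) powr (s - 1) * G * Z + 1 / (1 - s))"
  proof -
    have "- 1 / ((s - 2) + 1) = 1 / (1 - s)" using s by (simp add: divide_simps)
    then show ?thesis using G Z0 s by (simp add: ennreal_plus)
  qed
  finally have "m + 1 / (- s) / 2 = (2 * pi) powr (s - 1) * G * Z + 1 / (1 - s)"
  proof (subst (asm) ennreal_inj)
    show "0 \<le> m + 1 / (- s) / 2" using m s by (intro add_nonneg_nonneg divide_nonneg_nonneg) auto
    show "0 \<le> (2 * pi) powr (s - 1) * G * Z + 1 / (1 - s)" using s G Z0 by simp
  qed
  then have "m + 1 / (s - 1) - 1 / (2 * s) = (2 * pi) powr (s - 1) * G * Z"
    using s by (simp add: field_simps)
  then have "complex_of_real (m + 1 / (s - 1) - 1 / (2 * s)) = of_real ((2 * pi) powr (s - 1) * G * Z)" by simp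
  then show ?thesis unfolding m Z(2) G_def by simp
qed


section \<open>Analytic continuation to the functional equation\<close>

lemma islimpt_of_real_greaterThanLessThan:
  assumes "a < x" "x < b"
  shows "complex_of_real x islimpt complex_of_real ` {a<..<b}"
  unfolding islimpt_approachable
proof (intro allI impI)
  fix e :: real assume e: "e > 0"
  define y where "y = x + min (e / 2) ((b - x) / 2)"
  have "x < y" "y < b" "y - x < e" using e assms by (auto simp: y_def min_def field_simps)
  then show "\<exists>z\<in>complex_of_real ` {a<..<b}. z \<noteq> complex_of_real x \<and> dist z (complex_of_real x) < e"
    using assms by (intro bexI[of _ "of_real y"]) (auto simp: dist_of_real dist_real_def)
qed

text \<open>The identity for real \<open>s > 1\<close> spreads by continuation to
  \<open>- 1 < Re s\<close> away from the poles. Between -1 and 0 it then meets the other evaluation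
  of the same Mellin integral.\<close>

lemma Gamma_zeta_eq_mellin:
  assumes s: "- 1 < Re s" "s \<noteq> 0" "s \<noteq> 1"
  shows "Gamma s * zeta s = mellin s + 1 / (s - 1) - 1 / (2 * s)"
proof -
  define H where "H = (\<lambda>s. Gamma s * zeta s - (mellin s + 1 / (s - 1) - 1 / (2 * s)))"
  let ?S = "{s. - 1 < Re s} - {0, 1 :: complex}"
  have np: "s \<notin> \<int>\<^sub>\<le>\<^sub>0" if "s \<in> ?S" for s
  proof
    assume "s \<in> \<int>\<^sub>\<le>\<^sub>0"
    then obtain n where n: "s = - of_nat n" by (rule nonpos_Ints_cases')
    then show False using that by (cases n) auto
  qed
  have "H s = 0"
  proof (rule analytic_continuation[of H ?S "of_real ` {1<..<3}" 2])
    show "H holomorphic_on ?S" unfolding H_def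
      by (intro holomorphic_intros holomorphic_on_subset[OF zeta_holomorphic]
          holomorphic_on_subset[OF mellin_holo]) (use np in auto)
    show "open ?S" by (intro open_Diff open_Re_gt) auto
    have "connected ({s. - 1 < Re s} - {0 :: complex} - {1})"
      by (intro connected_open_delete open_Diff open_Re_gt convex_connected[OF convex_Re_gt]) auto
    moreover have "{s. - 1 < Re s} - {0 :: complex} - {1} = ?S" by blast
    ultimately show "connected ?S" by simp
    show "2 islimpt complex_of_real ` {1<..<3}"
      using islimpt_of_real_greaterThanLessThan[of 1 2 3] by simp
    show "H z = 0" if "z \<in> complex_of_real ` {1<..<3}" for z
      using that mellin_identity_gt_1 by (auto simp: H_def)
  qed (use s in auto)
  then show ?thesis by (simp add: H_def)
qed

text \<open>The reciprocal \<open>rGamma\<close> is entire, so in this form both sides are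
  holomorphic off 0 and 1, with no exceptions at poles of Gamma. It suffices to compare them on the
  real interval from -1 to 0.\<close>

lemma zeta_functional_equation:
  assumes s: "s \<noteq> 0" "s \<noteq> 1"
  shows "zeta s * rGamma ((1 - s) / 2) = of_real pi powr (s - 1 / 2) * zeta (1 - s) * rGamma (s / 2)"
proof -
  define H where "H = (\<lambda>s. zeta s * rGamma ((1 - s) / 2) - of_real pi powr (s - 1 / 2) * zeta (1 - s) * rGamma (s / 2))"
  let ?S = "- {0, 1 :: complex}"
  have "H s = 0"
  proof (rule analytic_continuation[of H ?S "of_real ` {-1<..<0}" "of_real (- 1 / 2)"])
    have "(zeta \<circ> (\<lambda>s. 1 - s)) holomorphic_on ?S"
      by (rule holomorphic_on_compose_gen[OF _ zeta_holomorphic]) (auto intro!: holomorphic_intros)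
    then show "H holomorphic_on ?S" unfolding H_def o_def
      by (intro holomorphic_intros holomorphic_on_subset[OF zeta_holomorphic]) auto
    show "connected ?S"
      using connected_open_delete_finite[of UNIV "{0, 1 :: complex}"] connected_UNIV[where 'a = complex]
      by (simp add: Compl_eq_Diff_UNIV)
    show "complex_of_real (- 1 / 2) islimpt complex_of_real ` {-1<..<0}"
      by (rule islimpt_of_real_greaterThanLessThan) auto
  next
    fix z assume "z \<in> complex_of_real ` {-1<..<0}"
    then obtain x where x: "z = of_real x" "- 1 < x" "x < 0" by auto
    have "Gamma z * zeta z = mellin z + 1 / (z - 1) - 1 / (2 * z)"
      by (rule Gamma_zeta_eq_mellin) (use x in auto)
    also have "\<dots> = of_real ((2 * pi) powr (x - 1) * (Gamma ((1 + x) / 2) * Gamma ((1 - x) / 2))) * zeta (1 - z)"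
      unfolding x(1) using mellin_identity_lt_0[OF x(2,3)] by simp
    finally have A: "Gamma z * zeta z = of_real ((2 * pi) powr (x - 1) * (Gamma ((1 + x) / 2) * Gamma ((1 - x) / 2))) * zeta (1 - z)" .
    have np: "w \<notin> \<int>\<^sub>\<le>\<^sub>0" if "w = of_real y" "- 1 < y" "y \<noteq> 0" for w :: complex and y
    proof
      assume "w \<in> \<int>\<^sub>\<le>\<^sub>0"
      then obtain n where "w = - of_nat n" by (rule nonpos_Ints_cases')
      then have "complex_of_real y = of_real (- real n)" using that by simp
      then have "y = - real n" by (simp only: of_real_eq_iff)
      then show False using that by (cases n) auto
    qed
    \<comment> \<open>Duplication splits \<open>Gamma z\<close> into \<open>Gamma (z / 2)\<close>
      and \<open>Gamma ((1 + z) / 2)\<close>, up to elementary factors; the second also stands on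
      the right of \<open>A\<close> and cancels.\<close>
    have dup: "Gamma (z / 2) * Gamma (z / 2 + 1 / 2) = exp ((1 - 2 * (z / 2)) * of_real (ln 2)) * of_real (sqrt pi) * Gamma (2 * (z / 2))"
      by (rule Gamma_legendre_duplication)
         (use x np[of "z / 2" "x / 2"] np[of "z / 2 + 1 / 2" "x / 2 + 1 / 2"] in \<open>auto\<close>)
    have e: "exp ((1 - 2 * (z / 2)) * of_real (ln 2)) = of_real (2 powr (1 - x))"
      by (simp add: x powr_def flip: exp_of_real)
    have g: "Gamma (z / 2 + 1 / 2) = of_real (Gamma ((1 + x) / 2))"
      using Gamma_complex_of_real[of "(1 + x) / 2"] by (simp add: x add_divide_distrib add.commute)
    have g2: "Gamma ((1 - z) / 2) = of_real (Gamma ((1 - x) / 2))"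
      using Gamma_complex_of_real[of "(1 - x) / 2"] by (simp add: x)
    define a b where "a = Gamma ((1 + x) / 2)" and "b = Gamma ((1 - x) / 2)"
    have ab: "a > 0" "b > 0" unfolding a_def b_def using x by (auto intro!: Gamma_real_pos)
    have "of_real (2 powr (1 - x) * sqrt pi) * (Gamma z * zeta z) = Gamma (z / 2) * of_real a * zeta z"
      using dup unfolding e g a_def[symmetric] by simp
    then have "of_real (2 powr (1 - x) * sqrt pi * (2 * pi) powr (x - 1)) * of_real a * of_real b * zeta (1 - z) =
        Gamma (z / 2) * of_real a * zeta z"
      unfolding A a_def[symmetric] b_def[symmetric] by (simp add: mult_ac)
    from this[symmetric] have "Gamma (z / 2) * of_real a * zeta z =
        of_real (2 powr (1 - x) * sqrt pi * (2 * pi) powr (x - 1)) * of_real a * of_real b * zeta (1 - z)" .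
    also have "2 powr (1 - x) * sqrt pi * (2 * pi) powr (x - 1) = pi powr (x - 1 / 2)"
    proof -
      have "2 powr (1 - x) * (2 * pi) powr (x - 1) = pi powr (x - 1)"
        by (simp add: powr_mult powr_diff field_simps)
      moreover have "sqrt pi * pi powr (x - 1) = pi powr (1 / 2 + (x - 1))"
        by (simp only: powr_add powr_half_sqrt[OF pi_ge_zero])
      moreover have "1 / 2 + (x - 1) = x - 1 / 2" by simp
      ultimately show ?thesis by (simp add: mult_ac)
    qed
    finally have B: "Gamma (z / 2) * zeta z = of_real (pi powr (x - 1 / 2)) * of_real b * zeta (1 - z)"
      using ab by simp
    have p: "complex_of_real pi powr (z - 1 / 2) = of_real (pi powr (x - 1 / 2))"
      using powr_of_real[of pi "x - 1 / 2"] by (simp add: x)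
    have "Gamma (z / 2) \<noteq> 0"
      using np[of "z / 2" "x / 2"] x by (auto simp: Gamma_eq_zero_iff)
    then have "zeta z = of_real (pi powr (x - 1 / 2)) * of_real b * zeta (1 - z) / Gamma (z / 2)"
      using B by (simp add: field_simps)
    then show "H z = 0"
      unfolding H_def p rGamma_inverse_Gamma g2 b_def[symmetric] using ab by (simp add: divide_simps)
  next
    have "complex_of_real (- 1 / 2) \<noteq> 1" by (simp add: complex_eq_iff)
    then show "complex_of_real (- 1 / 2) \<in> ?S" by simp
  qed (use s in auto)
  then show ?thesis by (simp add: H_def)
qed

text \<open>Covers what \<open>riemann_hypothesis\<close> leaves open, the nonreal zeros outside the
  open strip. On the left the functional equation transfers the question to \<open>1 - s\<close>,
  since \<open>rGamma (s / 2)\<close> vanishes only at real points.\<close>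

lemma zeta_nontrivial_zero_strip:
  assumes "zeta s = 0" "Im s \<noteq> 0"
  shows "0 < Re s" "Re s < 1"
proof -
  show "Re s < 1" using assms zeta_nonzero_Re_ge_1[of s] by force
  show "0 < Re s"
  proof (rule ccontr)
    assume "\<not> 0 < Re s"
    then have nz: "zeta (1 - s) \<noteq> 0" using assms by (intro zeta_nonzero_Re_ge_1) auto
    have "s / 2 \<notin> \<int>\<^sub>\<le>\<^sub>0" using assms(2) by (auto elim!: nonpos_Ints_cases' simp: complex_eq_iff)
    then have "rGamma (s / 2) \<noteq> 0" by (simp add: rGamma_eq_zero_iff)
    moreover have "s \<noteq> 0" "s \<noteq> 1" using assms(2) by auto
    ultimately show False using zeta_functional_equation[of s] assms(1) nz by simp
  qed
qed

section \<open>The logarithmic derivative of zeta on the critical line\<close>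

lemma Digamma_cnj: "z \<noteq> 0 \<Longrightarrow> Digamma (cnj z) = cnj (Digamma z)"
proof -
  assume z: "z \<noteq> 0"
  have "(\<lambda>m. cnj (of_real (ln (real m)) - (\<Sum>n<m. inverse (z + of_nat n)))) \<longlonglongrightarrow> cnj (Digamma z)"
    by (intro tendsto_cnj Digamma_LIMSEQ z)
  then have "(\<lambda>m. of_real (ln (real m)) - (\<Sum>n<m. inverse (cnj z + of_nat n))) \<longlonglongrightarrow> cnj (Digamma z)"
    by (simp add: cnj_sum)
  moreover have "(\<lambda>m. of_real (ln (real m)) - (\<Sum>n<m. inverse (cnj z + of_nat n))) \<longlonglongrightarrow> Digamma (cnj z)"
    by (intro Digamma_LIMSEQ) (use z in simp)
  ultimately show ?thesis using LIMSEQ_unique by blast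
qed

lemma deriv_zeta_cnj:
  assumes "s \<noteq> 1" shows "deriv zeta (cnj s) = cnj (deriv zeta s)"
proof -
  have "(zeta has_field_derivative deriv zeta s) (at s)"
    by (rule holomorphic_derivI[OF zeta_holomorphic]) (use assms in auto)
  then have "((cnj \<circ> zeta \<circ> cnj) has_field_derivative cnj (deriv zeta s)) (at (cnj s))"
    by (simp add: has_field_derivative_cnj_cnj)
  then have "(zeta has_field_derivative cnj (deriv zeta s)) (at (cnj s))"
  proof (rule has_field_derivative_transform_within_open[of _ _ _ "- {1}"])
    show "cnj s \<in> - {1}" using assms by (metis ComplI complex_cnj_cnj complex_cnj_one singletonD)
    show "(cnj \<circ> zeta \<circ> cnj) x = zeta x" if "x \<in> - {1}" for x using that by (simp add: zeta_cnj)
  qed auto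
  then show ?thesis by (rule DERIV_imp_deriv)
qed

text \<open>Comparison with the integral of \<open>a / (a\<^sup>2 + y\<^sup>2)\<close>, whose
  antiderivative is \<open>ln (a\<^sup>2 + y\<^sup>2) / 2\<close>. Two mean value steps bound the
  error between \<open>a\<close> and \<open>a + 1\<close> by \<open>1 / a\<^sup>2\<close>,
  independently of \<open>y\<close>.\<close>

lemma sum_inverse_linear_bound:
  fixes y :: real
  shows "\<bar>(\<Sum>n<m. (real n + 1 / 4) / ((real n + 1 / 4)\<^sup>2 + y\<^sup>2)) - (ln ((real m + 1 / 4)\<^sup>2 + y\<^sup>2) / 2 - ln ((1 / 4)\<^sup>2 + y\<^sup>2) / 2)\<bar>
    \<le> (\<Sum>n<m. 1 / (real n + 1 / 4)\<^sup>2)"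
proof -
  define G where "G = (\<lambda>a::real. ln (a\<^sup>2 + y\<^sup>2) / 2)"
  define g where "g = (\<lambda>a::real. a / (a\<^sup>2 + y\<^sup>2))"
  have pos: "a\<^sup>2 + y\<^sup>2 > 0" if "a > 0" for a :: real using that by (simp add: add_pos_nonneg)
  have dG: "(G has_real_derivative g a) (at a)" if "a > 0" for a
  proof -
    have 1: "((\<lambda>a. a\<^sup>2 + y\<^sup>2) has_real_derivative 2 * a) (at a)" by (auto intro!: derivative_eq_intros)
    have "((\<lambda>a. ln (a\<^sup>2 + y\<^sup>2)) has_real_derivative 1 / (a\<^sup>2 + y\<^sup>2) * (2 * a)) (at a)"
      by (rule DERIV_chain2[OF DERIV_ln_divide[OF pos[OF that]] 1])
    moreover have "1 / q * (2 * a) / 2 = a / q" for q :: real by simp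
    ultimately show ?thesis unfolding G_def g_def using DERIV_cdivide[of "\<lambda>a. ln (a\<^sup>2 + y\<^sup>2)" _ _ _ 2] by metis
  qed
  have dg: "(g has_real_derivative (y\<^sup>2 - a\<^sup>2) / (a\<^sup>2 + y\<^sup>2)\<^sup>2) (at a)" if "a > 0" for a
    unfolding g_def using pos[OF that] by (auto intro!: derivative_eq_intros simp: power2_eq_square field_simps)
  have step: "\<bar>G (a + 1) - G a - g a\<bar> \<le> 1 / a\<^sup>2" if a: "a > 0" for a
  proof -
    obtain z where z: "a < z" "z < a + 1" "G (a + 1) - G a = (a + 1 - a) * g z"
      using MVT2[of a "a + 1" G g] dG a by force
    obtain w where w: "a < w" "w < z" "g z - g a = (z - a) * ((y\<^sup>2 - w\<^sup>2) / (w\<^sup>2 + y\<^sup>2)\<^sup>2)"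
      using MVT2[of a z g "\<lambda>a. (y\<^sup>2 - a\<^sup>2) / (a\<^sup>2 + y\<^sup>2)\<^sup>2"] dg a z by force
    have "\<bar>y\<^sup>2 - w\<^sup>2\<bar> \<le> w\<^sup>2 + y\<^sup>2" by (simp add: abs_le_iff)
    then have "\<bar>(y\<^sup>2 - w\<^sup>2) / (w\<^sup>2 + y\<^sup>2)\<^sup>2\<bar> \<le> (w\<^sup>2 + y\<^sup>2) / (w\<^sup>2 + y\<^sup>2)\<^sup>2"
      by (simp add: divide_right_mono)
    also have "\<dots> = 1 / (w\<^sup>2 + y\<^sup>2)" using pos[of w] a w by (simp add: power2_eq_square)
    also have "\<dots> \<le> 1 / a\<^sup>2" using a w by (intro divide_left_mono add_increasing2 power_mono mult_pos_pos pos) auto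
    finally have "\<bar>(y\<^sup>2 - w\<^sup>2) / (w\<^sup>2 + y\<^sup>2)\<^sup>2\<bar> \<le> 1 / a\<^sup>2" .
    then have "\<bar>(z - a) * ((y\<^sup>2 - w\<^sup>2) / (w\<^sup>2 + y\<^sup>2)\<^sup>2)\<bar> \<le> 1 * (1 / a\<^sup>2)"
      unfolding abs_mult using z by (intro mult_mono) auto
    then show ?thesis using z w by simp
  qed
  have tel: "(\<Sum>n<m. G (real n + 1 / 4 + 1) - G (real n + 1 / 4)) = G (real m + 1 / 4) - G (1 / 4)"
    using sum_lessThan_telescope[of "\<lambda>n. G (real n + 1 / 4)" m] by (simp add: add_ac)
  have "\<bar>(\<Sum>n<m. g (real n + 1 / 4)) - (G (real m + 1 / 4) - G (1 / 4))\<bar> =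
      \<bar>\<Sum>n<m. G (real n + 1 / 4 + 1) - G (real n + 1 / 4) - g (real n + 1 / 4)\<bar>"
    unfolding tel[symmetric] sum_subtractf by simp
  also have "\<dots> \<le> (\<Sum>n<m. 1 / (real n + 1 / 4)\<^sup>2)"
    by (rule order_trans[OF sum_abs]) (intro sum_mono step, simp)
  finally show ?thesis by (simp add: G_def g_def)
qed

text \<open>The limit formula for Digamma turns the comparison above into an error bounded uniformly
  in \<open>y\<close>. The real part 1/4 is that of \<open>s / 2\<close> on the critical
  line.\<close>

lemma Re_Digamma_quarter:
  obtains C where "\<And>y. 0 < y \<Longrightarrow> \<bar>Re (Digamma (Complex (1 / 4) y)) - ln ((1 / 4)\<^sup>2 + y\<^sup>2) / 2\<bar> \<le> C"
proof -
  have sm: "summable (\<lambda>n. 1 / (real n + 1 / 4)\<^sup>2)"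
    using Polygamma_converges'[of "1 / 4 :: real" 2] by (simp add: inverse_eq_divide add.commute)
  define C where "C = (\<Sum>n. 1 / (real n + 1 / 4)\<^sup>2)"
  have "\<bar>Re (Digamma (Complex (1 / 4) y)) - ln ((1 / 4)\<^sup>2 + y\<^sup>2) / 2\<bar> \<le> C" if y: "0 < y" for y
  proof -
    define S where "S = (\<lambda>m. \<Sum>n<m. (real n + 1 / 4) / ((real n + 1 / 4)\<^sup>2 + y\<^sup>2))"
    have "(\<lambda>m. Re (of_real (ln (real m)) - (\<Sum>n<m. inverse (Complex (1 / 4) y + of_nat n)))) \<longlonglongrightarrow> Re (Digamma (Complex (1 / 4) y))"
      by (intro tendsto_Re Digamma_LIMSEQ) (simp add: complex_eq_iff)
    also have "(\<lambda>m. Re (of_real (ln (real m)) - (\<Sum>n<m. inverse (Complex (1 / 4) y + of_nat n)))) = (\<lambda>m. ln (real m) - S m)"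
      by (simp add: S_def add.commute)
    finally have 1: "(\<lambda>m. ln (real m) - S m) \<longlonglongrightarrow> Re (Digamma (Complex (1 / 4) y))" .
    have 2: "(\<lambda>m. ln (real m) - ln ((real m + 1 / 4)\<^sup>2 + y\<^sup>2) / 2) \<longlonglongrightarrow> 0"
      by real_asymp
    have "(\<lambda>m. (ln (real m) - S m) - (ln (real m) - ln ((real m + 1 / 4)\<^sup>2 + y\<^sup>2) / 2) - ln ((1 / 4)\<^sup>2 + y\<^sup>2) / 2)
       \<longlonglongrightarrow> Re (Digamma (Complex (1 / 4) y)) - 0 - ln ((1 / 4)\<^sup>2 + y\<^sup>2) / 2"
      by (intro tendsto_intros 1 2)
    then have lim: "(\<lambda>m. \<bar>(ln (real m) - S m) - (ln (real m) - ln ((real m + 1 / 4)\<^sup>2 + y\<^sup>2) / 2) - ln ((1 / 4)\<^sup>2 + y\<^sup>2) / 2\<bar>)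
       \<longlonglongrightarrow> \<bar>Re (Digamma (Complex (1 / 4) y)) - ln ((1 / 4)\<^sup>2 + y\<^sup>2) / 2\<bar>"
      using tendsto_rabs by fastforce
    have "\<bar>(ln (real m) - S m) - (ln (real m) - ln ((real m + 1 / 4)\<^sup>2 + y\<^sup>2) / 2) - ln ((1 / 4)\<^sup>2 + y\<^sup>2) / 2\<bar> \<le> C" for m
    proof -
      have "(\<Sum>n<m. 1 / (real n + 1 / 4)\<^sup>2) \<le> C" unfolding C_def by (intro sum_le_suminf sm) auto
      then show ?thesis using sum_inverse_linear_bound[where m = m and y = y]
        fun_cong[OF S_def, of m] by linarith
    qed
    then show ?thesis by (intro LIMSEQ_le_const2[OF lim]) auto
  qed
  then show thesis by (rule that)
qed


text \<open>On the critical line \<open>1 - s = cnj s\<close>, so the logarithmic derivative of the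
  functional equation pairs each quantity with its conjugate, and taking real parts leaves twice the
  one wanted.\<close>

lemma Re_zeta_log_deriv_half:
  assumes t: "t \<noteq> 0" and nz: "zeta (Complex (1 / 2) t) \<noteq> 0"
  shows "Re (deriv zeta (Complex (1 / 2) t) / zeta (Complex (1 / 2) t)) = (ln pi - Re (Digamma (Complex (1 / 4) (t / 2)))) / 2"
proof -
  define s where "s = Complex (1 / 2) t"
  have s: "s \<noteq> 0" "s \<noteq> 1" "1 - s = cnj s" "cnj s \<noteq> 1" "1 - s \<noteq> 0" "1 - s \<noteq> 1"
    using t by (auto simp: s_def complex_eq_iff)
  have s2: "s / 2 = Complex (1 / 4) (t / 2)" by (simp add: s_def complex_eq_iff)
  have s2c: "(1 - s) / 2 = cnj (s / 2)" unfolding s(3) by simp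
  have np: "s / 2 \<notin> \<int>\<^sub>\<le>\<^sub>0" "(1 - s) / 2 \<notin> \<int>\<^sub>\<le>\<^sub>0"
    using t by (auto simp: s_def complex_eq_iff elim!: nonpos_Ints_cases')
  define u v where "u = deriv zeta s" and "v = deriv zeta (1 - s)"
  define P where "P = complex_of_real pi powr (s - 1 / 2)"
  have du: "(zeta has_field_derivative u) (at s)" unfolding u_def
    by (rule holomorphic_derivI[OF zeta_holomorphic]) (use s in auto)
  have dv: "(zeta has_field_derivative v) (at (1 - s))" unfolding v_def
    by (rule holomorphic_derivI[OF zeta_holomorphic]) (use s in auto)
  have i1: "((\<lambda>s. 1 - s) has_field_derivative - 1) (at s)" by (auto intro!: derivative_eq_intros)
  have i3: "((\<lambda>s. s - 1 / 2) has_field_derivative 1) (at s)" by (auto intro!: derivative_eq_intros)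
  note i2 = DERIV_cdivide[OF i1, of 2] and i4 = DERIV_cdivide[OF DERIV_ident, of 2 s UNIV]
  have dv': "((\<lambda>s. zeta (1 - s)) has_field_derivative - v) (at s)"
    by (rule DERIV_cong[OF DERIV_chain2[where f = zeta and g = "\<lambda>s. 1 - s", OF dv i1]]) simp
  have dr1: "((\<lambda>s. rGamma ((1 - s) / 2)) has_field_derivative rGamma ((1 - s) / 2) * Digamma ((1 - s) / 2) / 2) (at s)"
    by (rule DERIV_cong[OF DERIV_chain2[where f = rGamma and g = "\<lambda>s. (1 - s) / 2",
          OF has_field_derivative_rGamma_no_nonpos_int[OF np(2)] i2]]) simp
  have dr2: "((\<lambda>s. rGamma (s / 2)) has_field_derivative - rGamma (s / 2) * Digamma (s / 2) / 2) (at s)"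
    by (rule DERIV_cong[OF DERIV_chain2[where f = rGamma and g = "\<lambda>s. s / 2",
          OF has_field_derivative_rGamma_no_nonpos_int[OF np(1)] i4]]) simp
  have "((\<lambda>s. complex_of_real pi powr (s - 1 / 2)) has_field_derivative Ln (of_real pi) * P * 1) (at s)"
    unfolding P_def by (rule DERIV_chain2[where g = "\<lambda>s. s - 1 / 2", OF has_field_derivative_powr_right i3]) simp
  then have dP: "((\<lambda>s. complex_of_real pi powr (s - 1 / 2)) has_field_derivative P * of_real (ln pi)) (at s)"
    by (simp add: Ln_of_real mult.commute)
  have d1: "((\<lambda>s. zeta s * rGamma ((1 - s) / 2)) has_field_derivative
     u * rGamma ((1 - s) / 2) + rGamma ((1 - s) / 2) * Digamma ((1 - s) / 2) / 2 * zeta s) (at s)"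
    by (rule DERIV_mult[OF du dr1])
  have "((\<lambda>s. of_real pi powr (s - 1 / 2) * zeta (1 - s) * rGamma (s / 2)) has_field_derivative
     (P * of_real (ln pi) * zeta (1 - s) + - v * P) * rGamma (s / 2) + - rGamma (s / 2) * Digamma (s / 2) / 2 * (P * zeta (1 - s))) (at s)"
    unfolding P_def using DERIV_mult[OF DERIV_mult[OF dP dv'] dr2] unfolding P_def .
  then have d2: "((\<lambda>s. zeta s * rGamma ((1 - s) / 2)) has_field_derivative
     (P * of_real (ln pi) * zeta (1 - s) + - v * P) * rGamma (s / 2) + - rGamma (s / 2) * Digamma (s / 2) / 2 * (P * zeta (1 - s))) (at s)"
  proof (rule has_field_derivative_transform_within_open[of _ _ _ "- {0, 1}"])
    show "open (- {0, 1 :: complex})" by (intro open_Compl finite_imp_closed) auto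
    show "complex_of_real pi powr (x - 1 / 2) * zeta (1 - x) * rGamma (x / 2) = zeta x * rGamma ((1 - x) / 2)"
      if "x \<in> - {0, 1}" for x using zeta_functional_equation[of x] that by simp
  qed (use s in auto)
  have r: "rGamma (s / 2) \<noteq> 0" "rGamma ((1 - s) / 2) \<noteq> 0" using np by (auto simp: rGamma_eq_zero_iff)
  have fe: "zeta s * rGamma ((1 - s) / 2) = P * zeta (1 - s) * rGamma (s / 2)"
    unfolding P_def using zeta_functional_equation[of s] s by simp
  have zc: "zeta (1 - s) = cnj (zeta s)" "v = cnj u" unfolding v_def u_def s(3)
    using zeta_cnj[OF s(2)] deriv_zeta_cnj[OF s(2)] by auto
  have z: "zeta s \<noteq> 0" "zeta (1 - s) \<noteq> 0" using nz unfolding zc by (auto simp: s_def)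
  define X where "X = zeta s * rGamma ((1 - s) / 2)"
  have X: "X \<noteq> 0" using z r by (simp add: X_def)
  have "u * rGamma ((1 - s) / 2) + rGamma ((1 - s) / 2) * Digamma ((1 - s) / 2) / 2 * zeta s = X * (u / zeta s + Digamma ((1 - s) / 2) / 2)"
    using z by (simp add: X_def field_simps)
  moreover have "(P * of_real (ln pi) * zeta (1 - s) + - v * P) * rGamma (s / 2) + - rGamma (s / 2) * Digamma (s / 2) / 2 * (P * zeta (1 - s))
      = X * (of_real (ln pi) - v / zeta (1 - s) - Digamma (s / 2) / 2)"
    unfolding X_def fe using z by (simp add: field_simps)
  ultimately have "X * (u / zeta s + Digamma ((1 - s) / 2) / 2) = X * (of_real (ln pi) - v / zeta (1 - s) - Digamma (s / 2) / 2)"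
    using DERIV_unique[OF d1 d2] by simp
  then have "u / zeta s + Digamma ((1 - s) / 2) / 2 = of_real (ln pi) - v / zeta (1 - s) - Digamma (s / 2) / 2"
    using X by simp
  moreover have "v / zeta (1 - s) = cnj (u / zeta s)" using zc by simp
  moreover have "Digamma ((1 - s) / 2) = cnj (Digamma (s / 2))" unfolding s2c by (rule Digamma_cnj) (use s in simp)
  ultimately have "u / zeta s + cnj (Digamma (s / 2)) / 2 = of_real (ln pi) - cnj (u / zeta s) - Digamma (s / 2) / 2"
    by simp
  then have "Re (u / zeta s + cnj (Digamma (s / 2)) / 2) = Re (of_real (ln pi) - cnj (u / zeta s) - Digamma (s / 2) / 2)"
    by (rule arg_cong)
  then have "2 * Re (u / zeta s) = ln pi - Re (Digamma (s / 2))" by (simp del: complex_cnj_divide)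
  then show ?thesis unfolding s2[symmetric] by (simp add: u_def s_def)
qed

lemma Re_zeta_log_deriv_half_bounds:
  "\<exists>T0. \<forall>t\<ge>T0. zeta (Complex (1 / 2) t) \<noteq> 0 \<longrightarrow>
     0 < - Re (deriv zeta (Complex (1 / 2) t) / zeta (Complex (1 / 2) t)) \<and>
     - Re (deriv zeta (Complex (1 / 2) t) / zeta (Complex (1 / 2) t)) \<le> ln t"
proof -
  obtain C where C: "\<And>y. 0 < y \<Longrightarrow> \<bar>Re (Digamma (Complex (1 / 4) y)) - ln ((1 / 4)\<^sup>2 + y\<^sup>2) / 2\<bar> \<le> C"
    using Re_Digamma_quarter by blast
  \<comment> \<open>The second bound gives \<open>C \<le> ln t\<close>; the third gives
    \<open>C + ln pi < ln (t / 2)\<close>, so that the main term of Digamma outweighs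
    \<open>ln pi\<close> together with the error.\<close>
  define T0 where "T0 = max 1 (max (exp C) (2 * exp (C + ln pi) + 1))"
  have "0 < - Re (deriv zeta (Complex (1 / 2) t) / zeta (Complex (1 / 2) t)) \<and>
     - Re (deriv zeta (Complex (1 / 2) t) / zeta (Complex (1 / 2) t)) \<le> ln t"
    if t: "t \<ge> T0" and nz: "zeta (Complex (1 / 2) t) \<noteq> 0" for t
  proof -
    have t1: "t \<ge> 1" "t \<ge> exp C" "t > 2 * exp (C + ln pi)" using t by (auto simp: T0_def)
    define D where "D = Re (Digamma (Complex (1 / 4) (t / 2)))"
    have D: "\<bar>D - ln ((1 / 4)\<^sup>2 + (t / 2)\<^sup>2) / 2\<bar> \<le> C" unfolding D_def using C[of "t / 2"] t1 by simp
    have e: "Re (deriv zeta (Complex (1 / 2) t) / zeta (Complex (1 / 2) t)) = (ln pi - D) / 2"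
      unfolding D_def using Re_zeta_log_deriv_half[OF _ nz] t1 by simp
    have "ln (exp (C + ln pi)) < ln (t / 2)" using t1 by (subst ln_less_cancel_iff) auto
    then have "C + ln pi < ln (t / 2)" by simp
    also have "ln (t / 2) = ln ((t / 2)\<^sup>2) / 2" using t1 by (simp add: ln_realpow)
    also have "\<dots> \<le> ln ((1 / 4)\<^sup>2 + (t / 2)\<^sup>2) / 2" using t1 by (simp add: add_pos_pos)
    finally have lo: "ln pi < D" using D by linarith
    have "1 \<le> t\<^sup>2" using t1 by simp
    then have "(1 / 4)\<^sup>2 + (t / 2)\<^sup>2 \<le> t\<^sup>2" unfolding power_divide by simp
    then have "ln ((1 / 4)\<^sup>2 + (t / 2)\<^sup>2) \<le> ln (t\<^sup>2)" using t1 by (intro ln_mono) (auto intro!: add_pos_pos)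
    also have "ln (t\<^sup>2) = 2 * ln t" using t1 by (simp add: ln_realpow)
    finally have "D \<le> ln t + C" using D by linarith
    also have "C \<le> ln t" using t1 by (subst ln_ge_iff) auto
    finally have "D \<le> 2 * ln t" by simp
    moreover define L where "L = ln pi"
    moreover have "L > 0" using pi_gt3 by (simp add: L_def)
    ultimately have L: "D \<le> 2 * ln t" "0 < L" "L < D" "L = ln pi" using lo by auto
    have "- ((L - D) / 2) \<le> ln t" using L by argo
    moreover have "0 < - ((L - D) / 2)" using L by argo
    ultimately show ?thesis unfolding e L(4)[symmetric] by (rule conjI[rotated])
  qed
  then show ?thesis by blast
qed

section \<open>Zeros of the derivative inside small gaps\<close>

text \<open>The remainder of the linear Taylor polynomial of \<open>1 / (w + \<i> * u)\<close> at 0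
  is exactly \<open>- w\<^sup>2 / (u\<^sup>2 * (w + \<i> * u))\<close>. Keeping
  \<open>1 / u\<^sup>2\<close> as a factor lets the sum over the poles be bounded by
  \<open>A\<close>.\<close>

lemma pole_second_difference_bound:
  fixes u d :: real and w :: complex
  assumes "0 < d" "d \<le> \<bar>u\<bar>" "norm w \<le> d / 2"
  shows "norm (1 / (w + \<i> * of_real u) - 1 / (\<i> * of_real u) - w / of_real (u\<^sup>2)) \<le> 2 * (norm w)\<^sup>2 / d * (1 / u\<^sup>2)"
proof -
  have u: "u \<noteq> 0" using assms by auto
  have lo: "d / 2 \<le> norm (w + \<i> * of_real u)"

  proof -
    have "norm (\<i> * of_real u) - norm (- w) \<le> norm (\<i> * of_real u - (- w))" by (rule norm_triangle_ineq2)
    moreover have "\<i> * of_real u - (- w) = w + \<i> * of_real u" by simp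
    moreover have "norm (\<i> * complex_of_real u) = \<bar>u\<bar>" by (simp add: norm_mult)
    ultimately have "\<bar>u\<bar> - norm w \<le> norm (w + \<i> * of_real u)" by (simp only: norm_minus_cancel)
    then show ?thesis using assms by linarith
  qed
  then have nz: "w + \<i> * of_real u \<noteq> 0" using assms(1) by auto
  have "1 / (w + \<i> * of_real u) - 1 / (\<i> * of_real u) - w / of_real (u\<^sup>2) =
      - w\<^sup>2 / (of_real (u\<^sup>2) * (w + \<i> * of_real u))"
    using u nz by (simp add: divide_simps) (simp add: power2_eq_square algebra_simps)
  also have "norm \<dots> = (norm w)\<^sup>2 / (u\<^sup>2 * norm (w + \<i> * of_real u))"
    by (simp add: norm_divide norm_mult norm_power)
  also have "\<dots> \<le> (norm w)\<^sup>2 / (u\<^sup>2 * (d / 2))"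
    using u lo assms(1) by (intro divide_left_mono mult_left_mono mult_pos_pos) auto
  also have "\<dots> = 2 * (norm w)\<^sup>2 / d * (1 / u\<^sup>2)" by (simp add: mult_ac)
  finally show ?thesis .
qed

lemma filterlim_sum_poles_at_right:
  fixes m :: "real \<Rightarrow> real"
  assumes "finite S" "a \<in> S" "0 < m a" and e: "isCont e a"
  shows "filterlim (\<lambda>t. (\<Sum>y\<in>S. m y / (t - y)) + e t) at_top (at_right a)"
    and "filterlim (\<lambda>t. (\<Sum>y\<in>S. m y / (t - y)) + e t) at_bot (at_left a)"
proof -
  define g where "g = (\<lambda>t. (\<Sum>y\<in>S - {a}. m y / (t - y)) + e t)"
  have eq: "(\<Sum>y\<in>S. m y / (t - y)) + e t = g t + m a / (t - a)" for t
    using assms by (simp add: g_def sum.remove)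
  have "isCont g a" unfolding g_def by (intro continuous_intros e) auto
  then have g: "(g \<longlongrightarrow> g a) (at a within A)" for A
    by (metis continuous_at_imp_continuous_at_within continuous_within)
  have d: "((\<lambda>t. t - a) \<longlongrightarrow> 0) (at a within A)" for A
    by (rule tendsto_eq_intros refl | simp)+
  have "filterlim (\<lambda>t. m a / (t - a)) at_top (at_right a)"
    by (rule LIM_at_top_divide[OF tendsto_const assms(3) d]) (auto simp: eventually_at_filter)
  then show "filterlim (\<lambda>t. (\<Sum>y\<in>S. m y / (t - y)) + e t) at_top (at_right a)"
    unfolding eq by (rule filterlim_tendsto_add_at_top[OF g])
  have "((\<lambda>t. a - t) \<longlongrightarrow> 0) (at_left a)"
    by (rule tendsto_eq_intros refl | simp)+
  then have "filterlim (\<lambda>t. m a / (a - t)) at_top (at_left a)"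
    by (rule LIM_at_top_divide[OF tendsto_const assms(3)]) (auto simp: eventually_at_filter)
  moreover have "m a / (t - a) = - (m a / (a - t))" for t
    using minus_divide_right[of "m a" "a - t"] by simp
  ultimately have "filterlim (\<lambda>t. m a / (t - a)) at_bot (at_left a)"
    by (simp add: filterlim_uminus_at_bot)
  then show "filterlim (\<lambda>t. (\<Sum>y\<in>S. m y / (t - y)) + e t) at_bot (at_left a)"
    unfolding eq by (simp only: filterlim_tendsto_add_at_bot_iff[OF g])
qed

text \<open>The product of \<open>2 * (x * y) \<le> x\<^sup>2 + y\<^sup>2\<close> and
  \<open>4 * (x * y) \<le> (x + y)\<^sup>2\<close>. With \<open>x + y\<close> the length of the gap,
  its two end points alone force a large slope.\<close>

lemma inverse_squares_ge:
  fixes x y :: real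
  assumes "0 < x" "0 < y"
  shows "8 / (x + y)\<^sup>2 \<le> 1 / x\<^sup>2 + 1 / y\<^sup>2"
proof -
  have "8 * (x\<^sup>2 * y\<^sup>2) \<le> (x\<^sup>2 + y\<^sup>2) * (x + y)\<^sup>2"
  proof -
    have 1: "2 * (x * y) \<le> x\<^sup>2 + y\<^sup>2" and 2: "4 * (x * y) \<le> (x + y)\<^sup>2"
      using zero_le_power2[of "x - y"] unfolding power2_sum power2_diff by simp_all
    have "(2 * (x * y)) * (4 * (x * y)) \<le> (x\<^sup>2 + y\<^sup>2) * (x + y)\<^sup>2"
      by (rule mult_mono[OF 1 2]) (use assms in auto)
    then show ?thesis by (simp add: power2_eq_square algebra_simps)
  qed
  then show ?thesis using assms by (simp add: divide_simps) (simp add: algebra_simps)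
qed

text \<open>The coordinates put the critical line on the imaginary axis. Around
  \<open>\<i> * t\<close> the function is \<open>A * (w - w0)\<close> up to a small error, with
  \<open>w0 = l / A\<close>; comparing its size at \<open>w0\<close> with that on the circle of
  radius \<open>w0 / 2\<close> yields a zero inside, and \<open>l > 0\<close> keeps this circle in
  the right half-plane.\<close>

lemma zero_in_gap:
  fixes S :: "real set" and m :: "real \<Rightarrow> real" and E :: "complex \<Rightarrow> complex"
  assumes S: "finite S" "a \<in> S" "b \<in> S" "a < b" "\<And>y. y \<in> S \<Longrightarrow> y \<le> a \<or> b \<le> y"
    and m: "\<And>y. y \<in> S \<Longrightarrow> 1 \<le> m y"
    and U: "open U" and E: "E holomorphic_on U"
    and sub: "\<And>z. a \<le> Im z \<Longrightarrow> Im z \<le> b \<Longrightarrow> \<bar>Re z\<bar> \<le> b - a \<Longrightarrow> z \<in> U"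
    and lip: "\<And>z w. \<lbrakk>a \<le> Im z; Im z \<le> b; \<bar>Re z\<bar> \<le> b - a; a \<le> Im w; Im w \<le> b; \<bar>Re w\<bar> \<le> b - a\<rbrakk>
                 \<Longrightarrow> norm (E z - E w) \<le> K * norm (z - w)"
    and re: "\<And>t. a < t \<Longrightarrow> t < b \<Longrightarrow> Re (E (\<i> * of_real t)) < 0"
    and le: "\<And>t. a < t \<Longrightarrow> t < b \<Longrightarrow> - Re (E (\<i> * of_real t)) \<le> L"
    and small: "L * (b - a) \<le> 1 / 20" "K * (b - a)\<^sup>2 \<le> 1 / 4" "0 \<le> K"
  shows "\<exists>z. a < Im z \<and> Im z < b \<and> 0 < Re z \<and> Re z \<le> L * (b - a)\<^sup>2 / 4 \<and>
            (\<Sum>y\<in>S. of_real (m y) / (z - \<i> * of_real y)) + E z = 0"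
proof -
  have m0: "0 \<le> m y" if "y \<in> S" for y using m[OF that] by simp
  define f where "f = (\<lambda>z. (\<Sum>y\<in>S. of_real (m y) / (z - \<i> * of_real y)) + E z)"
  define \<delta> where "\<delta> = b - a"
  have \<delta>: "\<delta> > 0" using S by (simp add: \<delta>_def)
  define e where "e = (\<lambda>t. - Im (E (\<i> * of_real t)))"
  define g where "g = (\<lambda>t. (\<Sum>y\<in>S. m y / (t - y)) + e t)"
  have Econt: "isCont E z" if "z \<in> U" for z
    using holomorphic_on_imp_continuous_on[OF E] U that by (simp add: continuous_on_eq_continuous_at)
  have econt: "isCont e t" if "a \<le> t" "t \<le> b" for t
  proof -
    have "isCont (\<lambda>t. E (\<i> * of_real t)) t"
      by (rule isCont_o2[of t "\<lambda>t. \<i> * of_real t" E]) (use that \<delta> in \<open>auto intro!: continuous_intros Econt sub simp: \<delta>_def\<close>)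
    then show ?thesis unfolding e_def by (intro isCont_minus isCont_Im)
  qed
  have gcont: "isCont g t" if "a < t" "t < b" for t
    unfolding g_def by (intro continuous_intros econt) (use that S(5) in force)+
  have split: "f (\<i> * of_real t) = of_real (Re (E (\<i> * of_real t))) - \<i> * of_real (g t)" if "a < t" "t < b" for t
  proof -
    have "(\<Sum>y\<in>S. of_real (m y) / (\<i> * of_real t - \<i> * of_real y)) = - \<i> * of_real (\<Sum>y\<in>S. m y / (t - y))"
      unfolding of_real_sum sum_distrib_left
    proof (rule sum.cong)
      fix y assume "y \<in> S"
      have "complex_of_real (m y) / (\<i> * of_real t - \<i> * of_real y) = of_real (m y) / (\<i> * of_real (t - y))"
        by (simp add: algebra_simps)
      also have "\<dots> = - \<i> * of_real (m y / (t - y))" by (simp add: divide_simps)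
      finally show "complex_of_real (m y) / (\<i> * of_real t - \<i> * of_real y) = - \<i> * of_real (m y / (t - y))" .
    qed simp
    then show ?thesis unfolding f_def g_def e_def by (simp add: complex_eq_iff)
  qed
  \<comment> \<open>\<open>g\<close> runs from plus infinity just above \<open>a\<close> to minus
    infinity just below \<open>b\<close>, as the poles at both ends have positive weight.\<close>
  have "\<exists>t. a < t \<and> t < b \<and> g t = 0"
  proof -
    have "filterlim g at_top (at_right a)" "filterlim g at_bot (at_left b)"
      unfolding g_def using S m[OF S(2)] m[OF S(3)]
      by (auto intro!: filterlim_sum_poles_at_right econt)
    then have "\<forall>\<^sub>F t in at_right a. 0 < g t" "\<forall>\<^sub>F t in at_left b. g t < 0"
      by (auto simp: filterlim_at_top_dense filterlim_at_bot_dense)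
    moreover have "\<forall>\<^sub>F t in at_right a. t \<in> {a<..<(a + b) / 2}" "\<forall>\<^sub>F t in at_left b. t \<in> {(a + b) / 2<..<b}"
      using eventually_at_right_real[of a "(a + b) / 2"] eventually_at_left_real[of "(a + b) / 2" b] S by auto
    ultimately have "\<forall>\<^sub>F t in at_right a. 0 < g t \<and> t \<in> {a<..<(a + b) / 2}"
      "\<forall>\<^sub>F t in at_left b. g t < 0 \<and> t \<in> {(a + b) / 2<..<b}"
      by (auto elim: eventually_elim2)
    then obtain t1 t2 where t: "0 < g t1" "t1 \<in> {a<..<(a + b) / 2}" "g t2 < 0" "t2 \<in> {(a + b) / 2<..<b}"
      using eventually_happens'[of "at_right a"] eventually_happens'[of "at_left b"]
      by (metis (no_types, lifting) trivial_limit_at_left_real trivial_limit_at_right_real)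
    have "\<exists>t\<ge>t1. t \<le> t2 \<and> g t = 0"
      by (rule IVT2) (use t gcont in auto)
    then show ?thesis using t by (metis atLeastAtMost_iff greaterThanLessThan_iff less_le_trans order_le_less_trans)
  qed
  then obtain t where t: "a < t" "t < b" "g t = 0" by blast
  define l where "l = - Re (E (\<i> * of_real t))"
  have l: "0 < l" "l \<le> L" using re[of t] le[of t] t by (auto simp: l_def)
  have ft: "f (\<i> * of_real t) = - of_real l" using split[of t] t by (simp add: l_def)
  define A where "A = (\<Sum>y\<in>S. m y / (t - y)\<^sup>2)"
  define d where "d = min (t - a) (b - t)"
  have d: "0 < d" "d \<le> \<delta> / 2" "d \<le> t - a" "d \<le> b - t" using t by (auto simp: d_def \<delta>_def min_def)
  have du: "d \<le> \<bar>t - y\<bar>" if "y \<in> S" for y using S(5)[OF that] d t by auto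
  have A2: "1 / (t - a)\<^sup>2 + 1 / (b - t)\<^sup>2 \<le> A"
  proof -
    have "1 / (t - a)\<^sup>2 + 1 / (b - t)\<^sup>2 = (\<Sum>y\<in>{a, b}. 1 / (t - y)\<^sup>2)"
      using S by (simp add: power2_commute)
    also have "\<dots> \<le> (\<Sum>y\<in>{a, b}. m y / (t - y)\<^sup>2)"
      using m S by (intro sum_mono divide_right_mono) auto
    also have "\<dots> \<le> A" unfolding A_def using S m0 by (intro sum_mono2) auto
    finally show ?thesis .
  qed
  \<comment> \<open>Two lower bounds for \<open>A\<close>: one by the gap length, to control
    \<open>K\<close> and the final displacement, and one by the distance \<open>d\<close> to the
    nearer end, to keep \<open>w0\<close> small against \<open>d\<close> even when \<open>t\<close>
    is close to an end.\<close>
  have A8: "8 / \<delta>\<^sup>2 \<le> A" using inverse_squares_ge[of "t - a" "b - t"] t A2 by (simp add: \<delta>_def)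
  have Ad: "1 / d\<^sup>2 \<le> A" using A2 t by (cases "t - a \<le> b - t") (auto simp: d_def min_def intro: order_trans[rotated])
  have A0: "A > 0" using A8 \<delta> by (smt (verit) divide_pos_pos zero_less_power)
  define w0 where "w0 = l / A"
  have w0: "0 < w0" using l A0 by (simp add: w0_def)
  \<comment> \<open>\<open>l * d \<le> L * \<delta> / 2 \<le> 1 / 40\<close> and
    \<open>1 / A \<le> d\<^sup>2\<close>, hence \<open>l / A \<le> (l * d) * d\<close>.\<close>
  have w0d: "w0 \<le> d / 40"
  proof -
    have "l * d \<le> L * (\<delta> / 2)" using l d by (intro mult_mono) auto
    also have "\<dots> \<le> 1 / 40" using small(1) by (simp add: \<delta>_def)
    finally have ld: "l * d \<le> 1 / 40" .
    have "l \<le> (l * d) * (d * A)"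
    proof -
      have "1 \<le> d * d * A" using Ad d(1) by (simp add: divide_le_eq power2_eq_square mult.commute)
      then have "l * 1 \<le> l * (d * d * A)" using l by (intro mult_left_mono) auto
      then show ?thesis by (simp add: mult_ac)
    qed
    also have "\<dots> \<le> 1 / 40 * (d * A)" using ld d A0 by (intro mult_right_mono) auto
    finally show ?thesis using A0 by (simp add: w0_def divide_le_eq mult_ac)
  qed
  have KA: "K \<le> A / 32"
  proof -
    have "K \<le> 1 / (4 * \<delta>\<^sup>2)" using small(2) \<delta> by (simp add: \<delta>_def field_simps)
    also have "\<dots> = (8 / \<delta>\<^sup>2) / 32" by simp
    also have "\<dots> \<le> A / 32" using A8 by simp
    finally show ?thesis .
  qed
  have box: "a \<le> Im (\<i> * of_real t + w)" "Im (\<i> * of_real t + w) \<le> b" "\<bar>Re (\<i> * of_real t + w)\<bar> \<le> b - a"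
    if "norm w \<le> d / 2" for w
    using abs_Re_le_cmod[of w] abs_Im_le_cmod[of w] that d t by (auto simp: \<delta>_def)
  have boxt: "\<i> * of_real t + 0 = \<i> * of_real t" by simp
  define \<phi> where "\<phi> = (\<lambda>w. f (\<i> * of_real t + w))"
  have err: "norm (\<phi> w - of_real A * (w - of_real w0)) \<le> 2 * A * (norm w)\<^sup>2 / d + K * norm w" if w: "norm w \<le> d / 2" for w
  proof -
    have "of_real A * (w - of_real w0) = of_real A * w - of_real l"
      using A0 by (simp add: w0_def algebra_simps)
    then have "\<phi> w - of_real A * (w - of_real w0) = f (\<i> * of_real t + w) - f (\<i> * of_real t) - of_real A * w"
      by (simp add: \<phi>_def ft)
    also have "\<dots> = (\<Sum>y\<in>S. of_real (m y) * (1 / (w + \<i> * of_real (t - y)) - 1 / (\<i> * of_real (t - y)) - w / of_real ((t - y)\<^sup>2)))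
        + (E (\<i> * of_real t + w) - E (\<i> * of_real t))"
    proof -
      have "of_real A * w = (\<Sum>y\<in>S. of_real (m y) * (w / of_real ((t - y)\<^sup>2)))"
        unfolding A_def of_real_sum sum_distrib_right by (intro sum.cong) auto
      moreover have "\<i> * of_real t + w - \<i> * of_real y = w + \<i> * of_real (t - y)"
        "\<i> * of_real t - \<i> * of_real y = \<i> * of_real (t - y)" for y
        by (simp_all add: algebra_simps)
      ultimately show ?thesis
        by (simp only: f_def sum_subtractf right_diff_distrib) simp
    qed
    also have "norm \<dots> \<le> (\<Sum>y\<in>S. 2 * (norm w)\<^sup>2 / d * (m y / (t - y)\<^sup>2)) + K * norm w"
    proof (intro norm_triangle_le add_mono sum_norm_le)
      fix y assume y: "y \<in> S"
      have "norm (of_real (m y) * (1 / (w + \<i> * of_real (t - y)) - 1 / (\<i> * of_real (t - y)) - w / of_real ((t - y)\<^sup>2)))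
          \<le> m y * (2 * (norm w)\<^sup>2 / d * (1 / (t - y)\<^sup>2))"
        unfolding norm_mult norm_of_real using m[OF y]
        by (intro mult_mono[OF _ pole_second_difference_bound[OF d(1) du[OF y] w]]) auto
      then show "norm (of_real (m y) * (1 / (w + \<i> * of_real (t - y)) - 1 / (\<i> * of_real (t - y)) - w / of_real ((t - y)\<^sup>2)))
          \<le> 2 * (norm w)\<^sup>2 / d * (m y / (t - y)\<^sup>2)" by (simp add: mult_ac)
    next
      show "norm (E (\<i> * of_real t + w) - E (\<i> * of_real t)) \<le> K * norm w"
        using lip[OF box[OF w] box[of 0, unfolded boxt]] d by simp
    qed
    also have "(\<Sum>y\<in>S. 2 * (norm w)\<^sup>2 / d * (m y / (t - y)\<^sup>2)) = 2 * A * (norm w)\<^sup>2 / d"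
      unfolding sum_distrib_left[symmetric] A_def[symmetric] by simp
    finally show ?thesis .
  qed
  \<comment> \<open>The quadratic error contributes 9/80 and the Lipschitz error 3/64 of
    \<open>A * w0\<close>, together below 1/5. Two such errors stay below the modulus
    \<open>A * w0 / 2\<close> of the linear part on the circle.\<close>
  have errb: "norm (\<phi> w - of_real A * (w - of_real w0)) \<le> A * w0 * (1 / 5)" if w: "norm w \<le> 3 / 2 * w0" for w
  proof -
    have wd: "norm w \<le> d / 2" using w w0d w0 d by auto
    have "2 * A * (norm w)\<^sup>2 / d \<le> 2 * A * (3 / 2 * w0)\<^sup>2 / d"
      using w A0 d by (intro divide_right_mono mult_left_mono power_mono) auto
    also have "\<dots> = 9 / 2 * A * w0 * (w0 / d)" by (simp add: power2_eq_square)
    also have "\<dots> \<le> 9 / 2 * A * w0 * (1 / 40)"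
      using w0d w0 A0 d by (intro mult_left_mono) (auto simp: field_simps)
    finally have 1: "2 * A * (norm w)\<^sup>2 / d \<le> 9 / 2 * A * w0 * (1 / 40)" .
    have 2: "K * norm w \<le> A / 32 * (3 / 2 * w0)" using KA w small(3) A0 by (intro mult_mono) auto
    have 3: "9 / 2 * A * w0 * (1 / 40) + A / 32 * (3 / 2 * w0) \<le> A * w0 * (1 / 5)" using A0 w0 by simp
    show ?thesis using err[OF wd] 1 2 3 by linarith
  qed
  have inb: "norm w \<le> 3 / 2 * w0" if "norm (of_real w0 - w) \<le> w0 / 2" for w :: complex
    using norm_triangle_ineq2[of w "of_real w0"] that w0 by (simp add: norm_minus_commute)
  obtain w where w: "w \<in> ball (of_real w0) (w0 / 2)" "\<phi> w = 0"
  proof (rule holomorphic_contract_to_zero[of "of_real w0" "w0 / 2" \<phi>])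
    define V where "V = {z. \<i> * of_real t + z \<in> U} - (\<lambda>y. \<i> * of_real (y - t)) ` S"
    have "(E \<circ> (\<lambda>z. \<i> * of_real t + z)) holomorphic_on V"
      by (rule holomorphic_on_compose_gen[OF _ E]) (auto simp: V_def intro!: holomorphic_intros)
    then have E': "(\<lambda>z. E (\<i> * of_real t + z)) holomorphic_on V" by (simp add: o_def)
    have nzV: "\<i> * of_real t + z - \<i> * of_real y \<noteq> 0" if "z \<in> V" "y \<in> S" for z y
    proof
      assume "\<i> * of_real t + z - \<i> * of_real y = 0"
      moreover have "z = (\<i> * of_real t + z - \<i> * of_real y) + \<i> * of_real (y - t)"
        by (simp add: right_diff_distrib)
      ultimately have "z = \<i> * of_real (y - t)" by simp
      then show False using that unfolding V_def by blast
    qed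
    have "\<phi> holomorphic_on V"
      unfolding \<phi>_def f_def by (intro holomorphic_intros E' nzV)
    moreover have "cball (of_real w0) (w0 / 2) \<subseteq> V"
    proof
      fix z assume "z \<in> cball (complex_of_real w0) (w0 / 2)"
      then have z: "norm (of_real w0 - z) \<le> w0 / 2" by (simp add: dist_norm)
      then have nz: "norm z \<le> 3 / 2 * w0" by (rule inb)
      then have "norm z \<le> d / 2" using w0d w0 d by auto
      then have "\<i> * of_real t + z \<in> U" using box by (intro sub) auto
      moreover have "z \<noteq> \<i> * of_real (y - t)" if "y \<in> S" for y
      proof
        assume "z = \<i> * of_real (y - t)"
        then have "norm z = \<bar>t - y\<bar>" by (simp add: norm_mult abs_minus_commute del: of_real_diff)
        then show False using du[OF that] \<open>norm z \<le> d / 2\<close> d by simp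
      qed
      ultimately show "z \<in> V" by (auto simp: V_def)
    qed
    ultimately show "continuous_on (cball (of_real w0) (w0 / 2)) \<phi>" "\<phi> holomorphic_on ball (of_real w0) (w0 / 2)"
      using holomorphic_on_subset[of \<phi> V "cball (of_real w0) (w0 / 2)"]
        holomorphic_on_subset[of \<phi> V "ball (of_real w0) (w0 / 2)"]
        ball_subset_cball[of "complex_of_real w0" "w0 / 2"]
      by (blast intro: holomorphic_on_imp_continuous_on)+
    fix z assume z: "norm (complex_of_real w0 - z) = w0 / 2"
    have "norm (\<phi> (of_real w0)) \<le> A * w0 * (1 / 5)" using errb[of "of_real w0"] w0 by simp
    moreover have "norm (of_real A * (z - of_real w0)) = A * (w0 / 2)"
      unfolding norm_mult using z A0 by (simp add: norm_minus_commute)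
    then have "A * (w0 / 2) - A * w0 * (1 / 5) \<le> norm (\<phi> z)"
      using errb[OF inb, of z] z norm_triangle_ineq2[of "of_real A * (z - of_real w0)" "of_real A * (z - of_real w0) - \<phi> z"]
      by (simp add: norm_minus_commute)
    moreover have "A * w0 * (1 / 5) < A * (w0 / 2) - A * w0 * (1 / 5)" using A0 w0 by simp
    ultimately show "norm (\<phi> (of_real w0)) < norm (\<phi> z)" by linarith
  qed (use w0 in auto)
  have nw: "norm (w - of_real w0) < w0 / 2" using w(1) by (simp add: dist_norm norm_minus_commute)
  have "\<bar>Re w - w0\<bar> < w0 / 2" "\<bar>Im w\<bar> < w0 / 2"
    using abs_Re_le_cmod[of "w - of_real w0"] abs_Im_le_cmod[of "w - of_real w0"] nw by auto
  \<comment> \<open>A displacement of at most \<open>3 / 2 * w0\<close> is then at most 3/16 of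
    \<open>L * \<delta>\<^sup>2\<close>, within the claimed quarter.\<close>
  moreover have "w0 \<le> L * \<delta>\<^sup>2 / 8"
  proof -
    have "l * 8 \<le> L * (A * \<delta>\<^sup>2)"
      using mult_mono[OF l(2), of 8 "A * \<delta>\<^sup>2"] A8 \<delta> l by (simp add: divide_le_eq)
    then show ?thesis using A0 by (simp add: w0_def divide_le_eq mult_ac)
  qed
  moreover have "0 < Re w" "Re w \<le> 3 / 2 * w0" using \<open>\<bar>Re w - w0\<bar> < w0 / 2\<close> by linarith+
  ultimately show ?thesis
    using w(2) t d w0d w0 by (intro exI[of _ "\<i> * of_real t + w"]) (auto simp: \<phi>_def f_def \<delta>_def)
qed

section \<open>Isolation and multiplicity of the zeros of zeta and its derivative\<close>

lemma zeta_not_affine: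
  assumes "\<And>s. s \<noteq> 1 \<Longrightarrow> zeta s = c * s + d"
  shows False
proof -
  have "((\<lambda>s. (s - 1) * (c * s + d)) \<longlongrightarrow> (1 - 1) * (c * 1 + d)) (at 1)" by (intro tendsto_intros)
  moreover have "((\<lambda>s. (s - 1) * (c * s + d)) \<longlongrightarrow> 1) (at 1)"
    using zeta_pole by (rule Lim_transform_eventually) (auto simp: eventually_at_filter assms)
  ultimately have "(1 - 1) * (c * 1 + d) = 1" by (intro tendsto_unique) auto
  then show False by simp
qed

lemma connected_punctured_complex: "connected (- {1 :: complex})" and open_punctured_complex: "open (- {1 :: complex})"
  by (auto intro!: connected_punctured_universe)

lemma zeta_not_constant: "\<not> zeta constant_on - {1}"
proof
  assume "zeta constant_on - {1}"
  then obtain d where "\<And>s. s \<noteq> 1 \<Longrightarrow> zeta s = d" by (auto simp: constant_on_def)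
  then show False by (intro zeta_not_affine[of 0 d]) auto
qed

lemma deriv_zeta_holomorphic: "deriv zeta holomorphic_on - {1}"
  by (intro holomorphic_deriv zeta_holomorphic open_punctured_complex)

lemma deriv_zeta_not_constant: "\<not> deriv zeta constant_on - {1}"
proof
  assume "deriv zeta constant_on - {1}"
  then obtain c where c: "\<And>s. s \<noteq> 1 \<Longrightarrow> deriv zeta s = c" by (auto simp: constant_on_def)
  have "(\<lambda>s. zeta s - c * s) constant_on - {1}"
  proof (rule has_field_derivative_0_imp_constant_on)
    fix s :: complex assume s: "s \<in> - {1}"
    have "(zeta has_field_derivative c) (at s)"
      using holomorphic_derivI[OF zeta_holomorphic open_punctured_complex s] c s by simp
    then show "((\<lambda>s. zeta s - c * s) has_field_derivative 0) (at s)"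
      by (auto intro!: derivative_eq_intros)
  qed (use connected_punctured_complex open_punctured_complex in auto)
  then obtain d where d: "\<And>s. s \<noteq> 1 \<Longrightarrow> zeta s - c * s = d" unfolding constant_on_def by blast
  show False by (rule zeta_not_affine[of c d]) (use d in \<open>auto simp: algebra_simps\<close>)
qed

lemma frequently_nonzero:
  assumes f: "f holomorphic_on - {1}" "\<not> f constant_on - {1}" and s: "s \<noteq> 1"
  shows "\<exists>\<^sub>F w in at s. f w \<noteq> 0"
proof (rule ccontr)
  assume "\<not> (\<exists>\<^sub>F w in at s. f w \<noteq> 0)"
  then have "\<forall>\<^sub>F w in at s. f w = 0" by (simp add: not_frequently)
  then obtain e where e: "e > 0" "\<And>w. w \<noteq> s \<Longrightarrow> dist w s < e \<Longrightarrow> f w = 0"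
    by (auto simp: eventually_at)
  define r where "r = min e (dist s 1)"
  have r: "r > 0" using e s by (simp add: r_def)
  have "f w = 0" if "w \<in> - {1}" for w
  proof (rule analytic_continuation[OF f(1) open_punctured_complex connected_punctured_complex,
        of "ball s r - {s}" s])
    show "s islimpt ball s r - {s}"
      using r islimpt_ball[of s s r] by (simp flip: islimpt_punctured)
  qed (use that s e in \<open>auto simp: dist_commute r_def\<close>)
  then show False using f(2) by (auto simp: constant_on_def)
qed

lemma zero_mult_pos:
  assumes "f holomorphic_on - {1}" "\<not> f constant_on - {1}" "s \<noteq> 1" "f s = 0"
  shows "1 \<le> zero_mult f s"
proof -
  have "zorder f s > 0"
    using zorder_pos_iff[OF assms(1) open_punctured_complex, of s] frequently_nonzero[OF assms(1-3)] assms by simp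
  then show ?thesis by (simp add: zero_mult_def)
qed

text \<open>The subtraction never truncates, since the order of a zero is positive; at a simple zero
  of zeta the derivative has order 0.\<close>

lemma zero_mult_deriv_zeta:
  assumes s: "s \<noteq> 1" "zeta s = 0"
  shows "zero_mult (deriv zeta) s = zero_mult zeta s - 1"
proof -
  have an: "zeta analytic_on {s}"
    using zeta_holomorphic open_punctured_complex s by (auto simp: analytic_at)
  have f: "\<exists>\<^sub>F w in at s. zeta w \<noteq> 0"
    by (rule frequently_nonzero[OF zeta_holomorphic zeta_not_constant s(1)])
  have p: "zorder zeta s > 0"
    using zorder_pos_iff[OF zeta_holomorphic open_punctured_complex, of s] f s by simp
  have "zorder (deriv zeta) s = zorder zeta s - 1"
    using p by (intro zorder_deriv_minus_1 f isolated_singularity_at_analytic not_essential_analytic an) auto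
  then show ?thesis by (simp add: zero_mult_def nat_diff_distrib')
qed

lemma riemann_hypothesisD:
  assumes "riemann_hypothesis" "zeta s = 0" "Im s \<noteq> 0"
  shows "Re s = 1 / 2"
  using assms zeta_nontrivial_zero_strip[of s] by (simp add: riemann_hypothesis_def)

lemma local_log_deriv_mono: "local_log_deriv f R r B \<Longrightarrow> B \<le> B' \<Longrightarrow> local_log_deriv f R r B'"
  unfolding local_log_deriv_def by (meson order_trans)

text \<open>The 3-4-1 inequality at \<open>x = 2\<close>: the other factors are bounded by
  \<open>B\<close>, so \<open>B ^ 4 * norm (zeta (Complex 2 t)) ^ 4 \<ge> 1\<close>.\<close>

lemma zeta_2_lower_bound: "\<exists>c>0. \<forall>t. c \<le> norm (zeta (Complex 2 t))"
proof -
  define B where "B = (\<Sum>n. real (Suc n) powr (- 2))"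
  have sm: "summable (\<lambda>n. real (Suc n) powr (- 2))" by (rule summable_Suc_powr) simp
  have up: "norm (zeta (Complex 2 t)) \<le> B" for t
  proof -
    have e: "norm (of_nat (Suc n) powr (- Complex 2 t) :: complex) = real (Suc n) powr (- 2)" for n
      unfolding norm_Suc_powr by simp
    have "norm (\<Sum>n. of_nat (Suc n) powr (- Complex 2 t) :: complex) \<le> (\<Sum>n. norm (of_nat (Suc n) powr (- Complex 2 t) :: complex))"
      by (rule summable_norm) (unfold e, rule sm)
    then show ?thesis unfolding e B_def using zeta_sums[of "Complex 2 t"] by (simp add: sums_iff)
  qed
  have B: "B > 0"
  proof -
    have "real (Suc 0) powr (- 2) \<le> B" unfolding B_def
      by (rule order_trans[OF _ sum_le_suminf[OF sm, of "{0}"]]) auto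
    then show ?thesis by simp
  qed
  have "1 / B \<le> norm (zeta (Complex 2 t))" for t
  proof (rule ccontr)
    assume *: "\<not> 1 / B \<le> norm (zeta (Complex 2 t))"
    have "norm (zeta (of_real 2)) ^ 3 * norm (zeta (Complex 2 t)) ^ 4 * norm (zeta (Complex 2 (2 * t)))
        \<le> B ^ 3 * norm (zeta (Complex 2 t)) ^ 4 * B"
      using up[of 0] up[of "2 * t"] B by (intro mult_mono power_mono) (auto simp: complex_of_real_def)
    also have "\<dots> < B ^ 3 * (1 / B) ^ 4 * B"
      using * B by (intro mult_strict_right_mono mult_strict_left_mono power_strict_mono) auto
    also have "\<dots> = 1" using B by (simp add: field_simps eval_nat_numeral)
    finally show False using zeta_3_4_1[of 2 t] by simp
  qed
  then show ?thesis using B by (intro exI[of _ "1 / B"]) auto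
qed

text \<open>The disc of radius 17/10 about \<open>2 + \<i> * \<tau>\<close> crosses the critical
  line, at distance 3/2, with room to spare, and radius 19/10 still stays in
  \<open>1 / 10 \<le> Re s\<close>. Linear growth against the lower bound at the centre makes
  \<open>M / norm (f 0)\<close> at most \<open>\<tau>\<^sup>2\<close>, which gives the
  \<open>ln \<tau>\<close>.\<close>

lemma zeta_local_log_deriv:
  "\<exists>K>0. \<exists>T0\<ge>4. \<forall>\<tau>\<ge>T0. finite {p \<in> cball 0 (9 / 5). zeta (p + Complex 2 \<tau>) = 0} \<and>
     local_log_deriv (\<lambda>z. zeta (z + Complex 2 \<tau>)) (9 / 5) (17 / 10) (K * ln \<tau>)"
proof -
  obtain c where c: "c > 0" "\<And>t. c \<le> norm (zeta (Complex 2 t))" using zeta_2_lower_bound by blast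
  obtain C where C: "C > 0" "\<And>s. 1 / 10 \<le> Re s \<Longrightarrow> Re s \<le> 4 \<Longrightarrow> 1 \<le> \<bar>Im s\<bar> \<Longrightarrow> norm (zeta s) \<le> C * \<bar>Im s\<bar>"
    using zeta_strip_bound by blast
  define K0 where "K0 = 32 * (9 / 5) / (9 / 5 - 17 / 10) ^ 3 + 1 / (ln ((19 / 10) / (9 / 5)) * (19 / 10 - 9 / 5 :: real)\<^sup>2)"
  have K0: "K0 > 0" unfolding K0_def by (intro add_pos_pos divide_pos_pos mult_pos_pos ln_gt_zero) auto
  have "\<forall>\<^sub>F \<tau> in at_top. 4 \<le> \<tau> \<and> C * (\<tau> + 2) / c \<le> \<tau>\<^sup>2"
    by (intro eventually_conj eventually_ge_at_top) (use c C in real_asymp)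
  then obtain T0 where T0: "\<And>\<tau>. \<tau> \<ge> T0 \<Longrightarrow> 4 \<le> \<tau> \<and> C * (\<tau> + 2) / c \<le> \<tau>\<^sup>2"
    by (auto simp: eventually_at_top_linorder)
  have "finite {p \<in> cball 0 (9 / 5). zeta (p + Complex 2 \<tau>) = 0} \<and>
     local_log_deriv (\<lambda>z. zeta (z + Complex 2 \<tau>)) (9 / 5) (17 / 10) (2 * K0 * ln \<tau>)" if t: "\<tau> \<ge> max T0 4" for \<tau>
  proof -
    have \<tau>: "4 \<le> \<tau>" "C * (\<tau> + 2) / c \<le> \<tau>\<^sup>2" using T0[of \<tau>] t by auto
    define f where "f = (\<lambda>z. zeta (z + Complex 2 \<tau>))"
    define M where "M = C * (\<tau> + 2)"
    have inb: "1 / 10 \<le> Re (z + Complex 2 \<tau>)" "Re (z + Complex 2 \<tau>) \<le> 4" "1 \<le> \<bar>Im (z + Complex 2 \<tau>)\<bar>"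
      "\<bar>Im (z + Complex 2 \<tau>)\<bar> \<le> \<tau> + 2" if "norm z \<le> 19 / 10" for z
      using that abs_Re_le_cmod[of z] abs_Im_le_cmod[of z] \<tau> by auto
    have hol: "f holomorphic_on ball 0 2"
    proof -
      have "(zeta \<circ> (\<lambda>z. z + Complex 2 \<tau>)) holomorphic_on ball 0 2"
      proof (rule holomorphic_on_compose_gen[OF _ zeta_holomorphic])
        show "(\<lambda>z. z + Complex 2 \<tau>) ` ball 0 2 \<subseteq> - {1}"
        proof clarify
          fix z assume "z \<in> ball 0 2" "z + Complex 2 \<tau> = 1"
          then show False using abs_Im_le_cmod[of z] \<tau> by (auto simp: complex_eq_iff)
        qed
      qed (intro holomorphic_intros)
      then show ?thesis by (simp add: f_def o_def)
    qed
    have f0: "c \<le> norm (f 0)" using c(2)[of \<tau>] by (simp add: f_def)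
    have fM: "norm (f z) \<le> M" if "norm z = 19 / 10" for z
    proof -
      have "norm (f z) \<le> C * \<bar>Im (z + Complex 2 \<tau>)\<bar>" unfolding f_def using inb[of z] that by (intro C) auto
      also have "\<dots> \<le> M" unfolding M_def using inb(4)[of z] that C by (intro mult_left_mono) auto
      finally show ?thesis .
    qed
    have "norm (f 0) \<le> C * \<tau>" using C(2)[of "Complex 2 \<tau>"] \<tau> by (simp add: f_def)
    then have f0M: "norm (f 0) < M" unfolding M_def using C(1) by (simp add: algebra_simps)
    have "f 0 \<noteq> 0" using f0 c by auto
    note L = local_log_deriv[of "17 / 10" "9 / 5" "19 / 10" 2 f M, OF _ _ _ _ hol this f0M fM]
    have "ln (M / norm (f 0)) \<le> ln (\<tau>\<^sup>2)"
    proof (rule ln_mono)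
      have "M / norm (f 0) \<le> M / c" using f0 c C \<tau> by (intro divide_left_mono) (auto simp: M_def intro!: mult_pos_pos)
      then show "M / norm (f 0) \<le> \<tau>\<^sup>2" using \<tau> by (simp add: M_def)
      show "0 < M / norm (f 0)" using f0 c C \<tau> by (auto simp: M_def intro!: divide_pos_pos)
    qed
    also have "ln (\<tau>\<^sup>2) = 2 * ln \<tau>" using \<tau> by (simp add: ln_realpow)
    finally have "K0 * ln (M / norm (f 0)) \<le> K0 * (2 * ln \<tau>)" using K0 by (intro mult_left_mono) auto
    then show ?thesis using L local_log_deriv_mono[of f "9 / 5" "17 / 10" "K0 * ln (M / norm (f 0))"]
      unfolding K0_def[symmetric] f_def by (auto simp: mult_ac)
  qed
  then show ?thesis using K0 by (intro exI[of _ "2 * K0"] conjI exI[of _ "max T0 4"]) auto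
qed

text \<open>Transfers \<open>zero_in_gap\<close> to zeta, with the disc centred at
  \<open>2 + \<i> * a\<close>. The Riemann Hypothesis puts all zeros in that disc on one vertical
  line, which is the arrangement of poles in \<open>zero_in_gap\<close>.\<close>

lemma deriv_zeta_zero_in_gap:
  assumes RH: "riemann_hypothesis"
  shows "\<exists>c>0. \<exists>T0\<ge>4. \<forall>a b. T0 \<le> a \<and> a < b \<and> zeta (Complex (1 / 2) a) = 0 \<and> zeta (Complex (1 / 2) b) = 0 \<and>
    (\<forall>s. zeta s = 0 \<longrightarrow> Im s \<le> a \<or> b \<le> Im s) \<and> (b - a) * ln b \<le> c \<longrightarrow>
    (\<exists>s. deriv zeta s = 0 \<and> a < Im s \<and> Im s < b \<and> 1 / 2 < Re s \<and> Re s \<le> 1 / 2 + ln b * (b - a)\<^sup>2 / 4)"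
proof -
  obtain K0 T1 where K0: "K0 > 0" "T1 \<ge> 4" and loc: "\<And>\<tau>. \<tau> \<ge> T1 \<Longrightarrow> finite {p \<in> cball 0 (9 / 5). zeta (p + Complex 2 \<tau>) = 0}"
     "\<And>\<tau>. \<tau> \<ge> T1 \<Longrightarrow> local_log_deriv (\<lambda>z. zeta (z + Complex 2 \<tau>)) (9 / 5) (17 / 10) (K0 * ln \<tau>)"
    using zeta_local_log_deriv by blast
  obtain T2 where T2: "\<And>t. t \<ge> T2 \<Longrightarrow> zeta (Complex (1 / 2) t) \<noteq> 0 \<Longrightarrow>
     0 < - Re (deriv zeta (Complex (1 / 2) t) / zeta (Complex (1 / 2) t)) \<and>
     - Re (deriv zeta (Complex (1 / 2) t) / zeta (Complex (1 / 2) t)) \<le> ln t"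
    using Re_zeta_log_deriv_half_bounds by blast
  \<comment> \<open>The first entry serves \<open>L * (b - a) \<le> 1 / 20\<close> with
    \<open>L = ln b\<close>, the second \<open>K * (b - a)\<^sup>2 \<le> 1 / 4\<close> with
    \<open>K = K0 * ln a\<close>, where one factor \<open>b - a\<close> is spent against the
    logarithm and the other is at most 1.\<close>
  define c where "c = min (1 / 20) (1 / (4 * K0))"
  have c: "c > 0" "c \<le> 1 / 20" "K0 * c \<le> 1 / 4" using K0 by (auto simp: c_def min_def field_simps)
  have "\<exists>s. deriv zeta s = 0 \<and> a < Im s \<and> Im s < b \<and> 1 / 2 < Re s \<and> Re s \<le> 1 / 2 + ln b * (b - a)\<^sup>2 / 4"
    if a: "max T1 T2 \<le> a" and ab: "a < b" and za: "zeta (Complex (1 / 2) a) = 0" and zb: "zeta (Complex (1 / 2) b) = 0"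
      and gap: "\<And>s. zeta s = 0 \<Longrightarrow> Im s \<le> a \<or> b \<le> Im s" and small: "(b - a) * ln b \<le> c" for a b
  proof -
    have a4: "a \<ge> 4" "a \<ge> T1" "a \<ge> T2" using a K0 by auto
    define \<delta> where "\<delta> = b - a"
    have "exp 1 \<le> (3::real)" using exp_le by simp
    then have "ln (exp 1) \<le> ln b" using a4 ab by (intro ln_mono) auto
    then have lnb: "1 \<le> ln b" by simp
    have \<delta>1: "\<delta> * ln b \<le> c" "0 < \<delta>" using small ab by (auto simp: \<delta>_def)
    have "\<delta> * 1 \<le> \<delta> * ln b" using lnb \<delta>1 by (intro mult_left_mono) auto
    then have "\<delta> \<le> 1 / 20" using \<delta>1(1) c(2) by linarith
    then have \<delta>: "0 < \<delta>" "\<delta> \<le> 1 / 20" "\<delta> * ln b \<le> c" using \<delta>1 by blast+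
    define f where "f = (\<lambda>z. zeta (z + Complex 2 a))"
    define Z where "Z = {p \<in> cball 0 (9 / 5). f p = 0}"
    have finZ: "finite Z" using loc(1)[OF a4(2)] by (simp add: Z_def f_def)
    obtain n E where n: "\<And>p. p \<in> Z \<Longrightarrow> 1 \<le> (n p :: nat)" and E: "E holomorphic_on ball 0 (9 / 5)"
      and fE: "\<And>z. z \<in> ball 0 (9 / 5) \<Longrightarrow> f z \<noteq> 0 \<Longrightarrow> deriv f z / f z = (\<Sum>p\<in>Z. of_nat (n p) / (z - p)) + E z"
      and Ed: "\<And>z. z \<in> ball 0 (17 / 10) \<Longrightarrow> norm (deriv E z) \<le> K0 * ln a"
      using loc(2)[OF a4(2)] unfolding local_log_deriv_def f_def[symmetric] Z_def[symmetric] by blast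
    \<comment> \<open>The point \<open>1 / 2 + \<i> * y\<close> seen from the centre
      \<open>2 + \<i> * a\<close>.\<close>
    define P where "P = (\<lambda>y. Complex (- 3 / 2) (y - a))"
    define S where "S = (\<lambda>p. Im p + a) ` Z"
    have Z_P: "p = P (Im p + a)" if "p \<in> Z" for p
    proof -
      have p: "zeta (p + Complex 2 a) = 0" "norm p \<le> 9 / 5" using that by (auto simp: Z_def f_def)
      have "Im (p + Complex 2 a) \<noteq> 0" using abs_Im_le_cmod[of p] p a4 by auto
      then have "Re (p + Complex 2 a) = 1 / 2" by (rule riemann_hypothesisD[OF RH p(1)])
      then show ?thesis by (auto simp: P_def complex_eq_iff)
    qed
    have PS: "P y \<in> Z" if "y \<in> S" for y using that Z_P by (auto simp: S_def)
    have inj: "inj_on P S" by (auto simp: inj_on_def P_def)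
    have imgP: "P ` S = Z" using PS Z_P by (auto simp: S_def image_iff)
    have Pshift: "P y + Complex 2 a = Complex (1 / 2) y" for y by (simp add: P_def complex_eq_iff)
    \<comment> \<open>Passes from the coordinates of \<open>zero_in_gap\<close>, where
      \<open>z\<close> stands for the point \<open>z + 1 / 2\<close>, to those of the disc.\<close>
    define h where "h = (\<lambda>z. z - Complex (3 / 2) a)"
    have hP: "h z - P y = z - \<i> * of_real y" for z y by (simp add: h_def P_def complex_eq_iff)
    have hshift: "h z + Complex 2 a = z + 1 / 2" for z by (simp add: h_def complex_eq_iff)
    have box: "norm (h z) \<le> 8 / 5" if "a \<le> Im z" "Im z \<le> b" "\<bar>Re z\<bar> \<le> b - a" for z
    proof -
      have "norm (h z) \<le> \<bar>Re (h z)\<bar> + \<bar>Im (h z)\<bar>" by (rule cmod_le)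
      also have "\<dots> \<le> 3 / 2 + \<delta> + \<delta>" using that by (auto simp: h_def \<delta>_def)
      finally show ?thesis using \<delta> by simp
    qed
    have PN: "P y \<in> Z" if "zeta (Complex (1 / 2) y) = 0" "a \<le> y" "y \<le> b" for y
    proof -
      have "h (\<i> * of_real y) = P y" by (simp add: h_def P_def complex_eq_iff)
      then have "norm (P y) \<le> 8 / 5" using box[of "\<i> * of_real y"] that \<delta> by (simp add: \<delta>_def)
      then show ?thesis using that by (simp add: Z_def f_def Pshift)
    qed
    have aS: "a \<in> S" using PN[of a] za ab by (force simp: S_def P_def)
    have bS: "b \<in> S" using PN[of b] zb ab by (force simp: S_def P_def)
    have Sgap: "y \<le> a \<or> b \<le> y" if "y \<in> S" for y
      using gap[of "Complex (1 / 2) y"] PS[OF that] by (simp add: Z_def f_def Pshift)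
    have fin: "finite S" using finZ by (simp add: S_def)
    define m where "m = (\<lambda>y. real (n (P y)))"
    define E' where "E' = (\<lambda>z. E (h z))"
    have hsum: "(\<Sum>p\<in>Z. of_nat (n p) / (h z - p)) = (\<Sum>y\<in>S. of_real (m y) / (z - \<i> * of_real y))" for z
      unfolding imgP[symmetric] sum.reindex[OF inj] o_def hP m_def by simp
    have fder: "deriv f (h z) = deriv zeta (z + 1 / 2)" if "z + 1 / 2 \<noteq> 1" for z
    proof -
      have "(zeta has_field_derivative deriv zeta (z + 1 / 2)) (at (h z + Complex 2 a))"
        unfolding hshift by (rule holomorphic_derivI[OF zeta_holomorphic open_punctured_complex]) (use that in auto)
      then have "(f has_field_derivative deriv zeta (z + 1 / 2)) (at (h z))"
        unfolding f_def DERIV_shift .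
      then show ?thesis by (rule DERIV_imp_deriv)
    qed
    have key: "deriv zeta (z + 1 / 2) / zeta (z + 1 / 2) = (\<Sum>y\<in>S. of_real (m y) / (z - \<i> * of_real y)) + E' z"
      if "a \<le> Im z" "Im z \<le> b" "\<bar>Re z\<bar> \<le> b - a" "zeta (z + 1 / 2) \<noteq> 0" for z
    proof -
      have "z + 1 / 2 \<noteq> 1" using that a4 by (auto simp: complex_eq_iff)
      then show ?thesis
        using fE[of "h z"] box[OF that(1-3)] that(4) fder[of z] unfolding hsum E'_def by (simp add: f_def hshift)
    qed
    have online: "zeta (Complex (1 / 2) t) \<noteq> 0" "Re (E' (\<i> * of_real t)) = Re (deriv zeta (Complex (1 / 2) t) / zeta (Complex (1 / 2) t))"
      if t: "a < t" "t < b" for t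
    proof -
      show nz: "zeta (Complex (1 / 2) t) \<noteq> 0" using gap[of "Complex (1 / 2) t"] t by auto
      have e: "\<i> * of_real t + 1 / 2 = Complex (1 / 2) t" by (simp add: complex_eq_iff)
      have "Re (\<Sum>y\<in>S. of_real (m y) / (\<i> * of_real t - \<i> * of_real y)) = 0"
      proof -
        have "of_real (m y) / (\<i> * of_real t - \<i> * of_real y) = - \<i> * of_real (m y / (t - y))" for y
          by (cases "t = y") (simp_all add: divide_simps, simp_all add: algebra_simps)
        then show ?thesis by (simp add: Re_sum)
      qed
      then show "Re (E' (\<i> * of_real t)) = Re (deriv zeta (Complex (1 / 2) t) / zeta (Complex (1 / 2) t))"
        using key[of "\<i> * of_real t"] t nz ab unfolding e by simp
    qed
    have Eder: "(E has_field_derivative deriv E z) (at z within ball 0 (17 / 10))" if "z \<in> ball 0 (17 / 10)" for z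
      by (rule has_field_derivative_at_within, rule holomorphic_derivI[OF E open_ball]) (use that in simp)
    have "\<exists>z. a < Im z \<and> Im z < b \<and> 0 < Re z \<and> Re z \<le> ln b * (b - a)\<^sup>2 / 4 \<and>
            (\<Sum>y\<in>S. of_real (m y) / (z - \<i> * of_real y)) + E' z = 0"
    proof (rule zero_in_gap[where U = "h -` ball 0 (9 / 5)" and K = "K0 * ln a"])
      show "finite S" "a \<in> S" "b \<in> S" "a < b" by (fact fin aS bS ab)+
      show "y \<le> a \<or> b \<le> y" if "y \<in> S" for y by (rule Sgap[OF that])
      show "1 \<le> m y" if "y \<in> S" for y using n[OF PS[OF that]] by (simp add: m_def)
      show "open (h -` ball 0 (9 / 5))" unfolding h_def by (intro open_vimage open_ball continuous_intros)
      have "(E \<circ> h) holomorphic_on h -` ball 0 (9 / 5)"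
        by (rule holomorphic_on_compose_gen[OF _ E]) (auto simp: h_def intro!: holomorphic_intros)
      then show "E' holomorphic_on h -` ball 0 (9 / 5)" by (simp add: E'_def o_def)
      show "z \<in> h -` ball 0 (9 / 5)" if "a \<le> Im z" "Im z \<le> b" "\<bar>Re z\<bar> \<le> b - a" for z
        using box[OF that] by simp
      show "norm (E' z - E' w) \<le> K0 * ln a * norm (z - w)"
        if "a \<le> Im z" "Im z \<le> b" "\<bar>Re z\<bar> \<le> b - a" "a \<le> Im w" "Im w \<le> b" "\<bar>Re w\<bar> \<le> b - a" for z w
      proof -
        have "norm (E (h z) - E (h w)) \<le> K0 * ln a * norm (h z - h w)"
          by (rule field_differentiable_bound[of "ball 0 (17 / 10)", OF _ Eder Ed])
             (use box[OF that(1-3)] box[OF that(4-6)] in auto)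
        then show ?thesis by (simp add: E'_def h_def)
      qed
      show "Re (E' (\<i> * of_real t)) < 0" if "a < t" "t < b" for t
        unfolding online(2)[OF that] using T2[of t] online(1)[OF that] that a4 by fastforce
      show "- Re (E' (\<i> * of_real t)) \<le> ln b" if t: "a < t" "t < b" for t
      proof -
        have "- Re (E' (\<i> * of_real t)) \<le> ln t"
          unfolding online(2)[OF t] using T2[of t] online(1)[OF t] t a4 by fastforce
        also have "\<dots> \<le> ln b" using t a4 by simp
        finally show ?thesis .
      qed
      show "ln b * (b - a) \<le> 1 / 20" using \<delta> c by (simp add: \<delta>_def mult.commute)
      have "ln a \<le> ln b" using a4 ab by simp
      then have "K0 * ln a * \<delta>\<^sup>2 \<le> K0 * ln b * \<delta>\<^sup>2" using K0 by (intro mult_right_mono mult_left_mono) auto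
      also have "\<dots> = K0 * (\<delta> * ln b) * \<delta>" by (simp add: power2_eq_square)
      also have "\<dots> \<le> K0 * c * 1" using \<delta> K0 c lnb by (intro mult_mono) auto
      also have "\<dots> \<le> 1 / 4" using c by simp
      finally show "K0 * ln a * (b - a)\<^sup>2 \<le> 1 / 4" by (simp add: \<delta>_def)
      show "0 \<le> K0 * ln a" using K0 a4 by simp
    qed
    then obtain z where z: "a < Im z" "Im z < b" "0 < Re z" "Re z \<le> ln b * (b - a)\<^sup>2 / 4"
      "(\<Sum>y\<in>S. of_real (m y) / (z - \<i> * of_real y)) + E' z = 0" by blast
    have "ln b * (b - a)\<^sup>2 / 4 = (\<delta> * ln b) * \<delta> / 4" by (simp add: \<delta>_def power2_eq_square)
    also have "\<dots> \<le> 1 * \<delta> / 4" using \<delta> c lnb by (intro divide_right_mono mult_right_mono) auto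
    finally have Rz: "\<bar>Re z\<bar> \<le> b - a" using z \<delta> by (simp add: \<delta>_def)
    \<comment> \<open>Off the critical line zeta has no zero at this height, so the zero of the
      logarithmic derivative is one of the derivative and not an artefact of a vanishing
      denominator.\<close>
    have nz: "zeta (z + 1 / 2) \<noteq> 0"
    proof
      assume "zeta (z + 1 / 2) = 0"
      then have "Re (z + 1 / 2) = 1 / 2" by (rule riemann_hypothesisD[OF RH]) (use z a4 in auto)
      then show False using z by simp
    qed
    have "deriv zeta (z + 1 / 2) = 0"
      using key[of z] z Rz nz by simp
    then show ?thesis using z by (intro exI[of _ "z + 1 / 2"]) auto
  qed
  then show ?thesis using c K0 by (intro exI[of _ c] conjI exI[of _ "max T1 T2"]) auto
qed

section \<open>Counting gaps and zeros of the derivative\<close>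

lemma finite_zeros_compact:
  assumes "f holomorphic_on - {1}" "\<not> f constant_on - {1}" "compact K" "1 \<notin> K"
  shows "finite {s \<in> K. f s = 0}"
  by (rule holomorphic_compact_finite_zeros[OF assms(1) open_punctured_complex connected_punctured_complex assms(3) _ assms(2)])
     (use assms in auto)

definition zeros_upto :: "real \<Rightarrow> complex set" where
  "zeros_upto t = {\<rho>. zeta \<rho> = 0 \<and> 0 < Im \<rho> \<and> Im \<rho> \<le> t}"

lemma zero_count_def': "zero_count t = sum (zero_mult zeta) (zeros_upto t)"
  by (simp add: zero_count_def zeros_upto_def)

context
  assumes RH: riemann_hypothesis
begin

lemma finite_zeros_upto: "finite (zeros_upto t)"
proof (rule finite_subset)
  show "zeros_upto t \<subseteq> {s \<in> cbox (Complex (1 / 2) 0) (Complex (1 / 2) t). zeta s = 0}"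
    using riemann_hypothesisD[OF RH] by (auto simp: zeros_upto_def in_cbox_complex_iff)
  show "finite {s \<in> cbox (Complex (1 / 2) 0) (Complex (1 / 2) t). zeta s = 0}"
    by (rule finite_zeros_compact[OF zeta_holomorphic zeta_not_constant]) (auto simp: in_cbox_complex_iff)
qed

lemma zero_mult_zeta_pos: "\<rho> \<in> zeros_upto t \<Longrightarrow> 1 \<le> zero_mult zeta \<rho>"
  by (rule zero_mult_pos[OF zeta_holomorphic zeta_not_constant]) (auto simp: zeros_upto_def)

lemma zeros_upto_mono: "s \<le> t \<Longrightarrow> zeros_upto s \<subseteq> zeros_upto t"
  by (auto simp: zeros_upto_def)

lemma zero_count_mono: "s \<le> t \<Longrightarrow> zero_count s \<le> zero_count t"
  unfolding zero_count_def' by (intro sum_mono2 finite_zeros_upto zeros_upto_mono) auto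

text \<open>The counting function jumps only at ordinates of zeros, finitely many of them up to
  \<open>T\<close>, so the infimum that defines \<open>zero_ordinate\<close> is a minimum.\<close>

lemma zero_ordinate_least:
  assumes n: "1 \<le> n" and reach: "n \<le> zero_count T"
  shows "zeta (Complex (1 / 2) (zero_ordinate n)) = 0" and "0 < zero_ordinate n"
    and "n \<le> zero_count (zero_ordinate n)"
    and "\<And>t. n \<le> zero_count t \<Longrightarrow> zero_ordinate n \<le> t"
proof -
  define Y where "Y = Im ` zeros_upto T"
  have finY: "finite Y" by (simp add: Y_def finite_zeros_upto)
  \<comment> \<open>If the count reaches \<open>n\<close> at \<open>t\<close>, it does so already at
    the highest ordinate not above \<open>t\<close>.\<close>
  have low: "\<exists>y\<in>Im ` zeros_upto t. n \<le> zero_count y \<and> y \<le> t" if "n \<le> zero_count t" for t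
  proof -
    have ne: "Im ` zeros_upto t \<noteq> {}" using that n by (auto simp: zero_count_def')
    define y where "y = Max (Im ` zeros_upto t)"
    have fin: "finite (Im ` zeros_upto t)" by (simp add: finite_zeros_upto)
    have y: "y \<in> Im ` zeros_upto t" unfolding y_def by (rule Max_in[OF fin ne])
    have "Im \<rho> \<le> y" if "\<rho> \<in> zeros_upto t" for \<rho> unfolding y_def using that fin by (intro Max_ge) auto
    then have "zeros_upto t \<subseteq> zeros_upto y" by (auto simp: zeros_upto_def)
    then have "zero_count t \<le> zero_count y"
      unfolding zero_count_def' by (intro sum_mono2 finite_zeros_upto) auto
    then show ?thesis using that y by (intro bexI[of _ y]) (auto simp: zeros_upto_def)
  qed
  define Q where "Q = {y \<in> Y. n \<le> zero_count y}"
  have Q: "finite Q" "Q \<noteq> {}" using finY low[OF reach] by (auto simp: Q_def Y_def)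
  define y where "y = Min Q"
  have yQ: "y \<in> Q" unfolding y_def by (rule Min_in[OF Q])
  have y0: "0 < y" using yQ by (auto simp: Q_def Y_def zeros_upto_def)
  have least: "y \<le> t" if nt: "n \<le> zero_count t" for t
  proof (rule ccontr)
    assume "\<not> y \<le> t"
    obtain x where x: "x \<in> Im ` zeros_upto t" "n \<le> zero_count x" "x \<le> t" using low[OF nt] by blast
    have "y \<le> T" using yQ by (auto simp: Q_def Y_def zeros_upto_def)
    then have "x \<in> Y" using x(1) zeros_upto_mono[of t T] \<open>\<not> y \<le> t\<close> by (auto simp: Y_def)
    then have "x \<in> Q" using x by (simp add: Q_def)
    then have "y \<le> x" unfolding y_def using Q by (intro Min_le) auto
    then show False using x \<open>\<not> y \<le> t\<close> by simp
  qed
  have eq: "zero_ordinate n = y"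
    unfolding zero_ordinate_def by (rule cInf_eq_minimum) (use yQ y0 least in \<open>auto simp: Q_def\<close>)
  obtain \<rho> where \<rho>: "\<rho> \<in> zeros_upto T" "Im \<rho> = y" using yQ by (auto simp: Q_def Y_def)
  then have "Re \<rho> = 1 / 2" using riemann_hypothesisD[OF RH, of \<rho>] by (auto simp: zeros_upto_def)
  then have "\<rho> = Complex (1 / 2) y" using \<rho> by (simp add: complex_eq_iff)
  then show "zeta (Complex (1 / 2) (zero_ordinate n)) = 0" using \<rho> unfolding eq by (auto simp: zeros_upto_def)
  show "0 < zero_ordinate n" "n \<le> zero_count (zero_ordinate n)" using y0 yQ unfolding eq by (auto simp: Q_def)
  show "\<And>t. n \<le> zero_count t \<Longrightarrow> zero_ordinate n \<le> t" unfolding eq by (rule least)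
qed

lemma zero_ordinate_mono:
  assumes "1 \<le> m" "m \<le> n" "n \<le> zero_count T"
  shows "zero_ordinate m \<le> zero_ordinate n"
proof -
  have "1 \<le> n" using assms by simp
  then have "m \<le> zero_count (zero_ordinate n)" using zero_ordinate_least(3)[OF _ assms(3)] assms(2) by linarith
  moreover have "m \<le> zero_count T" using assms by simp
  ultimately show ?thesis by (intro zero_ordinate_least(4)[OF assms(1)])
qed

text \<open>A zero strictly between would add at least 1 to a count that is already \<open>n\<close>
  at \<open>zero_ordinate n\<close>, so \<open>Suc n\<close> would be reached too early.\<close>

lemma no_zero_between:
  assumes n: "1 \<le> n" "Suc n \<le> zero_count T" and s: "zeta s = 0"
  shows "Im s \<le> zero_ordinate n \<or> zero_ordinate (Suc n) \<le> Im s"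
proof (rule ccontr)
  assume "\<not> ?thesis"
  then have lt: "zero_ordinate n < Im s" "Im s < zero_ordinate (Suc n)" by auto
  have 0: "0 < zero_ordinate n" using zero_ordinate_least(2)[of n T] n by auto
  have sin: "s \<in> zeros_upto (Im s)" "s \<notin> zeros_upto (zero_ordinate n)" using s lt 0 by (auto simp: zeros_upto_def)
  have "zero_count (zero_ordinate n) + zero_mult zeta s = sum (zero_mult zeta) (insert s (zeros_upto (zero_ordinate n)))"
    using sin by (simp add: zero_count_def' finite_zeros_upto)
  also have "\<dots> \<le> zero_count (Im s)" unfolding zero_count_def'
    using sin zeros_upto_mono[of "zero_ordinate n" "Im s"] lt by (intro sum_mono2 finite_zeros_upto) auto
  finally have "Suc n \<le> zero_count (Im s)"
    using zero_ordinate_least(3)[of n T] n zero_mult_zeta_pos[OF sin(1)] by simp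
  then have "zero_ordinate (Suc n) \<le> Im s" using zero_ordinate_least(4)[of "Suc n" T] n by simp
  then show False using lt by simp
qed

text \<open>Let \<open>N\<close> count the zeros below \<open>y\<close> and \<open>m\<close> be the
  multiplicity at height \<open>y\<close>. An index whose ordinate and next ordinate are both
  \<open>y\<close> satisfies \<open>N < n\<close> and \<open>Suc n \<le> N + m\<close>, which leaves
  \<open>m - 1\<close> values.\<close>

lemma card_zero_gaps:
  assumes fin: "\<And>n. n \<in> A \<Longrightarrow> 1 \<le> n \<and> Suc n \<le> zero_count T \<and> zero_ordinate n = y \<and> zero_ordinate (Suc n) = y"
  shows "card A \<le> zero_mult zeta (Complex (1 / 2) y) - 1"
proof (cases "A = {}")
  case False
  let ?\<rho> = "Complex (1 / 2) y"
  obtain n0 where "n0 \<in> A" using False by blast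
  then have y: "zeta ?\<rho> = 0" "0 < y" using zero_ordinate_least(1,2)[of n0 T] fin[of n0] by auto
  define N where "N = sum (zero_mult zeta) (zeros_upto y - {?\<rho>})"
  have in_y: "?\<rho> \<in> zeros_upto y" using y by (simp add: zeros_upto_def)
  have cnt: "zero_count y = N + zero_mult zeta ?\<rho>"
    unfolding zero_count_def' N_def using in_y by (simp add: finite_zeros_upto sum.remove)
  have "A \<subseteq> {N<..<zero_count y}"
  proof
    fix n assume n: "n \<in> A"
    have "Suc n \<le> zero_count (zero_ordinate (Suc n))" using zero_ordinate_least(3)[of "Suc n" T] fin[OF n] by simp
    then have up: "Suc n \<le> zero_count y" using fin[OF n] by simp
    have "N < n"
    proof (rule ccontr)
      assume "\<not> N < n"
      then have nN: "n \<le> N" by simp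
      have n1: "1 \<le> n" using fin[OF n] by simp
      let ?R = "zeros_upto y - {?\<rho>}"
      have ne: "Im ` ?R \<noteq> {}"
      proof
        assume "Im ` ?R = {}"
        then have "?R = {}" by (simp only: image_is_empty)
        then have "N = 0" by (simp only: N_def sum.empty)
        then show False using nN n1 by simp
      qed
      have finR: "finite (Im ` ?R)" by (simp add: finite_zeros_upto)
      define t where "t = Max (Im ` ?R)"
      have "t \<in> Im ` ?R" unfolding t_def by (rule Max_in[OF finR ne])
      then obtain \<rho> where \<rho>: "\<rho> \<in> zeros_upto y" "\<rho> \<noteq> ?\<rho>" "Im \<rho> = t" by auto
      then have "Re \<rho> = 1 / 2" using riemann_hypothesisD[OF RH, of \<rho>] by (auto simp: zeros_upto_def)
      \<comment> \<open>All zeros being on one line, no second zero has the ordinate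
        \<open>y\<close>.\<close>
      then have "t < y" using \<rho> by (auto simp: zeros_upto_def complex_eq_iff)
      have "Im \<sigma> \<le> t" if "\<sigma> \<in> ?R" for \<sigma> unfolding t_def using that finR by (intro Max_ge) auto
      then have "?R \<subseteq> zeros_upto t" by (auto simp: zeros_upto_def)
      then have "N \<le> zero_count t" unfolding N_def zero_count_def' by (intro sum_mono2 finite_zeros_upto) auto
      then have "zero_ordinate n \<le> t" using nN zero_ordinate_least(4)[of n T t] fin[OF n] by simp
      then show False using \<open>t < y\<close> fin[OF n] by simp
    qed
    then show "n \<in> {N<..<zero_count y}" using up by simp
  qed
  then have "card A \<le> card {N<..<zero_count y}" by (intro card_mono) auto
  then show ?thesis by (simp add: cnt)
qed simp

text \<open>The map \<open>\<phi>\<close> sends each short gap to a zero of the derivative, and no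
  zero is hit more often than its multiplicity. With the parameter \<open>v / (2 * pi)\<close> the
  gap window just says that length times \<open>ln T\<close> is at most \<open>v\<close>.\<close>

lemma gap_count_le_deriv_count:
  assumes v: "0 < v" and T: "4 \<le> T"
    and gapzero: "\<And>a b. \<lbrakk>T \<le> a; a < b; b \<le> 2 * T; (b - a) * ln T \<le> v; zeta (Complex (1 / 2) a) = 0;
        zeta (Complex (1 / 2) b) = 0; \<And>s. zeta s = 0 \<Longrightarrow> Im s \<le> a \<or> b \<le> Im s\<rbrakk> \<Longrightarrow>
        \<exists>s. deriv zeta s = 0 \<and> a < Im s \<and> Im s < b \<and> 1 / 2 < Re s \<and> (Re s - 1 / 2) * ln T \<le> v\<^sup>2"
    and reach: "\<And>n. \<exists>t. n \<le> zero_count t"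
  shows "(\<Sum>n | 1 \<le> n \<and> T \<le> zero_ordinate n \<and> zero_ordinate n \<le> 2 * T.
        unit_window ((zero_ordinate (Suc n) - zero_ordinate n) * ln T / (2 * pi * (v / (2 * pi)))) :: real) \<le>
     (\<Sum>\<^sub>\<infinity>\<rho>\<in>{\<rho>. deriv zeta \<rho> = 0 \<and> T \<le> Im \<rho> \<and> Im \<rho> \<le> 2 * T}.
        real (zero_mult (deriv zeta) \<rho>) * unit_window ((Re \<rho> - 1 / 2) * ln T / v\<^sup>2)) + 1"
proof -
  have lnT: "ln T > 0" using T by simp
  define I where "I = {n. 1 \<le> n \<and> T \<le> zero_ordinate n \<and> zero_ordinate n \<le> 2 * T}"
  define w where "w = (\<lambda>n. unit_window ((zero_ordinate (Suc n) - zero_ordinate n) * ln T / (2 * pi * (v / (2 * pi)))) :: real)"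
  define A where "A = {n \<in> I. (zero_ordinate (Suc n) - zero_ordinate n) * ln T \<le> v}"
  define B where "B = {\<rho>. deriv zeta \<rho> = 0 \<and> T \<le> Im \<rho> \<and> Im \<rho> \<le> 2 * T \<and> 1 / 2 \<le> Re \<rho> \<and> (Re \<rho> - 1 / 2) * ln T \<le> v\<^sup>2}"
  have zo: "zeta (Complex (1 / 2) (zero_ordinate n)) = 0" "0 < zero_ordinate n" "n \<le> zero_count (zero_ordinate n)"
      "\<And>t. n \<le> zero_count t \<Longrightarrow> zero_ordinate n \<le> t" if "1 \<le> n" for n
    using reach[of n] zero_ordinate_least[OF that] by blast+
  have mono: "zero_ordinate m \<le> zero_ordinate n" if "1 \<le> m" "m \<le> n" for m n
    using zero_ordinate_mono[OF that] reach[of n] by blast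
  have In: "n \<le> zero_count (2 * T)" if "n \<in> I" for n
  proof -
    have "n \<le> zero_count (zero_ordinate n)" using that by (intro zo) (simp add: I_def)
    also have "\<dots> \<le> zero_count (2 * T)" using that by (intro zero_count_mono) (simp add: I_def)
    finally show ?thesis .
  qed
  have finI: "finite I" by (rule finite_subset[of _ "{..zero_count (2 * T)}"]) (use In in auto)
  have wA: "w n = indicator A n" if "n \<in> I" for n
  proof -
    have "zero_ordinate n \<le> zero_ordinate (Suc n)" using that by (intro mono) (auto simp: I_def)
    then have "0 \<le> (zero_ordinate (Suc n) - zero_ordinate n) * ln T" using lnT by simp
    then show ?thesis using that v by (auto simp: w_def A_def indicator_def)
  qed
  have "(\<Sum>n\<in>I. w n) = (\<Sum>n\<in>I. indicator A n)" by (rule sum.cong) (use wA in auto)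
  also have "\<dots> = real (card A)" using finI by (simp add: indicator_def A_def sum.If_cases Int_def)
  finally have gapsum: "(\<Sum>n\<in>I. w n) = real (card A)" .
  define A' where "A' = {n \<in> A. zero_ordinate (Suc n) \<le> 2 * T}"
  have finA: "finite A" "finite A'" using finI by (auto simp: A_def A'_def)
  \<comment> \<open>If the ordinate after the \<open>n\<close>-th lies beyond \<open>2 * T\<close>,
    then \<open>n\<close> is exactly the number of zeros up to \<open>2 * T\<close>, so at most one
    index is lost.\<close>
  have "A \<subseteq> insert (zero_count (2 * T)) A'"
  proof
    fix n assume n: "n \<in> A"
    show "n \<in> insert (zero_count (2 * T)) A'"
    proof (cases "zero_ordinate (Suc n) \<le> 2 * T")
      case False
      then have "\<not> Suc n \<le> zero_count (2 * T)" using zo(4)[of "Suc n" "2 * T"] by auto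
      then show ?thesis using In[of n] n by (auto simp: A_def)
    qed (use n in \<open>auto simp: A'_def\<close>)
  qed
  then have "card A \<le> card (insert (zero_count (2 * T)) A')" using finA by (intro card_mono) auto
  also have "\<dots> \<le> card A' + 1" using finA by (simp add: card_insert_if)
  finally have cardA: "card A \<le> card A' + 1" .
  define good where "good = (\<lambda>n s. deriv zeta s = 0 \<and> zero_ordinate n < Im s \<and> Im s < zero_ordinate (Suc n) \<and>
      1 / 2 < Re s \<and> (Re s - 1 / 2) * ln T \<le> v\<^sup>2)"
  \<comment> \<open>Gaps of length 0 are sent to points of real part 1/2, the others to points of
    larger real part, so the two kinds never share a value.\<close>
  define \<phi> where "\<phi> = (\<lambda>n. if zero_ordinate n = zero_ordinate (Suc n) then Complex (1 / 2) (zero_ordinate n) else (SOME s. good n s))"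
  have A'D: "1 \<le> n" "T \<le> zero_ordinate n" "zero_ordinate n \<le> zero_ordinate (Suc n)" "zero_ordinate (Suc n) \<le> 2 * T"
    "(zero_ordinate (Suc n) - zero_ordinate n) * ln T \<le> v" if "n \<in> A'" for n
    using that mono[of n "Suc n"] by (auto simp: A'_def A_def I_def)
  have good: "good n (\<phi> n)" if n: "n \<in> A'" "zero_ordinate n \<noteq> zero_ordinate (Suc n)" for n
  proof -
    have "Im s \<le> zero_ordinate n \<or> zero_ordinate (Suc n) \<le> Im s" if "zeta s = 0" for s
      using no_zero_between[OF A'D(1)[OF n(1)] _ that] reach[of "Suc n"] by blast
    then have "\<exists>s. good n s"
      using gapzero[of "zero_ordinate n" "zero_ordinate (Suc n)"] A'D[OF n(1)] n(2) zo(1)[of n] zo(1)[of "Suc n"]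
      by (auto simp: good_def)
    then show ?thesis using n(2) by (simp add: \<phi>_def someI_ex)
  qed
  have fiber: "card {n \<in> A'. \<phi> n = y} \<le> zero_mult (deriv zeta) y \<and> y \<in> B" if yim: "y \<in> \<phi> ` A'" for y
  proof -
    obtain k where k: "k \<in> A'" "y = \<phi> k" using yim by blast
    show ?thesis
    proof (cases "zero_ordinate k = zero_ordinate (Suc k)")
      case True
      then have y: "y = Complex (1 / 2) (zero_ordinate k)" using k by (simp add: \<phi>_def)
      have eqs: "1 \<le> n \<and> Suc n \<le> zero_count (2 * T) \<and> zero_ordinate n = zero_ordinate k \<and> zero_ordinate (Suc n) = zero_ordinate k"
        if "n \<in> {n \<in> A'. \<phi> n = y}" for n
      proof -
        have nA: "n \<in> A'" "\<phi> n = y" using that by auto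
        have "zero_ordinate n = zero_ordinate (Suc n)"
        proof (rule ccontr)
          assume "zero_ordinate n \<noteq> zero_ordinate (Suc n)"
          then show False using good[OF nA(1)] nA(2) y by (simp add: good_def)
        qed
        moreover from this have "zero_ordinate n = zero_ordinate k" using nA(2) y by (simp add: \<phi>_def)
        moreover have "Suc n \<le> zero_count (zero_ordinate (Suc n))" by (intro zo) simp
        moreover have "zero_count (zero_ordinate (Suc n)) \<le> zero_count (2 * T)" using A'D(4)[OF nA(1)] by (rule zero_count_mono)
        ultimately show ?thesis using A'D(1)[OF nA(1)] by simp
      qed
      have z0: "zeta y = 0" unfolding y using zo(1) A'D(1)[OF k(1)] by blast
      have y1: "y \<noteq> 1" unfolding y by (simp add: complex_eq_iff)
      have "card {n \<in> A'. \<phi> n = y} \<le> zero_mult zeta y - 1"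
        unfolding y using card_zero_gaps[of "{n \<in> A'. \<phi> n = y}" "2 * T" "zero_ordinate k"] eqs unfolding y by blast
      moreover have c1: "1 \<le> card {n \<in> A'. \<phi> n = y}"
        using k finA by (simp add: Suc_le_eq card_gt_0_iff) blast
      \<comment> \<open>Otherwise the derivative would have order 0 at \<open>y\<close>, and the
        bound \<open>zero_mult zeta y - 1\<close> on a nonempty fibre would be 0.\<close>
      moreover have "deriv zeta y = 0"
      proof (rule ccontr)
        assume "deriv zeta y \<noteq> 0"
        moreover have "deriv zeta analytic_on {y}"
          using deriv_zeta_holomorphic open_punctured_complex y1 by (auto simp: analytic_at)
        ultimately have "zero_mult (deriv zeta) y = 0" by (simp add: zero_mult_def zorder_eq_0I)
        then show False using zero_mult_deriv_zeta[OF y1 z0] \<open>card _ \<le> zero_mult zeta y - 1\<close> c1 by simp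
      qed
      ultimately show ?thesis
        using zero_mult_deriv_zeta[OF y1 z0] A'D[OF k(1)] True v by (auto simp: B_def y)
    next
      case False
      have g: "good k y" using good[OF k(1) False] k by simp
      have y1: "y \<noteq> 1" using g A'D(2)[OF k(1)] T by (auto simp: good_def)
      have "n = k" if "n \<in> A'" "\<phi> n = y" for n
      proof -
        have "zero_ordinate n \<noteq> zero_ordinate (Suc n)"
        proof
          assume "zero_ordinate n = zero_ordinate (Suc n)"
          then have "Re y = 1 / 2" using that by (auto simp: \<phi>_def)
          then show False using g by (simp add: good_def)
        qed
        then have gn: "good n y" using good that by blast
        \<comment> \<open>The chosen zeros lie strictly inside their gaps, and the gaps of distinct
          indices do not overlap.\<close>
        show "n = k"
        proof (rule ccontr)
          assume "n \<noteq> k"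
          then consider "Suc n \<le> k" | "Suc k \<le> n" by linarith
          then show False
            using mono[of "Suc n" k] mono[of "Suc k" n] g gn by cases (auto simp: good_def)
        qed
      qed
      then have "{n \<in> A'. \<phi> n = y} \<subseteq> {k}" by blast
      then have "card {n \<in> A'. \<phi> n = y} \<le> 1" using card_mono[of "{k}"] by fastforce
      also have "1 \<le> zero_mult (deriv zeta) y"
        using g by (intro zero_mult_pos[OF deriv_zeta_holomorphic deriv_zeta_not_constant y1]) (simp add: good_def)
      finally show ?thesis using g A'D[OF k(1)] by (auto simp: B_def good_def)
    qed
  qed
  have finB: "finite B"
  proof (rule finite_subset)
    let ?K = "cbox (Complex (1 / 2) T) (Complex (1 / 2 + v\<^sup>2 / ln T) (2 * T))"
    show "B \<subseteq> {s \<in> ?K. deriv zeta s = 0}"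
      using lnT by (auto simp: B_def in_cbox_complex_iff field_simps)
    show "finite {s \<in> ?K. deriv zeta s = 0}"
      by (rule finite_zeros_compact[OF deriv_zeta_holomorphic deriv_zeta_not_constant]) (use T in \<open>auto simp: in_cbox_complex_iff\<close>)
  qed
  have "real (card A') = (\<Sum>n\<in>A'. 1)" by simp
  also have "\<dots> = (\<Sum>y\<in>\<phi> ` A'. \<Sum>n | n \<in> A' \<and> \<phi> n = y. 1)" by (rule sum.image_gen[OF finA(2)])
  also have "\<dots> = (\<Sum>y\<in>\<phi> ` A'. real (card {n \<in> A'. \<phi> n = y}))" by simp
  also have "\<dots> \<le> (\<Sum>y\<in>\<phi> ` A'. real (zero_mult (deriv zeta) y))" by (intro sum_mono) (use fiber in auto)
  also have "\<dots> \<le> (\<Sum>y\<in>B. real (zero_mult (deriv zeta) y))"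
    by (intro sum_mono2 finB) (use fiber in auto)
  also have "\<dots> = (\<Sum>\<^sub>\<infinity>\<rho>\<in>B. real (zero_mult (deriv zeta) \<rho>))" using finB by simp
  \<comment> \<open>Outside \<open>B\<close> the window vanishes: zeros left of the line give it a
    negative argument, the others an argument above 1. The infinite sum thus reduces to a finite
    one.\<close>
  also have "\<dots> = (\<Sum>\<^sub>\<infinity>\<rho>\<in>{\<rho>. deriv zeta \<rho> = 0 \<and> T \<le> Im \<rho> \<and> Im \<rho> \<le> 2 * T}.
        real (zero_mult (deriv zeta) \<rho>) * unit_window ((Re \<rho> - 1 / 2) * ln T / v\<^sup>2))"
  proof (rule infsum_cong_neutral)
    fix \<rho> assume "\<rho> \<in> {\<rho>. deriv zeta \<rho> = 0 \<and> T \<le> Im \<rho> \<and> Im \<rho> \<le> 2 * T} - B"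
    then have "Re \<rho> < 1 / 2 \<or> v\<^sup>2 < (Re \<rho> - 1 / 2) * ln T" by (auto simp: B_def)
    then have "\<not> (0 \<le> (Re \<rho> - 1 / 2) * ln T / v\<^sup>2 \<and> (Re \<rho> - 1 / 2) * ln T / v\<^sup>2 \<le> 1)"
      using lnT v by (auto simp: zero_le_divide_iff zero_le_mult_iff divide_le_eq)
    then show "real (zero_mult (deriv zeta) \<rho>) * unit_window ((Re \<rho> - 1 / 2) * ln T / v\<^sup>2) = 0"
      by (auto simp: indicator_def)
  next
    fix \<rho> assume "\<rho> \<in> B \<inter> {\<rho>. deriv zeta \<rho> = 0 \<and> T \<le> Im \<rho> \<and> Im \<rho> \<le> 2 * T}"
    then have "0 \<le> (Re \<rho> - 1 / 2) * ln T / v\<^sup>2 \<and> (Re \<rho> - 1 / 2) * ln T / v\<^sup>2 \<le> 1"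
      using lnT v by (auto simp: B_def divide_le_eq)
    then show "real (zero_mult (deriv zeta) \<rho>) = real (zero_mult (deriv zeta) \<rho>) * unit_window ((Re \<rho> - 1 / 2) * ln T / v\<^sup>2)"
      by (simp add: indicator_def)
  qed (auto simp: B_def)
  finally show ?thesis using gapsum cardA unfolding I_def[symmetric] w_def by simp
qed

end

theorem theorem1:
  assumes "riemann_hypothesis"
  shows "\<exists>c::real. c > 0 \<and> (\<forall>v::real. 0 < v \<and> v < c \<longrightarrow> m_gap (v / (2 * pi)) \<le> m_deriv (v\<^sup>2))"
proof -
  note RH = assms
  obtain c0 T0 where c0: "c0 > 0" and T0: "T0 \<ge> 4" and gap: "\<And>a b. \<lbrakk>T0 \<le> a; a < b; zeta (Complex (1 / 2) a) = 0; zeta (Complex (1 / 2) b) = 0;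
    \<forall>s. zeta s = 0 \<longrightarrow> Im s \<le> a \<or> b \<le> Im s; (b - a) * ln b \<le> c0\<rbrakk> \<Longrightarrow>
    \<exists>s. deriv zeta s = 0 \<and> a < Im s \<and> Im s < b \<and> 1 / 2 < Re s \<and> Re s \<le> 1 / 2 + ln b * (b - a)\<^sup>2 / 4"
    using deriv_zeta_zero_in_gap[OF RH] by metis
  \<comment> \<open>Halving \<open>c0\<close> pays for \<open>ln b \<le> 2 * ln T\<close>: the
    result on single gaps is phrased with the logarithm at the upper end of the gap, the counts with
    that of \<open>T\<close>.\<close>
  have "m_gap (v / (2 * pi)) \<le> m_deriv (v\<^sup>2)" if v: "0 < v" "v < c0 / 2" for v
  proof -
    define F where "F = (\<lambda>T. (\<Sum>n | 1 \<le> n \<and> T \<le> zero_ordinate n \<and> zero_ordinate n \<le> 2 * T.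
        unit_window ((zero_ordinate (Suc n) - zero_ordinate n) * ln T / (2 * pi * (v / (2 * pi)))) :: real))"
    define G where "G = (\<lambda>T. (\<Sum>\<^sub>\<infinity>\<rho>\<in>{\<rho>. deriv zeta \<rho> = 0 \<and> T \<le> Im \<rho> \<and> Im \<rho> \<le> 2 * T}.
        real (zero_mult (deriv zeta) \<rho>) * unit_window ((Re \<rho> - 1 / 2) * ln T / v\<^sup>2)))"
    have "\<forall>\<^sub>F T in at_top. F T \<le> G T + 1"
    proof (cases "\<forall>n. \<exists>t. n \<le> zero_count t")
      case True
      have "F T \<le> G T + 1" if T: "T \<ge> T0" for T
        unfolding F_def G_def
      proof (rule gap_count_le_deriv_count[OF RH v(1)])
        show T4: "4 \<le> T" using T T0 by simp
        show "\<exists>t. n \<le> zero_count t" for n using True by blast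
        fix a b assume ab: "T \<le> a" "a < b" "b \<le> 2 * T" "(b - a) * ln T \<le> v" "zeta (Complex (1 / 2) a) = 0"
          "zeta (Complex (1 / 2) b) = 0" "\<And>s. zeta s = 0 \<Longrightarrow> Im s \<le> a \<or> b \<le> Im s"
        have lnT: "ln T > 0" using T4 by simp
        have "ln b \<le> ln (2 * T)" using ab T4 by (intro ln_mono) auto
        also have "\<dots> = ln 2 + ln T" using T4 by (simp add: ln_mult)
        also have "\<dots> \<le> 2 * ln T" using T4 by simp
        finally have lnb: "ln b \<le> 2 * ln T" .
        have "(b - a) * ln b \<le> (b - a) * (2 * ln T)" using ab lnb by (intro mult_left_mono) auto
        also have "\<dots> \<le> c0" using ab v by simp
        finally obtain s where s: "deriv zeta s = 0" "a < Im s" "Im s < b" "1 / 2 < Re s" "Re s \<le> 1 / 2 + ln b * (b - a)\<^sup>2 / 4"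
          using gap[of a b] ab T by force
        have "(Re s - 1 / 2) * ln T \<le> (ln b * (b - a)\<^sup>2 / 4) * ln T" using s lnT by (intro mult_right_mono) auto
        also have "\<dots> \<le> (2 * ln T * (b - a)\<^sup>2 / 4) * ln T"
          using lnb lnT by (intro mult_right_mono divide_right_mono) auto
        also have "\<dots> = ((b - a) * ln T)\<^sup>2 / 2" by (simp add: power2_eq_square)
        also have "\<dots> \<le> v\<^sup>2 / 2" using ab lnT by (intro divide_right_mono power_mono) auto
        also have "\<dots> \<le> v\<^sup>2" by simp
        finally show "\<exists>s. deriv zeta s = 0 \<and> a < Im s \<and> Im s < b \<and> 1 / 2 < Re s \<and> (Re s - 1 / 2) * ln T \<le> v\<^sup>2"
          using s by blast
      qed
      then show ?thesis by (auto simp: eventually_at_top_linorder)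
    next
      case False
      \<comment> \<open>If the counts were bounded, the set defining a late ordinate would be empty,
        and all these ordinates would be the same real \<open>Inf {}\<close>. The ordinates would
        then be bounded, and the gap sum empty for large \<open>T\<close>.\<close>
      then obtain n0 where n0: "\<And>t. zero_count t < n0" by (auto simp: not_le)
      define e where "e = Inf ({} :: real set)"
      have un: "zero_ordinate n = e" if "n0 \<le> n" for n
      proof -
        have "{t. 0 < t \<and> n \<le> zero_count t} = {}" using n0 that by (auto simp: not_le intro: less_le_trans)
        then show ?thesis by (simp only: zero_ordinate_def e_def)
      qed
      define M where "M = Max (insert e (zero_ordinate ` {..<n0}))"
      have M: "zero_ordinate n \<le> M" for n
        unfolding M_def using un[of n] by (cases "n < n0") (auto intro!: Max_ge)
      have "F T \<le> G T + 1" if "T > M" for T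
      proof -
        have "{n. 1 \<le> n \<and> T \<le> zero_ordinate n \<and> zero_ordinate n \<le> 2 * T} = {}"
          using M that by (auto simp: not_le) (meson less_le_trans not_le)
        then have "F T = 0" unfolding F_def by (simp only: sum.empty)
        moreover have "0 \<le> G T" unfolding G_def by (rule infsum_nonneg) auto
        ultimately show ?thesis by simp
      qed
      then show ?thesis by (intro eventually_mono[OF eventually_gt_at_top[of M]])
    qed
    note ev = this
    \<comment> \<open>The extra 1 carries the weight \<open>2 * pi / (T * ln T)\<close>, which tends
      to 0 and so drops below any \<open>\<epsilon>\<close>.\<close>
    have "m_gap (v / (2 * pi)) \<le> m_deriv (v\<^sup>2) + ereal \<epsilon>" if \<epsilon>: "\<epsilon> > 0" for \<epsilon>
    proof -
      have "((\<lambda>T::real. 2 * pi / (T * ln T)) \<longlongrightarrow> 0) at_top" by real_asymp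
      then have "\<forall>\<^sub>F T in at_top. 2 * pi / (T * ln T) < \<epsilon>" using \<epsilon> by (rule order_tendstoD)
      then have le: "\<forall>\<^sub>F T in at_top. ereal (2 * pi / (T * ln T) * F T) \<le> ereal (2 * pi / (T * ln T) * G T) + ereal \<epsilon>"
        using ev eventually_gt_at_top[of 1]
      proof eventually_elim
        case (elim T)
        have p: "2 * pi / (T * ln T) > 0" using elim by simp
        have "2 * pi / (T * ln T) * F T \<le> 2 * pi / (T * ln T) * (G T + 1)"
          using elim p by (intro mult_left_mono) auto
        also have "\<dots> \<le> 2 * pi / (T * ln T) * G T + \<epsilon>" using elim by (simp add: distrib_left)
        finally show ?case by simp
      qed
      have "m_gap (v / (2 * pi)) \<le> Liminf at_top (\<lambda>T. ereal (2 * pi / (T * ln T) * G T) + ereal \<epsilon>)"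
        using Liminf_mono[OF le] by (simp only: m_gap_def F_def)
      also have "\<dots> = m_deriv (v\<^sup>2) + ereal \<epsilon>"
        by (simp only: m_deriv_def G_def) (rule Liminf_add_ereal_right, auto)
      finally show ?thesis .
    qed
    then show ?thesis by (rule ereal_le_epsilon2)
  qed
  then show ?thesis using c0 by (intro exI[of _ "c0 / 2"]) auto
qed

end
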